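(* Let $V=M(1)$ be the vertex operator algebra of $d$ free bosons ($d\ge 1$), and let $Q=\mathbb{C}[E_2,E_4,E_6]$. (a) If $v\in V$, then $Z(v,q)$ converges to a holomorphic function $f(v,q)/\eta(q)^d$ in the upper half plane (with $q=e^{2\pi i\tau}$) for some $f(v,q)\in Q$. (b) Every $f(q)\in Q$ may be realized as $f(v,q)$ for some $v\in V$.
   Context: Free boson VOA: let $\mathfrak{h}$ be a $d$-dimensional complex vector space with a non-degenerate symmetric bilinear form $(\,,\,)$, and $\hat{\mathfrak h}=\mathfrak h\otimes\mathbb C[t,t^{-1}]\oplus\mathbb CK$ with $[h\otimes t^m,h'\otimes t^n]=m(h,h')\delta_{m+n,0}K$ and $K$ central. Let $M(1)=U(\hat{\mathfrak h})\otimes_{U(\mathfrak h\otimes\mathbb C[t]\oplus\mathbb CK)}\mathbb C$, where $\mathfrak h\otimes\mathbb C[t]$ acts on $\mathbb C$ by $0$ and $K$ by $1$. Write $h(n)$ for the action of $h\otimes t^n$ and $\mathbf 1=1\otimes1$. $M(1)$ is spanned by the vectors $a_1(-n_1)\cdots a_k(-n_k)\mathbf 1$ ($a_i\in\mathfrak h$, $n_i\ge1$), with vertex operators $Y(a_1(-n_1)\cdots a_k(-n_k)\mathbf 1,z)={:}\partial^{(n_1-1)}a_1(z)\cdots\partial^{(n_k-1)}a_k(z){:}$, where $\partial^{(n)}=\frac1{n!}(d/dz)^n$, $a(z)=\sum_{n\in\mathbb Z}a(n)z^{-n-1}$ and ${:}\ {:}$ is normal ordering. The Virasoro element is $\omega=\frac12\sum_{i=1}^d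 h_i(-1)^2\mathbf 1$ for an orthonormal basis $h_1,\dots,h_d$ of $\mathfrak h$; the central charge is $c=d$; the weight-$n$ space (the $L(0)$-eigenspace) $M(1)_n$ is spanned by the vectors $a_1(-n_1)\cdots a_k(-n_k)\mathbf 1$ ($a_i\in\mathfrak h$, $n_i\ge1$) with $\sum n_i=n$. Trace functions: write $Y(v,z)=\sum_n v(n)z^{-n-1}$. For $v\in V_k$ (homogeneous of weight $k$) put $o(v)=v(k-1)$, which preserves each $V_n$; extend $o$ linearly to all $v\in V$. Then $Z(v,q)=\mathrm{tr}_V\,o(v)q^{L(0)-c/24}=q^{-c/24}\sum_n(\mathrm{tr}_{V_n}o(v))q^n$. $\eta(q)=q^{1/24}\prod_{n\ge1}(1-q^n)$. The Eisenstein series are $E_{2k}=\frac{-B_{2k}}{(2k)!}+\frac{2}{(2k-1)!}\sum_{n\ge1}\sigma_{2k-1}(n)q^n$, with $B_{2k}$ Bernoulli numbers and $\sigma_k(n)$ the sum of the $k$-th powers of the divisors of $n$. $Q$ is the ring of quasi-modular forms on $SL(2,\mathbb Z)$ (sums of mixed weights allowed). *)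

theory Defs
  imports
    "HOL-Library.Poly_Mapping"
    "HOL-Complex_Analysis.Complex_Analysis"
begin

section \<open>Complex vector spaces\<close>

class complex_vector = ab_group_add +
  fixes scaleC :: "complex \<Rightarrow> 'a \<Rightarrow> 'a" (infixr \<open>*\<^sub>C\<close> 75)
  assumes scaleC_add_right: "c *\<^sub>C (x + y) = c *\<^sub>C x + c *\<^sub>C y"
    and scaleC_add_left: "(b + c) *\<^sub>C x = b *\<^sub>C x + c *\<^sub>C x"
    and scaleC_scaleC: "b *\<^sub>C c *\<^sub>C x = (b * c) *\<^sub>C x"
    and scaleC_one: "1 *\<^sub>C x = x"

global_interpretation complex_vector: vector_space "scaleC :: complex \<Rightarrow> 'a \<Rightarrow> 'a::complex_vector"
  by unfold_locales (simp_all add: scaleC_add_right scaleC_add_left scaleC_scaleC scaleC_one)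

abbreviation clinear :: "('a::complex_vector \<Rightarrow> 'b::complex_vector) \<Rightarrow> bool"
  where "clinear \<equiv> Vector_Spaces.linear scaleC scaleC"

instantiation complex :: complex_vector
begin

definition scaleC_complex :: "complex \<Rightarrow> complex \<Rightarrow> complex"
  where "scaleC_complex c x = c * x"

instance
  by standard (simp_all add: scaleC_complex_def algebra_simps)

end

instantiation prod :: (complex_vector, complex_vector) complex_vector
begin

definition scaleC_prod :: "complex \<Rightarrow> 'a \<times> 'b \<Rightarrow> 'a \<times> 'b"
  where "scaleC_prod c x = (c *\<^sub>C fst x, c *\<^sub>C snd x)"

instance
  by standard (simp_all add: scaleC_prod_def scaleC_add_right scaleC_add_left
      scaleC_scaleC scaleC_one)

end

instantiation vec :: (complex_vector, finite) complex_vector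
begin

definition scaleC_vec :: "complex \<Rightarrow> 'a ^ 'b \<Rightarrow> 'a ^ 'b"
  where "scaleC_vec c x = (\<chi> i. c *\<^sub>C (x $ i))"

instance
  by standard (simp_all add: scaleC_vec_def vec_eq_iff scaleC_add_right scaleC_add_left
      scaleC_scaleC scaleC_one)

end

instantiation poly_mapping :: (type, complex_vector) complex_vector
begin

definition scaleC_poly_mapping :: "complex \<Rightarrow> ('a \<Rightarrow>\<^sub>0 'b) \<Rightarrow> ('a \<Rightarrow>\<^sub>0 'b)"
  where "scaleC_poly_mapping c p = Poly_Mapping.map (scaleC c) p"

lemma lookup_scaleC: "Poly_Mapping.lookup (c *\<^sub>C p) k = c *\<^sub>C Poly_Mapping.lookup p k"
  for p :: "'a \<Rightarrow>\<^sub>0 'b"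
  by (simp add: scaleC_poly_mapping_def Poly_Mapping.map.rep_eq when_def)

instance
  by standard (simp_all add: poly_mapping_eq_iff fun_eq_iff lookup_scaleC lookup_add
      scaleC_add_right scaleC_add_left scaleC_scaleC scaleC_one)

end


section \<open>Finite-dimensional spaces with a non-degenerate symmetric bilinear form\<close>

class bilinear_form_space = complex_vector +
  fixes bform :: "'a \<Rightarrow> 'a \<Rightarrow> complex"
  assumes finite_dim: "\<exists>S. finite S \<and> (\<forall>x. \<exists>c. x = (\<Sum>s\<in>S. scaleC (c s) s))"
    and bform_sym: "bform x y = bform y x"
    and bform_add: "bform (x + y) z = bform x z + bform y z"
    and bform_scale: "bform (scaleC c x) z = c * bform x z"
    and bform_nondegenerate: "(\<And>y. bform x y = 0) \<Longrightarrow> x = 0"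

text \<open>The following instances show that the class has members of every positive dimension.\<close>

instantiation complex :: bilinear_form_space
begin

definition bform_complex :: "complex \<Rightarrow> complex \<Rightarrow> complex"
  where "bform_complex x y = x * y"

instance
proof
  show "\<exists>S. finite S \<and> (\<forall>x :: complex. \<exists>c. x = (\<Sum>s\<in>S. c s *\<^sub>C s))"
    by (intro exI[of _ "{1}"]) (auto simp: scaleC_complex_def)
  fix x :: complex
  assume "\<And>y. bform x y = 0"
  from this[of 1] show "x = 0" by (simp add: bform_complex_def)
qed (simp_all add: bform_complex_def scaleC_complex_def algebra_simps)

end

lemma bilinear_form_space_finite_span:
  "\<exists>S :: 'a::bilinear_form_space set. finite S \<and> complex_vector.span S = UNIV"
proof -
  obtain S :: "'a set" where S: "finite S" "\<forall>x. \<exists>c. x = (\<Sum>s\<in>S. c s *\<^sub>C s)"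
    using finite_dim by blast
  have "x \<in> complex_vector.span S" for x
    using S(2)[rule_format, of x]
    by (metis (no_types, lifting) complex_vector.span_sum complex_vector.span_scale
        complex_vector.span_base)
  then show ?thesis using S(1) by blast
qed

instantiation vec :: (bilinear_form_space, finite) bilinear_form_space
begin

definition bform_vec :: "'a ^ 'b \<Rightarrow> 'a ^ 'b \<Rightarrow> complex"
  where "bform_vec x y = (\<Sum>i\<in>UNIV. bform (x $ i) (y $ i))"

instance
proof
  obtain S :: "'a set" where S: "finite S" "complex_vector.span S = UNIV"
    using bilinear_form_space_finite_span by auto
  define T :: "('a ^ 'b) set" where "T = (\<lambda>(i, a). axis i a) ` (UNIV \<times> S)"
  have axis: "axis i a \<in> complex_vector.span T" for i :: 'b and a :: 'a
  proof -
    have "a \<in> complex_vector.span S" using S by simp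
    then show ?thesis
    proof (induction rule: complex_vector.span_induct_alt)
      case base
      have "axis i (0::'a) = 0" by (simp add: axis_def vec_eq_iff)
      then show ?case by (simp only: complex_vector.span_zero)
    next
      case (step c x y)
      have "axis i (c *\<^sub>C x + y) = c *\<^sub>C axis i x + axis i y"
        by (simp add: axis_def vec_eq_iff scaleC_vec_def)
      moreover have "axis i x \<in> T" using step by (auto simp: T_def)
      ultimately show ?case
        using step.IH
        by (simp add: complex_vector.span_add complex_vector.span_scale complex_vector.span_base)
    qed
  qed
  have "x \<in> complex_vector.span T" for x :: "'a ^ 'b"
  proof -
    have "x = (\<Sum>i\<in>UNIV. axis i (x $ i))"
      by (simp add: vec_eq_iff axis_def if_distrib[of "\<lambda>f. f _"] sum.delta)
    also have "\<dots> \<in> complex_vector.span T"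
      by (intro complex_vector.span_sum axis)
    finally show ?thesis .
  qed
  then have "UNIV = complex_vector.span T" by auto
  moreover have fin: "finite T" using S by (simp add: T_def)
  ultimately have "\<exists>c. x = (\<Sum>s\<in>T. c s *\<^sub>C s)" for x
    using complex_vector.span_finite[OF fin] by auto
  then show "\<exists>S. finite S \<and> (\<forall>x :: 'a ^ 'b. \<exists>c. x = (\<Sum>s\<in>S. c s *\<^sub>C s))"
    using fin by blast
next
  fix x :: "'a ^ 'b"
  assume *: "\<And>y. bform x y = 0"
  have ax: "bform (x $ i) (axis j a $ i) = (if i = j then bform (x $ i) a else 0)" for i j :: 'b and a
  proof -
    have "bform z 0 = 0" for z :: 'a
      using bform_scale[of 0 0 z] by (simp add: bform_sym[of z])
    then show ?thesis by (simp add: axis_def)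
  qed
  have "bform (x $ j) a = 0" for j a
    using *[of "axis j a"] by (simp add: bform_vec_def ax)
  then have "x $ j = 0" for j by (rule bform_nondegenerate)
  then show "x = 0" by (simp add: vec_eq_iff)
next
  fix x y z :: "'a ^ 'b" and c :: complex
  show "bform x y = bform y x"
    unfolding bform_vec_def by (rule sum.cong[OF refl], rule bform_sym)
  show "bform (x + y) z = bform x z + bform y z"
    by (simp add: bform_vec_def bform_add sum.distrib)
  show "bform (c *\<^sub>C x) z = c * bform x z"
    by (simp add: bform_vec_def scaleC_vec_def bform_scale sum_distrib_left)
qed

end


section \<open>The Heisenberg algebra and its Fock module\<close>

text \<open>
  The pair \<open>(f, c)\<close> stands for the element \<open>(\<Sum>n. f n \<otimes> t ^ n) + c K\<close> of
  the affinization of \<open>'h\<close>.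
\<close>

type_synonym 'h heis = "(int \<Rightarrow>\<^sub>0 'h) \<times> complex"

definition heis_bracket :: "'h::bilinear_form_space heis \<Rightarrow> 'h heis \<Rightarrow> 'h heis"
  where "heis_bracket x y =
    (0, \<Sum>m\<in>Poly_Mapping.keys (fst x).
          of_int m * bform (Poly_Mapping.lookup (fst x) m) (Poly_Mapping.lookup (fst y) (- m)))"

text \<open>
  Formal combinations of words in a Lie algebra \<open>L\<close> form the free associative algebra on the
  set \<open>L\<close>. The relators \<open>env_relators\<close> generate (as a subspace) the two-sided ideal whose
  quotient is the universal enveloping algebra \<open>U(L)\<close>. If \<open>\<chi>\<close> is a character of a subalgebra
  \<open>b\<close>, then the module induced from it is \<open>U(L)\<close> modulo the left ideal generated by
  \<open>x - \<chi> x\<close> for \<open>x \<in> b\<close>. Here \<open>b = h \<otimes> C[t] \<oplus> C K\<close> and \<open>\<chi> (f, c) = c\<close>.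
\<close>

abbreviation word :: "'a list \<Rightarrow> ('a list \<Rightarrow>\<^sub>0 complex)"
  where "word w \<equiv> Poly_Mapping.single w 1"

inductive_set env_relators :: "('h::bilinear_form_space heis list \<Rightarrow>\<^sub>0 complex) set" where
  add: "word (u @ [x + y] @ w) - word (u @ [x] @ w) - word (u @ [y] @ w) \<in> env_relators"
| scale: "word (u @ [c *\<^sub>C x] @ w) - c *\<^sub>C word (u @ [x] @ w) \<in> env_relators"
| bracket: "word (u @ [x, y] @ w) - word (u @ [y, x] @ w) - word (u @ [heis_bracket x y] @ w)
    \<in> env_relators"

definition vacuum_relators :: "('h::bilinear_form_space heis list \<Rightarrow>\<^sub>0 complex) set"
  where "vacuum_relators =
    {word (u @ [(f, c)]) - c *\<^sub>C word u | u f c. \<forall>n\<in>Poly_Mapping.keys f. 0 \<le> n}"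

definition fock_null :: "('h::bilinear_form_space heis list \<Rightarrow>\<^sub>0 complex) set"
  where "fock_null = complex_vector.span (env_relators \<union> vacuum_relators)"

quotient_type (overloaded) 'h fock =
  "'h::bilinear_form_space heis list \<Rightarrow>\<^sub>0 complex" / "\<lambda>p q. p - q \<in> fock_null"
proof (rule equivpI)
  show "reflp (\<lambda>p q :: 'h heis list \<Rightarrow>\<^sub>0 complex. p - q \<in> fock_null)"
    by (rule reflpI) (simp add: fock_null_def complex_vector.span_zero)
  show "symp (\<lambda>p q :: 'h heis list \<Rightarrow>\<^sub>0 complex. p - q \<in> fock_null)"
    by (rule sympI) (metis complex_vector.span_neg fock_null_def minus_diff_eq)
  show "transp (\<lambda>p q :: 'h heis list \<Rightarrow>\<^sub>0 complex. p - q \<in> fock_null)"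
  proof (rule transpI)
    fix p q r :: "'h heis list \<Rightarrow>\<^sub>0 complex"
    assume "p - q \<in> fock_null" "q - r \<in> fock_null"
    then have "(p - q) + (q - r) \<in> fock_null"
      unfolding fock_null_def by (rule complex_vector.span_add)
    then show "p - r \<in> fock_null" by simp
  qed
qed

instantiation fock :: (bilinear_form_space) complex_vector
begin

lift_definition zero_fock :: "'a fock" is 0 .

lift_definition plus_fock :: "'a fock \<Rightarrow> 'a fock \<Rightarrow> 'a fock" is "(+)"
  unfolding fock_null_def by (simp only: add_diff_add complex_vector.span_add)

lift_definition uminus_fock :: "'a fock \<Rightarrow> 'a fock" is uminus
  unfolding fock_null_def by (simp only: minus_diff_minus complex_vector.span_neg)

lift_definition minus_fock :: "'a fock \<Rightarrow> 'a fock \<Rightarrow> 'a fock" is "(-)"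
proof -
  fix p q r s :: "'a heis list \<Rightarrow>\<^sub>0 complex"
  assume "p - q \<in> fock_null" "r - s \<in> fock_null"
  then have "(p - q) - (r - s) \<in> fock_null"
    unfolding fock_null_def by (rule complex_vector.span_diff)
  then show "(p - r) - (q - s) \<in> fock_null"
    by (simp add: algebra_simps)
qed

lift_definition scaleC_fock :: "complex \<Rightarrow> 'a fock \<Rightarrow> 'a fock" is scaleC
  unfolding fock_null_def
  by (simp only: complex_vector.scale_right_diff_distrib[symmetric] complex_vector.span_scale)

instance
proof
  have null0: "(0 :: 'a heis list \<Rightarrow>\<^sub>0 complex) \<in> fock_null"
    by (simp add: fock_null_def complex_vector.span_zero)
  fix x y z :: "'a fock" and b c :: complex
  show "x + y + z = x + (y + z)" by transfer (simp add: null0 add.assoc)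
  show "x + y = y + x" by transfer (simp add: null0 add.commute)
  show "0 + x = x" by transfer (simp add: null0)
  show "- x + x = 0" by transfer (simp add: null0)
  show "x - y = x + - y" by transfer (simp add: null0)
  show "c *\<^sub>C (x + y) = c *\<^sub>C x + c *\<^sub>C y" by transfer (simp add: null0 scaleC_add_right)
  show "(b + c) *\<^sub>C x = b *\<^sub>C x + c *\<^sub>C x" by transfer (simp add: null0 scaleC_add_left)
  show "b *\<^sub>C c *\<^sub>C x = (b * c) *\<^sub>C x" by transfer (simp add: null0 scaleC_scaleC)
  show "1 *\<^sub>C x = x" by transfer (simp add: null0 scaleC_one)
qed

end

definition left_mult :: "'a \<Rightarrow> ('a list \<Rightarrow>\<^sub>0 complex) \<Rightarrow> ('a list \<Rightarrow>\<^sub>0 complex)"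
  where "left_mult x p =
    (\<Sum>w\<in>Poly_Mapping.keys p. Poly_Mapping.single (x # w) (Poly_Mapping.lookup p w))"

lemma lookup_left_mult:
  "Poly_Mapping.lookup (left_mult x p) v =
    (case v of [] \<Rightarrow> 0 | y # w \<Rightarrow> if y = x then Poly_Mapping.lookup p w else 0)"
proof (cases v)
  case Nil
  then show ?thesis by (simp add: left_mult_def lookup_sum lookup_single)
next
  case (Cons y w)
  have "Poly_Mapping.lookup (left_mult x p) v =
      (\<Sum>w'\<in>Poly_Mapping.keys p. if w' = w then (if y = x then Poly_Mapping.lookup p w else 0) else 0)"
    unfolding left_mult_def lookup_sum
    by (rule sum.cong) (auto simp: lookup_single Cons when_def)
  also have "\<dots> = (if y = x then Poly_Mapping.lookup p w else 0)"
    by (simp add: sum.delta in_keys_iff)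
  finally show ?thesis by (simp add: Cons)
qed

lemma left_mult_linear:
  "left_mult x (p + q) = left_mult x p + left_mult x q"
  "left_mult x (p - q) = left_mult x p - left_mult x q"
  "left_mult x (c *\<^sub>C p) = c *\<^sub>C left_mult x p"
  "left_mult x 0 = 0"
  by (simp_all add: poly_mapping_eq_iff fun_eq_iff lookup_left_mult lookup_add lookup_minus
      lookup_scaleC scaleC_complex_def split: list.split)

lemma left_mult_word: "left_mult x (word w) = word (x # w)"
  by (simp add: left_mult_def)

lemma left_mult_fock_null:
  assumes "p \<in> fock_null"
  shows "left_mult x p \<in> fock_null"
  using assms unfolding fock_null_def
proof (induction rule: complex_vector.span_induct_alt)
  case base
  then show ?case by (simp add: left_mult_linear complex_vector.span_zero)
next
  case (step c p q)
  have "left_mult x p \<in> env_relators \<union> vacuum_relators"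
    using step(1)
  proof
    assume "p \<in> env_relators"
    then have "left_mult x p \<in> env_relators"
    proof cases
      case (add u y z w)
      then show ?thesis
        using env_relators.add[of "x # u" y z w] by (simp add: left_mult_linear left_mult_word)
    next
      case (scale u c y w)
      then show ?thesis
        using env_relators.scale[of "x # u" c y w] by (simp add: left_mult_linear left_mult_word)
    next
      case (bracket u y z w)
      then show ?thesis
        using env_relators.bracket[of "x # u" y z w] by (simp add: left_mult_linear left_mult_word)
    qed
    then show ?thesis by simp
  next
    assume "p \<in> vacuum_relators"
    then obtain u f c where p: "p = word (u @ [(f, c)]) - c *\<^sub>C word u"
      and f: "\<forall>n\<in>Poly_Mapping.keys f. 0 \<le> n"
      unfolding vacuum_relators_def by blast
    have "left_mult x p = word ((x # u) @ [(f, c)]) - c *\<^sub>C word (x # u)"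
      by (simp add: p left_mult_linear left_mult_word)
    then show ?thesis using f unfolding vacuum_relators_def by blast
  qed
  then show ?case
    unfolding left_mult_linear
    by (intro complex_vector.span_add complex_vector.span_scale step.IH
        complex_vector.span_base[of "left_mult x p"])
qed

lifting_forget poly_mapping.lifting

lift_definition heis_act :: "'h::bilinear_form_space heis \<Rightarrow> 'h fock \<Rightarrow> 'h fock" is left_mult
  by (simp only: left_mult_linear(2)[symmetric] left_mult_fock_null)

lift_definition vacuum :: "'h::bilinear_form_space fock" is "word []" .

definition mode :: "'h::bilinear_form_space \<Rightarrow> int \<Rightarrow> 'h fock \<Rightarrow> 'h fock"
  where "mode h n = heis_act (Poly_Mapping.single n h, 0)"


section \<open>Vertex operators\<close>

definition mode_prod :: "('h::bilinear_form_space \<times> int) list \<Rightarrow> 'h fock \<Rightarrow> 'h fock"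
  where "mode_prod xs w = foldr (\<lambda>(a, m). mode a m) xs w"

definition normal_ordered :: "('h::bilinear_form_space \<times> int) list \<Rightarrow> 'h fock \<Rightarrow> 'h fock"
  where "normal_ordered xs =
    mode_prod (filter (\<lambda>(a, m). m < 0) xs @ filter (\<lambda>(a, m). 0 \<le> m) xs)"

definition fock_monomial :: "('h::bilinear_form_space \<times> nat) list \<Rightarrow> 'h fock"
  where "fock_monomial xs = mode_prod (map (\<lambda>(a, n). (a, - int n)) xs) vacuum"

text \<open>
  For \<open>xs = [(a\<^sub>1, n\<^sub>1), \<dots>, (a\<^sub>k, n\<^sub>k)]\<close> this is the coefficient of \<open>z\<close> to the power
  \<open>- N - 1\<close> in the normally ordered product of the \<open>(1 / (n\<^sub>i - 1)!) (d/dz)\<close> to the power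
  \<open>n\<^sub>i - 1\<close> of \<open>a\<^sub>i(z)\<close>, applied to \<open>w\<close>. Each factor expands as the sum over \<open>m\<close> of
  \<open>((- m - 1) gchoose (n\<^sub>i - 1)) a\<^sub>i(m)\<close> times \<open>z\<close> to the power \<open>- m - n\<^sub>i\<close>.
  Only finitely many choices \<open>ms\<close> of modes contribute a nonzero vector.
\<close>

definition normal_product_coeff ::
  "('h::bilinear_form_space \<times> nat) list \<Rightarrow> int \<Rightarrow> 'h fock \<Rightarrow> 'h fock"
  where "normal_product_coeff xs N w =
    Sum_any (\<lambda>ms :: int list.
      if length ms = length xs \<and> (\<Sum>i<length xs. ms ! i + int (snd (xs ! i))) = N + 1
      then (\<Prod>i<length xs. of_int (- (ms ! i) - 1) gchoose (snd (xs ! i) - 1))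
             *\<^sub>C normal_ordered (zip (map fst xs) ms) w
      else 0)"

text \<open>\<open>vertex_op v n\<close> is the mode \<open>v(n)\<close>, i.e. the coefficient of \<open>z\<close> to the power
  \<open>- n - 1\<close> in \<open>Y(v, z)\<close>.\<close>

definition vertex_op :: "'h::bilinear_form_space fock \<Rightarrow> int \<Rightarrow> 'h fock \<Rightarrow> 'h fock"
  where "vertex_op = (THE Y.
    (\<forall>n w. clinear (\<lambda>v. Y v n w)) \<and>
    (\<forall>xs n w. (\<forall>(a, k)\<in>set xs. 1 \<le> k) \<longrightarrow>
       Y (fock_monomial xs) n w = normal_product_coeff xs n w))"


section \<open>Conformal grading and trace functions\<close>

definition orthonormal_basis :: "'h::bilinear_form_space set \<Rightarrow> bool"
  where "orthonormal_basis B \<longleftrightarrow>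
    complex_vector.independent B \<and> complex_vector.span B = UNIV \<and>
    (\<forall>x\<in>B. \<forall>y\<in>B. bform x y = (if x = y then 1 else 0))"

text \<open>The value does not depend on the orthonormal basis.\<close>

definition virasoro_element :: "'h::bilinear_form_space fock"
  where "virasoro_element = (THE \<omega>. \<exists>B. orthonormal_basis B \<and>
    \<omega> = (1 / 2) *\<^sub>C (\<Sum>h\<in>B. mode h (- 1) (mode h (- 1) vacuum)))"

text \<open>\<open>L(n)\<close> is the mode \<open>\<omega>(n + 1)\<close>.\<close>

definition virasoro_L0 :: "'h::bilinear_form_space fock \<Rightarrow> 'h fock"
  where "virasoro_L0 = vertex_op virasoro_element 1"

definition weight_space :: "nat \<Rightarrow> 'h::bilinear_form_space fock set"
  where "weight_space n = {v. virasoro_L0 v = of_nat n *\<^sub>C v}"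

definition zero_mode :: "'h::bilinear_form_space fock \<Rightarrow> 'h fock \<Rightarrow> 'h fock"
  where "zero_mode = (THE o'.
    (\<forall>w. clinear (\<lambda>v. o' v w)) \<and>
    (\<forall>k. \<forall>v\<in>weight_space k. \<forall>w. o' v w = vertex_op v (int k - 1) w))"

text \<open>The trace of an endomorphism of a finite-dimensional subspace \<open>S\<close>; it does not depend on
  the basis chosen.\<close>

definition subspace_trace :: "'a::complex_vector set \<Rightarrow> ('a \<Rightarrow> 'a) \<Rightarrow> complex"
  where "subspace_trace S f =
    (let B = (SOME B. complex_vector.independent B \<and> complex_vector.span B = S)
     in \<Sum>b\<in>B. complex_vector.representation B (f b) b)"

definition nome :: "complex \<Rightarrow> complex"
  where "nome \<tau> = exp (2 * of_real pi * \<i> * \<tau>)"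

definition dedekind_eta :: "complex \<Rightarrow> complex"
  where "dedekind_eta \<tau> = exp (2 * of_real pi * \<i> * \<tau> / 24) * prodinf (\<lambda>n. 1 - nome \<tau> ^ (n + 1))"

text \<open>The summand of \<open>Z(v, q)\<close> from the weight-\<open>n\<close> space; the central charge is the dimension
  of \<open>'h\<close>.\<close>

definition trace_term :: "'h::bilinear_form_space fock \<Rightarrow> complex \<Rightarrow> nat \<Rightarrow> complex"
  where "trace_term v \<tau> n =
    exp (- (2 * of_real pi * \<i> * \<tau> * of_nat (complex_vector.dim (UNIV :: 'h set)) / 24)) *
    (subspace_trace (weight_space n) (zero_mode v) * nome \<tau> ^ n)"


section \<open>Quasi-modular forms\<close>

fun bernoulli :: "nat \<Rightarrow> complex" where
  "bernoulli n = (if n = 0 then 1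
     else - (\<Sum>k<n. of_nat ((n + 1) choose k) * bernoulli k) / of_nat (n + 1))"

declare bernoulli.simps [simp del]

definition divisor_sigma :: "nat \<Rightarrow> nat \<Rightarrow> nat"
  where "divisor_sigma k n = (\<Sum>d | d dvd n. d ^ k)"

text \<open>The argument is half the weight: \<open>eisenstein k\<close> is \<open>E\<^sub>2\<^sub>k\<close>.\<close>

definition eisenstein :: "nat \<Rightarrow> complex \<Rightarrow> complex"
  where "eisenstein k \<tau> =
    - bernoulli (2 * k) / fact (2 * k) +
    2 / fact (2 * k - 1) *
      suminf (\<lambda>n. of_nat (divisor_sigma (2 * k - 1) (n + 1)) * nome \<tau> ^ (n + 1))"

text \<open>The ring generated over the constants by \<open>E\<^sub>2, E\<^sub>4, E\<^sub>6\<close>, as functions of \<open>\<tau>\<close>; only their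
  values on the upper half plane are meaningful.\<close>

inductive_set quasi_modular :: "(complex \<Rightarrow> complex) set" where
  const: "(\<lambda>\<tau>. c) \<in> quasi_modular"
| E2: "eisenstein 1 \<in> quasi_modular"
| E4: "eisenstein 2 \<in> quasi_modular"
| E6: "eisenstein 3 \<in> quasi_modular"
| add: "f \<in> quasi_modular \<Longrightarrow> g \<in> quasi_modular \<Longrightarrow> (\<lambda>\<tau>. f \<tau> + g \<tau>) \<in> quasi_modular"
| mult: "f \<in> quasi_modular \<Longrightarrow> g \<in> quasi_modular \<Longrightarrow> (\<lambda>\<tau>. f \<tau> * g \<tau>) \<in> quasi_modular"

definition upper_half_plane :: "complex set"
  where "upper_half_plane = {\<tau>. 0 < Im \<tau>}"

definition trace_function_converges_to ::
  "'h::bilinear_form_space fock \<Rightarrow> (complex \<Rightarrow> complex) \<Rightarrow> bool"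
  where "trace_function_converges_to v F \<longleftrightarrow>
    F holomorphic_on upper_half_plane \<and>
    (\<forall>\<tau>\<in>upper_half_plane. trace_term v \<tau> sums F \<tau>)"

end

theory Submission
  imports Defs
begin

text \<open>
  In an orthonormal basis of \<open>'h\<close> the Fock module is a polynomial ring in the variables
  \<open>b(-n)\<close>, and the monomials of weight \<open>n\<close> form a basis of the weight space. Hence the character is
  \<open>\<Prod> (1 - q\<^sup>n)\<close> to the power \<open>-d\<close>. Cyclicity of the trace and the commutation relations give a Wick
  formula: the trace of the zero mode of a monomial is the character times a sum, over the perfect
  matchings of its factors, of products of pairings. The pairing of two derivatives of free fields
  is a combination of the series \<open>S\<^sub>k = \<Sum> \<sigma>\<^sub>k(n) q\<^sup>n\<close> with \<open>k\<close> odd. A Lambert series identity expresses all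
  of these as polynomials in \<open>S\<^sub>1, S\<^sub>3, S\<^sub>5\<close>, that is, in \<open>E\<^sub>2, E\<^sub>4, E\<^sub>6\<close>; this is (a). For (b), let \<open>b\<close> be a
  unit vector. Even normally ordered powers of suitable combinations of \<open>b(z)\<close> and its first two
  derivatives realize all powers of all linear forms in \<open>S\<^sub>1, S\<^sub>3, S\<^sub>5\<close>, and these span all polynomials.
\<close>

section \<open>Orthonormal bases\<close>

text \<open>The module is a quotient by relators, so spanning sets are easy but independence of
  monomials is not visible. It comes from an explicit action on functions of multisets that respects
  the relators and so yields dual coordinates \<open>coef\<close>. \<open>vertex_op\<close>,
  \<open>zero_mode\<close> and \<open>virasoro_element\<close> are definite descriptions, so nothing
  is known about them before existence and uniqueness are proved. Infinite mode sums are avoided by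
  truncating at \<open>K\<close> and comparing power series modulo \<open>X^(n+1)\<close>. The
  Lambert identity stands in for modularity: with \<open>u_a = X^a / (1 - X^a)\<close>, the products
  \<open>u_a u_b\<close>, weighted by \<open>a b (a + b)^(2k)\<close> and
  \<open>a b (a - b)^(2k)\<close>, are grouped by \<open>N = a + b\<close> and by
  \<open>N = a - b\<close>. The incomplete sums \<open>conv_geom\<close> left by the two groupings
  cancel; what remains relates \<open>S_(2k+3)\<close> to a series \<open>conv_fps k\<close>, for
  which second differences of \<open>N^(2k+2)\<close> give another relation. For (b), a field with
  mode polynomial \<open>p + q m + r m^2\<close> has three free coefficients for the three
  generators, and complex square roots solve for them.\<close>

lemma bform_add_right: "bform x (y + z) = bform x y + bform x z"
  for x :: "'h::bilinear_form_space"
  by (metis bform_sym bform_add)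

lemma bform_scale_right: "bform x (c *\<^sub>C y) = c * bform x y"
  for x :: "'h::bilinear_form_space"
  by (metis bform_sym bform_scale)

lemma bform_zero [simp]: "bform 0 y = 0" "bform y 0 = 0"
  for y :: "'h::bilinear_form_space"
  using bform_scale[of 0 0 y] by (simp_all add: bform_sym[of y])

lemma bform_sum: "bform (\<Sum>i\<in>A. f i) y = (\<Sum>i\<in>A. bform (f i) y)"
  for y :: "'h::bilinear_form_space"
  by (induction A rule: infinite_finite_induct) (simp_all add: bform_add)

lemma bform_sum_right: "bform y (\<Sum>i\<in>A. f i) = (\<Sum>i\<in>A. bform y (f i))"
  for y :: "'h::bilinear_form_space"
  by (induction A rule: infinite_finite_induct) (simp_all add: bform_add_right)

lemma bform_diff: "bform (x - y) z = bform x z - bform y z"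
  for z :: "'h::bilinear_form_space"
  using bform_add[of "x - y" y z] by simp

definition orthonormal_family :: "'h::bilinear_form_space set \<Rightarrow> bool"
  where "orthonormal_family B \<longleftrightarrow> finite B \<and> (\<forall>x\<in>B. \<forall>y\<in>B. bform x y = (if x = y then 1 else 0))"

lemma bform_sum_orthonormal:
  assumes "orthonormal_family B" "b \<in> B"
  shows "bform (\<Sum>x\<in>B. c x *\<^sub>C x) b = c b"
proof -
  have "bform (\<Sum>x\<in>B. c x *\<^sub>C x) b = (\<Sum>x\<in>B. if x = b then c b else 0)"
    unfolding bform_sum by (rule sum.cong) (use assms in \<open>auto simp: orthonormal_family_def bform_scale\<close>)
  also have "\<dots> = c b" using assms by (auto simp: orthonormal_family_def)
  finally show ?thesis .
qed

lemma orthonormal_family_independent: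
  assumes "orthonormal_family B"
  shows "complex_vector.independent B"
proof (rule ccontr)
  assume "\<not> complex_vector.independent B"
  then obtain u where u: "(\<Sum>v\<in>B. u v *\<^sub>C v) = 0" "\<exists>v\<in>B. u v \<noteq> 0"
    using complex_vector.dependent_finite[of B] assms orthonormal_family_def by blast
  then obtain v where v: "v \<in> B" "u v \<noteq> 0" by blast
  have "bform (\<Sum>v\<in>B. u v *\<^sub>C v) v = u v" using bform_sum_orthonormal[OF assms v(1)] .
  with u v show False by simp
qed

text \<open>The vectors orthogonal to an orthonormal family complement its span, and by polarization
  a non-zero such complement contains a non-isotropic vector, so that a maximal orthonormal
  family spans.\<close>

lemma orthonormal_family_extend:
  fixes B :: "'h::bilinear_form_space set"
  assumes B: "orthonormal_family B" and x: "x \<notin> complex_vector.span B"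
  shows "\<exists>y. y \<notin> B \<and> orthonormal_family (insert y B)"
proof -
  define pr where "pr x = x - (\<Sum>b\<in>B. bform x b *\<^sub>C b)" for x
  have fin: "finite B" using B by (simp add: orthonormal_family_def)
  have pr_orth: "bform (pr x) b = 0" if "b \<in> B" for x b
    using bform_sum_orthonormal[OF B that, of "bform x"] by (simp add: pr_def bform_diff)
  have pr_x: "pr x \<noteq> 0"
  proof
    assume "pr x = 0"
    then have "x = (\<Sum>b\<in>B. bform x b *\<^sub>C b)" by (simp add: pr_def)
    also have "\<dots> \<in> complex_vector.span B"
      by (intro complex_vector.span_sum complex_vector.span_scale complex_vector.span_base)
    finally show False using x by simp
  qed
  define W where "W = {w. \<forall>b\<in>B. bform w b = 0}"
  have W_add: "w + w' \<in> W" if "w \<in> W" "w' \<in> W" for w w' using that by (simp add: W_def bform_add)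
  have pr_W: "pr z \<in> W" for z using pr_orth by (simp add: W_def)
  have "\<exists>w\<in>W. bform w w \<noteq> 0"
  proof (rule ccontr)
    assume "\<not> (\<exists>w\<in>W. bform w w \<noteq> 0)"
    then have iso: "bform w w = 0" if "w \<in> W" for w using that by blast
    have WW: "bform w w' = 0" if "w \<in> W" "w' \<in> W" for w w'
      using iso[OF W_add[OF that]] iso that by (simp add: bform_add bform_add_right bform_sym[of w' w])
    have "bform (pr x) y = 0" for y
    proof -
      have "y = pr y + (\<Sum>b\<in>B. bform y b *\<^sub>C b)" by (simp add: pr_def)
      then have "bform (pr x) y = bform (pr x) (pr y) + (\<Sum>b\<in>B. bform y b * bform (pr x) b)"
        by (metis (no_types, lifting) bform_add_right bform_scale_right bform_sum_right sum.cong)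
      then show ?thesis using WW[OF pr_W pr_W] pr_orth by simp
    qed
    then show False using pr_x bform_nondegenerate by blast
  qed
  then obtain w where w: "w \<in> W" "bform w w \<noteq> 0" by blast
  \<comment> \<open>Complex square roots allow every non-isotropic vector to be normalised.\<close>
  define y where "y = (1 / csqrt (bform w w)) *\<^sub>C w"
  have yy: "bform y y = 1"
    using w(2) by (simp add: y_def bform_scale bform_scale_right power2_eq_square[symmetric])
  have yb: "bform y b = 0" if "b \<in> B" for b using w(1) that by (simp add: y_def bform_scale W_def)
  have yb': "bform b y = 0" if "b \<in> B" for b using yb[OF that] by (simp add: bform_sym)
  have "y \<notin> B" using yy yb by fastforce
  moreover have "orthonormal_family (insert y B)"
    using B yy yb yb' fin by (auto simp: orthonormal_family_def)
  ultimately show ?thesis by blast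
qed

lemma orthonormal_family_card_le:
  assumes "orthonormal_family (B :: 'h::bilinear_form_space set)" "finite S" "complex_vector.span S = UNIV"
  shows "card B \<le> card (S :: 'h set)"
  using complex_vector.independent_span_bound[OF assms(2) orthonormal_family_independent[OF assms(1)]]
    assms(3) by simp

text \<open>The size of an orthonormal family is bounded by that of a finite spanning set, so a
  largest one exists; if it did not span, \<open>orthonormal_family_extend\<close> would enlarge
  it.\<close>

lemma orthonormal_basis_exists: "\<exists>B :: 'h::bilinear_form_space set. orthonormal_basis B"
proof -
  obtain S :: "'h set" where S: "finite S" "complex_vector.span S = UNIV"
    using bilinear_form_space_finite_span by blast
  define P where "P n \<longleftrightarrow> (\<exists>B :: 'h set. orthonormal_family B \<and> card B = n)" for n
  have P0: "P 0" unfolding P_def by (rule exI[of _ "{}"]) (simp add: orthonormal_family_def)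
  have bound: "P n \<Longrightarrow> n \<le> card S" for n
    unfolding P_def using orthonormal_family_card_le[OF _ S] by blast
  obtain n where n: "P n" "\<And>m. P m \<Longrightarrow> m \<le> n"
    using Nat.ex_has_greatest_nat[of P 0 "card S", OF P0] bound by blast
  then obtain B :: "'h set" where B: "orthonormal_family B" "card B = n" by (auto simp: P_def)
  have "complex_vector.span B = UNIV"
  proof (rule ccontr)
    assume "complex_vector.span B \<noteq> UNIV"
    then obtain x where "x \<notin> complex_vector.span B" by blast
    then obtain y where y: "y \<notin> B" "orthonormal_family (insert y B)"
      using orthonormal_family_extend[OF B(1)] by blast
    then have "P (Suc n)" using B by (auto simp: P_def orthonormal_family_def intro!: exI[of _ "insert y B"])
    then show False using n(2) by fastforce
  qed
  then have "orthonormal_basis B"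
    using B(1) orthonormal_family_independent[OF B(1)]
    by (simp add: orthonormal_basis_def orthonormal_family_def)
  then show ?thesis by blast
qed

definition onb :: "'h::bilinear_form_space set"
  where "onb = (SOME B. orthonormal_basis B)"

lemma orthonormal_basis_onb: "orthonormal_basis onb"
  unfolding onb_def by (rule someI_ex) (rule orthonormal_basis_exists)

lemma orthonormal_basis_family:
  assumes "orthonormal_basis (B :: 'h::bilinear_form_space set)"
  shows "orthonormal_family B"
proof -
  obtain S :: "'h set" where S: "finite S" "complex_vector.span S = UNIV"
    using bilinear_form_space_finite_span by blast
  then have "finite B"
    using complex_vector.independent_span_bound[of S B] assms by (simp add: orthonormal_basis_def)
  then show ?thesis using assms by (simp add: orthonormal_basis_def orthonormal_family_def)
qed

lemma orthonormal_basis_expand: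
  assumes "orthonormal_basis (B :: 'h::bilinear_form_space set)"
  shows "x = (\<Sum>b\<in>B. bform x b *\<^sub>C b)"
proof -
  have fam: "orthonormal_family B" using assms by (rule orthonormal_basis_family)
  then have fin: "finite B" by (simp add: orthonormal_family_def)
  have "x \<in> complex_vector.span B" using assms by (simp add: orthonormal_basis_def)
  then obtain c where x: "x = (\<Sum>b\<in>B. c b *\<^sub>C b)"
    using complex_vector.span_finite[OF fin] by auto
  then have "bform x b = c b" if "b \<in> B" for b using bform_sum_orthonormal[OF fam that] by simp
  then have "(\<Sum>b\<in>B. bform x b *\<^sub>C b) = (\<Sum>b\<in>B. c b *\<^sub>C b)" by (intro sum.cong) auto
  with x show ?thesis by simp
qed

lemma finite_onb [simp]: "finite (onb :: 'h::bilinear_form_space set)"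
  using orthonormal_basis_family[OF orthonormal_basis_onb[where ?'a = 'h]] by (simp add: orthonormal_family_def)

lemma bform_onb: "b \<in> onb \<Longrightarrow> b' \<in> onb \<Longrightarrow> bform b b' = (if b = b' then 1 else 0)"
  using orthonormal_basis_onb by (auto simp: orthonormal_basis_def)

lemma onb_expand: "x = (\<Sum>b\<in>onb. bform x b *\<^sub>C b)"
  by (rule orthonormal_basis_expand[OF orthonormal_basis_onb])

lemma bform_parseval:
  assumes "orthonormal_basis B"
  shows "bform x y = (\<Sum>b\<in>B. bform x b * bform y b)"
proof -
  have "bform x y = bform (\<Sum>b\<in>B. bform x b *\<^sub>C b) y"
    using arg_cong[OF orthonormal_basis_expand[OF assms, of x], of "\<lambda>z. bform z y"] .
  also have "\<dots> = (\<Sum>b\<in>B. bform x b * bform b y)"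
    by (simp only: bform_sum bform_scale)
  also have "\<dots> = (\<Sum>b\<in>B. bform x b * bform y b)"
    by (simp only: bform_sym[of y])
  finally show ?thesis .
qed

lemma card_onb: "card (onb :: 'h::bilinear_form_space set) = complex_vector.dim (UNIV :: 'h set)"
proof -
  have "orthonormal_basis (onb :: 'h set)" by (rule orthonormal_basis_onb)
  then show ?thesis
    unfolding orthonormal_basis_def
    by (metis complex_vector.dim_eq_card complex_vector.span_UNIV)
qed

section \<open>The monomial basis of the Fock module\<close>

text \<open>
  The action of \<open>b(n)\<close>, for \<open>b\<close> in the orthonormal basis, on the coefficient function of a polynomial in
  the variables \<open>b(-k)\<close>: multiplication by \<open>b(-k)\<close> for \<open>n = -k < 0\<close>, and \<open>n d/d(b(-n))\<close> for \<open>n \<ge> 0\<close>. The pair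
  \<open>(b, k)\<close> stands for the variable \<open>b(-k)\<close>.
\<close>

definition osc ::
  "'h \<Rightarrow> int \<Rightarrow> (('h \<times> nat) multiset \<Rightarrow> complex) \<Rightarrow> ('h \<times> nat) multiset \<Rightarrow> complex"
  where "osc b n F M =
    (if n < 0 then (if (b, nat (- n)) \<in># M then F (M - {#(b, nat (- n))#}) else 0)
     else of_int n * of_nat (Suc (count M (b, nat n))) * F (add_mset (b, nat n) M))"

lemma osc_linear:
  "osc b n (\<lambda>M. F M + G M) M = osc b n F M + osc b n G M"
  "osc b n (\<lambda>M. c * F M) M = c * osc b n F M"
  "osc b n (\<lambda>M. F M * c) M = osc b n F M * c"
  "osc b n (\<lambda>M. 0) M = 0"
  by (simp_all add: osc_def algebra_simps)

lemma osc_sum: "osc b n (\<lambda>M. \<Sum>i\<in>A. F i M) M = (\<Sum>i\<in>A. osc b n (F i) M)"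
  by (induction A rule: infinite_finite_induct) (simp_all add: osc_linear)

text \<open>In one order a copy of the variable is removed before its multiplicity is read off, in
  the other it is not, so the two multiplicities differ by one. This includes the case of a variable
  absent from \<open>M\<close>, where the count is 0.\<close>

lemma osc_commutator_neg_nonneg:
  assumes "m < 0" "0 \<le> n"
  shows "osc b m (osc b' n F) M - osc b' n (osc b m F) M =
    (if b = b' \<and> m + n = 0 then of_int m * F M else 0)"
proof -
  define x y where "x = (b, nat (- m))" and "y = (b', nat n)"
  have eq: "x = y \<longleftrightarrow> b = b' \<and> m + n = 0" using assms by (auto simp: x_def y_def)
  have o: "osc b m G K = (if x \<in># K then G (K - {#x#}) else 0)"
      "osc b' n G K = of_int n * of_nat (Suc (count K y)) * G (add_mset y K)" for G K
    using assms by (auto simp: osc_def x_def y_def)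
  show ?thesis
  proof (cases "x = y")
    case True
    then have n: "n = - m" using eq by simp
    show ?thesis
    proof (cases "x \<in># M")
      case xM: True
      then obtain K where "M = add_mset x K" by (metis insert_DiffM)
      then show ?thesis unfolding o using True eq n by (simp add: algebra_simps)
    next
      case False
      then have "count M x = 0" by (simp add: not_in_iff)
      then show ?thesis unfolding o using False True eq n by simp
    qed
  next
    case False
    have "add_mset y M - {#x#} = add_mset y (M - {#x#})" if "x \<in># M" using that by simp
    then show ?thesis using False unfolding eq[symmetric] by (auto simp: o)
  qed
qed

lemma osc_commutator:
  "osc b m (osc b' n F) M - osc b' n (osc b m F) M =
    (if b = b' \<and> m + n = 0 then of_int m * F M else 0)"
proof -
  consider "m < 0" "n < 0" | "m < 0" "0 \<le> n" | "0 \<le> m" "n < 0" | "0 \<le> m" "0 \<le> n" by linarith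
  then show ?thesis
  proof cases
    case 1
    define x y where "x = (b, nat (- m))" and "y = (b', nat (- n))"
    have o: "osc b m G K = (if x \<in># K then G (K - {#x#}) else 0)"
      "osc b' n G K = (if y \<in># K then G (K - {#y#}) else 0)" for G K
      using 1 by (auto simp: osc_def x_def y_def)
    have "x \<in># M \<and> y \<in># M - {#x#} \<longleftrightarrow> y \<in># M \<and> x \<in># M - {#y#}"
      using insert_subset_eq_iff[of x "{#y#}" M] insert_subset_eq_iff[of y "{#x#}" M]
      by (simp add: add_mset_commute)
    then show ?thesis using 1 by (auto simp: o diff_diff_add_mset add_mset_commute)
  next
    case 2
    then show ?thesis by (rule osc_commutator_neg_nonneg)
  next
    case 3
    have mn: "(of_int m :: complex) = - of_int n" if "n + m = 0"
      using that by (metis add.commute add_eq_0_iff of_int_minus)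
    have "osc b m (osc b' n F) M - osc b' n (osc b m F) M
        = - (if b' = b \<and> n + m = 0 then of_int n * F M else 0)"
      unfolding osc_commutator_neg_nonneg[OF 3(2,1), symmetric] by simp
    also have "\<dots> = (if b = b' \<and> m + n = 0 then of_int m * F M else 0)"
      using mn by (auto simp: add.commute[of m n])
    finally show ?thesis .
  next
    case 4
    then show ?thesis by (auto simp: osc_def add_mset_commute)
  qed
qed

text \<open>Defined on all coefficient functions, finitely supported or not, so that no closure
  property has to be checked.\<close>

definition heis_op ::
  "'h::bilinear_form_space heis \<Rightarrow> (('h \<times> nat) multiset \<Rightarrow> complex) \<Rightarrow> ('h \<times> nat) multiset \<Rightarrow> complex"
  where "heis_op x F M =
    (\<Sum>n\<in>Poly_Mapping.keys (fst x). \<Sum>b\<in>onb. bform (Poly_Mapping.lookup (fst x) n) b * osc b n F M)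
    + snd x * F M"

lemma heis_op_superset:
  assumes "finite A" "Poly_Mapping.keys (fst x) \<subseteq> A"
  shows "heis_op x F M =
    (\<Sum>n\<in>A. \<Sum>b\<in>onb. bform (Poly_Mapping.lookup (fst x) n) b * osc b n F M) + snd x * F M"
  unfolding heis_op_def
  by (rule arg_cong2[where f="(+)"], rule sum.mono_neutral_left) (use assms in \<open>auto simp: in_keys_iff\<close>)

lemma heis_op_add: "heis_op (x + y) F M = heis_op x F M + heis_op y F M"
proof -
  let ?A = "Poly_Mapping.keys (fst x) \<union> Poly_Mapping.keys (fst y)"
  have "Poly_Mapping.keys (fst (x + y)) \<subseteq> ?A" by (simp add: keys_add)
  then show ?thesis
    by (simp add: heis_op_superset[of ?A] lookup_add bform_add algebra_simps sum.distrib)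
qed

lemma heis_op_scale: "heis_op (c *\<^sub>C x) F M = c * heis_op x F M"
proof -
  let ?A = "Poly_Mapping.keys (fst x)"
  have "Poly_Mapping.keys (fst (c *\<^sub>C x)) \<subseteq> ?A"
    by (auto simp: scaleC_prod_def in_keys_iff lookup_scaleC)
  then show ?thesis
    by (simp add: heis_op_superset[of ?A] scaleC_prod_def lookup_scaleC bform_scale
        scaleC_complex_def sum_distrib_left algebra_simps)
qed

lemma heis_op_linear:
  "heis_op x (\<lambda>M. F M + G M) M = heis_op x F M + heis_op x G M"
  "heis_op x (\<lambda>M. c * F M) M = c * heis_op x F M"
  "heis_op x (\<lambda>M. 0) M = 0"
  by (simp_all add: heis_op_def osc_linear algebra_simps sum.distrib sum_distrib_left)

lemma heis_op_sum: "heis_op x (\<lambda>M. \<Sum>i\<in>A. F i M) M = (\<Sum>i\<in>A. heis_op x (F i) M)"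
  by (induction A rule: infinite_finite_induct) (simp_all add: heis_op_linear)

text \<open>This makes the coefficient functions a module over the Heisenberg algebra. Only index
  pairs with \<open>n = - m\<close> and equal basis vectors survive \<open>osc_commutator\<close>,
  and Parseval turns the sum over basis vectors into the form.\<close>

lemma heis_op_commutator:
  "heis_op x (heis_op y F) M - heis_op y (heis_op x F) M = heis_op (heis_bracket x y) F M"
proof -
  define X Y where "X = Poly_Mapping.keys (fst x)" and "Y = Poly_Mapping.keys (fst y)"
  define p q where "p m b = bform (Poly_Mapping.lookup (fst x) m) b"
    and "q m b = bform (Poly_Mapping.lookup (fst y) m) b" for m and b :: 'a
  have fin: "finite X" "finite Y" by (simp_all add: X_def Y_def)
  have pq: "bform (Poly_Mapping.lookup (fst x) m) (Poly_Mapping.lookup (fst y) (- m))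
      = (\<Sum>b\<in>onb. p m b * q (- m) b)" for m
    unfolding p_def q_def by (rule bform_parseval[OF orthonormal_basis_onb])
  have hx: "heis_op x G = (\<lambda>M. (\<Sum>(m, b)\<in>X \<times> onb. p m b * osc b m G M) + snd x * G M)" for G
    by (simp add: fun_eq_iff heis_op_def X_def p_def sum.cartesian_product)
  have hy: "heis_op y G = (\<lambda>M. (\<Sum>(n, b)\<in>Y \<times> onb. q n b * osc b n G M) + snd y * G M)" for G
    by (simp add: fun_eq_iff heis_op_def Y_def q_def sum.cartesian_product)
  have "heis_op x (heis_op y F) M - heis_op y (heis_op x F) M =
      (\<Sum>(m, b)\<in>X \<times> onb. \<Sum>(n, b')\<in>Y \<times> onb. p m b * q n b' * osc b m (osc b' n F) M)
      - (\<Sum>(n, b')\<in>Y \<times> onb. \<Sum>(m, b)\<in>X \<times> onb. p m b * q n b' * osc b' n (osc b m F) M)"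
    unfolding hx hy
    by (simp add: osc_linear osc_sum case_prod_unfold sum_distrib_left algebra_simps sum.distrib)
  also have "\<dots> = (\<Sum>(m, b)\<in>X \<times> onb. \<Sum>(n, b')\<in>Y \<times> onb.
      p m b * q n b' * (osc b m (osc b' n F) M - osc b' n (osc b m F) M))"
    by (simp add: case_prod_unfold sum_subtractf right_diff_distrib) (rule sum.swap)
  also have "\<dots> = (\<Sum>(m, b)\<in>X \<times> onb. of_int m * p m b * q (- m) b * F M)"
  proof (rule sum.cong[OF refl], clarify)
    fix m and b :: 'a
    assume b: "b \<in> onb"
    have "(\<Sum>(n, b')\<in>Y \<times> onb. p m b * q n b' * (osc b m (osc b' n F) M - osc b' n (osc b m F) M))
      = (\<Sum>z\<in>Y \<times> onb. if z = (- m, b) then of_int m * p m b * q (- m) b * F M else 0)"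
      by (rule sum.cong) (auto simp: osc_commutator add_eq_0_iff split: if_splits)
    \<comment> \<open>If \<open>- m\<close> is not a key of \<open>y\<close>, the delta sum is
      empty, and \<open>q (- m) b\<close> is 0 as well.\<close>
    also have "\<dots> = of_int m * p m b * q (- m) b * F M"
      using fin b by (simp add: sum.delta) (auto simp: Y_def q_def in_keys_iff)
    finally show "(\<Sum>(n, b')\<in>Y \<times> onb. p m b * q n b' * (osc b m (osc b' n F) M - osc b' n (osc b m F) M))
      = of_int m * p m b * q (- m) b * F M" .
  qed
  also have "\<dots> = (\<Sum>m\<in>X. of_int m * bform (Poly_Mapping.lookup (fst x) m) (Poly_Mapping.lookup (fst y) (- m))) * F M"
    unfolding pq sum.cartesian_product[symmetric]
    by (simp add: sum_distrib_left sum_distrib_right algebra_simps)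
  also have "\<dots> = heis_op (heis_bracket x y) F M"
    by (simp add: heis_op_def heis_bracket_def X_def)
  finally show ?thesis .
qed

section \<open>Descent of the polynomial action to the quotient module\<close>

definition word_coef :: "'h::bilinear_form_space heis list \<Rightarrow> ('h \<times> nat) multiset \<Rightarrow> complex"
  where "word_coef w = foldr heis_op w (\<lambda>M. if M = {#} then 1 else 0)"

definition free_coef ::
  "('h::bilinear_form_space heis list \<Rightarrow>\<^sub>0 complex) \<Rightarrow> ('h \<times> nat) multiset \<Rightarrow> complex"
  where "free_coef p M = (\<Sum>w\<in>Poly_Mapping.keys p. Poly_Mapping.lookup p w * word_coef w M)"

lemma free_coef_superset:
  assumes "finite A" "Poly_Mapping.keys p \<subseteq> A"
  shows "free_coef p M = (\<Sum>w\<in>A. Poly_Mapping.lookup p w * word_coef w M)"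
  unfolding free_coef_def
  by (rule sum.mono_neutral_left) (use assms in \<open>auto simp: in_keys_iff\<close>)

lemma free_coef_linear:
  "free_coef (p + q) M = free_coef p M + free_coef q M"
  "free_coef (c *\<^sub>C p) M = c * free_coef p M"
  "free_coef 0 M = 0"
proof -
  let ?A = "Poly_Mapping.keys p \<union> Poly_Mapping.keys q"
  have "Poly_Mapping.keys (p + q) \<subseteq> ?A" by (simp add: keys_add)
  then show "free_coef (p + q) M = free_coef p M + free_coef q M"
    by (simp add: free_coef_superset[of ?A] lookup_add algebra_simps sum.distrib)
  have "Poly_Mapping.keys (c *\<^sub>C p) \<subseteq> Poly_Mapping.keys p"
    by (auto simp: in_keys_iff lookup_scaleC scaleC_complex_def)
  then show "free_coef (c *\<^sub>C p) M = c * free_coef p M"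
    by (simp add: free_coef_superset[of "Poly_Mapping.keys p"] lookup_scaleC scaleC_complex_def
        sum_distrib_left algebra_simps)
qed (simp add: free_coef_def)

lemma free_coef_diff: "free_coef (p - q) M = free_coef p M - free_coef q M"
  using free_coef_linear(1)[of "p - q" q M] by simp

lemma free_coef_word: "free_coef (word w) = word_coef w"
  by (simp add: free_coef_def fun_eq_iff)

lemma free_coef_sum: "free_coef (\<Sum>i\<in>A. f i) M = (\<Sum>i\<in>A. free_coef (f i) M)"
  by (induction A rule: infinite_finite_induct) (simp_all add: free_coef_linear)

lemma word_coef_append: "word_coef (u @ w) = foldr heis_op u (word_coef w)"
  by (simp add: word_coef_def)

lemma foldr_heis_op_linear:
  "foldr heis_op u (\<lambda>M. F M - G M) = (\<lambda>M. foldr heis_op u F M - foldr heis_op u G M)"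
  "foldr heis_op u (\<lambda>M. F M + G M) = (\<lambda>M. foldr heis_op u F M + foldr heis_op u G M)"
  "foldr heis_op u (\<lambda>M. c * F M) = (\<lambda>M. c * foldr heis_op u F M)"
proof (induction u)
  case (Cons x u)
  have d: "heis_op x (\<lambda>M. F M - G M) M = heis_op x F M - heis_op x G M" for F G M
    using heis_op_linear(1)[of x F "\<lambda>M. - 1 * G M" M] heis_op_linear(2)[of x "- 1" G M] by simp
  case 1
  show ?case using Cons(1) by (simp add: d)
  case 2
  show ?case using Cons(2) by (simp add: heis_op_linear)
  case 3
  show ?case using Cons(3) by (simp add: heis_op_linear)
qed simp_all

text \<open>Well-definedness on the quotient. The enveloping relators vanish because
  \<open>heis_op\<close> is linear in the Lie algebra element and respects the bracket; the vacuum
  relators vanish because \<open>osc b n\<close> with \<open>n\<close> non-negative evaluates the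
  vacuum function at a non-empty multiset.\<close>

lemma free_coef_null:
  assumes "p \<in> fock_null"
  shows "free_coef p = (\<lambda>M. 0)"
  using assms unfolding fock_null_def
proof (induction rule: complex_vector.span_induct_alt)
  case base
  then show ?case by (simp add: free_coef_linear fun_eq_iff)
next
  case (step c p q)
  have "free_coef p = (\<lambda>M. 0)"
    using step(1)
  proof
    assume "p \<in> env_relators"
    then show ?thesis
    proof cases
      case (add u x y w)
      have h: "heis_op (x + y) G = (\<lambda>M. heis_op x G M + heis_op y G M)" for G
        by (simp add: fun_eq_iff heis_op_add)
      show ?thesis
        unfolding add by (rule ext) (simp add: h free_coef_diff free_coef_word word_coef_append
            foldr_heis_op_linear word_coef_def[of "_ # _"])
    next
      case (scale u c x w)
      have h: "heis_op (c *\<^sub>C x) G = (\<lambda>M. c * heis_op x G M)" for G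
        by (simp add: fun_eq_iff heis_op_scale)
      show ?thesis
        unfolding scale by (rule ext) (simp add: h free_coef_diff free_coef_linear free_coef_word word_coef_append
            foldr_heis_op_linear word_coef_def[of "_ # _"])
    next
      case (bracket u x y w)
      have h: "heis_op (heis_bracket x y) G = (\<lambda>M. heis_op x (heis_op y G) M - heis_op y (heis_op x G) M)" for G
        by (simp add: fun_eq_iff heis_op_commutator)
      show ?thesis
        unfolding bracket by (rule ext) (simp add: h free_coef_diff free_coef_word word_coef_append
            foldr_heis_op_linear word_coef_def[of "_ # _"])
    qed
  next
    assume "p \<in> vacuum_relators"
    then obtain u f c where p: "p = word (u @ [(f, c)]) - c *\<^sub>C word u"
      and f: "\<forall>n\<in>Poly_Mapping.keys f. 0 \<le> n"
      unfolding vacuum_relators_def by blast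
    have "osc b n (\<lambda>M. if M = {#} then 1 else 0) M = 0" if "0 \<le> n" for b :: 'a and n M
      using that by (simp add: osc_def)
    then have h: "heis_op (f, c) (\<lambda>M. if M = {#} then 1 else 0) = (\<lambda>M. c * (if M = {#} then 1 else 0))"
      using f by (auto simp: heis_op_def fun_eq_iff intro!: sum.neutral)
    show ?thesis
      unfolding p by (rule ext) (simp add: h free_coef_diff free_coef_linear free_coef_word word_coef_def
          foldr_heis_op_linear)
  qed
  then show ?case using step by (simp add: fun_eq_iff free_coef_linear)
qed

lift_definition coef :: "'h::bilinear_form_space fock \<Rightarrow> ('h \<times> nat) multiset \<Rightarrow> complex" is free_coef
  using free_coef_null free_coef_diff by (metis (no_types, opaque_lifting) eq_iff_diff_eq_0 ext)

lemma coef_linear: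
  "coef (v + w) M = coef v M + coef w M"
  "coef (c *\<^sub>C v) M = c * coef v M"
  "coef 0 M = 0"
  by (transfer, simp add: free_coef_linear)+

lemma coef_sum: "coef (\<Sum>i\<in>A. f i) M = (\<Sum>i\<in>A. coef (f i) M)"
  by (induction A rule: infinite_finite_induct) (simp_all add: coef_linear)

lemma coef_vacuum: "coef vacuum M = (if M = {#} then 1 else 0)"
  by transfer (simp add: free_coef_word word_coef_def)

lemma free_coef_left_mult: "free_coef (left_mult x p) M = heis_op x (free_coef p) M"
proof -
  have "free_coef (left_mult x p) M =
      (\<Sum>w\<in>Poly_Mapping.keys p. Poly_Mapping.lookup p w * heis_op x (word_coef w) M)"
    unfolding left_mult_def free_coef_sum
    by (rule sum.cong) (auto simp: free_coef_def word_coef_def)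
  also have "\<dots> = heis_op x (\<lambda>M. \<Sum>w\<in>Poly_Mapping.keys p. Poly_Mapping.lookup p w * word_coef w M) M"
    by (simp add: heis_op_sum heis_op_linear)
  finally show ?thesis by (simp add: free_coef_def[abs_def])
qed

lemma coef_heis_act: "coef (heis_act x v) M = heis_op x (coef v) M"
  by transfer (simp add: free_coef_left_mult)

lemma coef_mode: "coef (mode a n v) M = (\<Sum>b\<in>onb. bform a b * osc b n (coef v) M)"
  unfolding mode_def coef_heis_act
  by (subst heis_op_superset[of "{n}"]) auto

section \<open>Linear maps and the Heisenberg relations in the Fock module\<close>

lemma clinearI:
  assumes "\<And>v w. f (v + w) = f v + f w" "\<And>c v. f (c *\<^sub>C v) = c *\<^sub>C f v"
  shows "clinear f"
  using assms by unfold_locales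

lemma clinear_module_hom: "clinear f \<Longrightarrow> module_hom scaleC scaleC f"
  by (rule Vector_Spaces.linear.axioms(3))

lemma clinear_add: "clinear f \<Longrightarrow> f (v + w) = f v + f w"
  and clinear_scale: "clinear f \<Longrightarrow> f (c *\<^sub>C v) = c *\<^sub>C f v"
  and clinear_diff: "clinear f \<Longrightarrow> f (v - w) = f v - f w"
  and clinear_0: "clinear f \<Longrightarrow> f 0 = 0"
  by (rule module_hom.add[OF clinear_module_hom] module_hom.scale[OF clinear_module_hom]
      module_hom.diff[OF clinear_module_hom] module_hom.zero[OF clinear_module_hom], assumption)+

lemmas clinear_simps = clinear_add clinear_scale clinear_diff clinear_0

lemma clinear_comp:
  assumes f: "clinear f" and g: "clinear g"
  shows "clinear (\<lambda>v. f (g v))"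
  by (rule clinearI) (simp_all add: clinear_simps[OF f] clinear_simps[OF g])

lemma clinear_plus:
  assumes f: "clinear f" and g: "clinear g"
  shows "clinear (\<lambda>v. f v + g v)"
  by (rule clinearI) (simp_all add: clinear_simps[OF f] clinear_simps[OF g] scaleC_add_right)

lemma clinear_scaleC:
  assumes f: "clinear f"
  shows "clinear (\<lambda>v. c *\<^sub>C f v)"
  by (rule clinearI) (simp_all add: clinear_simps[OF f] scaleC_add_right scaleC_scaleC mult.commute)

lemma clinear_ident: "clinear (\<lambda>v. v)" and clinear_zero: "clinear (\<lambda>v. 0)"
  by (auto intro: clinearI)

lemma clinear_sum: "clinear f \<Longrightarrow> f (\<Sum>i\<in>A. g i) = (\<Sum>i\<in>A. f (g i))"
  by (rule module_hom.sum[OF clinear_module_hom])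

lemma clinear_heis_act: "clinear (heis_act x)"
proof (rule clinearI)
  have null0: "(0 :: 'a heis list \<Rightarrow>\<^sub>0 complex) \<in> fock_null"
    by (simp add: fock_null_def complex_vector.span_zero)
  fix v w :: "'a fock" and c
  show "heis_act x (v + w) = heis_act x v + heis_act x w" by transfer (simp add: left_mult_linear null0)
  show "heis_act x (c *\<^sub>C v) = c *\<^sub>C heis_act x v" by transfer (simp add: left_mult_linear null0)
qed

lemma fock_word_abs: "foldr heis_act w vacuum = abs_fock (word w)"
  by (induction w) (simp_all add: vacuum_def heis_act.abs_eq left_mult_word)

lemma abs_fock_linear:
  "abs_fock (p - q) = abs_fock p - abs_fock q"
  "abs_fock (p + q) = abs_fock p + abs_fock q"
  "abs_fock (c *\<^sub>C p) = c *\<^sub>C abs_fock p"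
  by (simp_all add: minus_fock.abs_eq plus_fock.abs_eq scaleC_fock.abs_eq)

lemma poly_mapping_sum_single: "p = (\<Sum>k\<in>Poly_Mapping.keys p. Poly_Mapping.single k (Poly_Mapping.lookup p k))"
  by (simp add: poly_mapping_eq_iff fun_eq_iff lookup_sum lookup_single when_def in_keys_iff)

lemma span_fock_words:
  "complex_vector.span (range (\<lambda>w. foldr heis_act w vacuum)) = (UNIV :: 'h::bilinear_form_space fock set)"
proof -
  let ?S = "complex_vector.span (range (\<lambda>w. foldr heis_act w vacuum)) :: 'h fock set"
  have s: "abs_fock (Poly_Mapping.single k v) \<in> ?S" for k :: "'h heis list" and v
  proof -
    have "Poly_Mapping.single k v = v *\<^sub>C word k"
      by (simp add: poly_mapping_eq_iff fun_eq_iff lookup_scaleC lookup_single scaleC_complex_def when_def)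
    then have "abs_fock (Poly_Mapping.single k v) = v *\<^sub>C foldr heis_act k vacuum"
      by (simp only: fock_word_abs abs_fock_linear)
    then show ?thesis by (simp add: complex_vector.span_base complex_vector.span_scale)
  qed
  have "abs_fock (\<Sum>k\<in>A. Poly_Mapping.single k (g k)) \<in> ?S" for A :: "'h heis list set" and g
    by (induction A rule: infinite_finite_induct)
      (simp_all add: abs_fock_linear s complex_vector.span_add complex_vector.span_zero flip: zero_fock_def)
  then have "abs_fock p \<in> ?S" for p
    by (subst poly_mapping_sum_single[of p])
  then have "v \<in> ?S" for v
    by (induction v rule: fock.abs_induct)
  then show ?thesis by blast
qed

lemma fock_word_induct [case_names zero step]:
  fixes v :: "'h::bilinear_form_space fock"
  assumes "P 0" "\<And>c w v. P v \<Longrightarrow> P (c *\<^sub>C foldr heis_act w vacuum + v)"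
  shows "P v"
proof -
  have "v \<in> complex_vector.span (range (\<lambda>w. foldr heis_act w vacuum))"
    by (simp add: span_fock_words)
  then show ?thesis
    by (induction rule: complex_vector.span_induct_alt) (use assms in auto)
qed

text \<open>Relators speak about words, so an operator identity is read off on words applied to the
  vacuum and extended by linearity.\<close>

lemma clinear_eq_on_words:
  fixes f g :: "'h::bilinear_form_space fock \<Rightarrow> 'b::complex_vector"
  assumes "clinear f" "clinear g" "\<And>w. f (foldr heis_act w vacuum) = g (foldr heis_act w vacuum)"
  shows "f v = g v"
  by (induction v rule: fock_word_induct)
    (simp_all add: assms(3) clinear_simps[OF assms(1)] clinear_simps[OF assms(2)])

lemma abs_fock_eq_0: "p \<in> fock_null \<Longrightarrow> abs_fock p = 0"
  unfolding zero_fock_def by (subst fock.abs_eq_iff) simp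

lemma env_relator_null: "p \<in> env_relators \<Longrightarrow> p \<in> fock_null"
  unfolding fock_null_def by (simp add: complex_vector.span_base)

lemma heis_act_add: "heis_act (x + y) v = heis_act x v + heis_act y v"
proof (rule clinear_eq_on_words[where f = "heis_act (x + y)" and g = "\<lambda>v. heis_act x v + heis_act y v"])
  fix w :: "'a heis list"
  show "heis_act (x + y) (foldr heis_act w vacuum)
    = heis_act x (foldr heis_act w vacuum) + heis_act y (foldr heis_act w vacuum)"
    using abs_fock_eq_0[OF env_relator_null[OF env_relators.add[of "[]" x y w]]]
    by (simp add: fock_word_abs heis_act.abs_eq left_mult_word abs_fock_linear algebra_simps)
qed (auto intro!: clinear_plus clinear_heis_act)

lemma heis_act_scale: "heis_act (c *\<^sub>C x) v = c *\<^sub>C heis_act x v"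
proof (rule clinear_eq_on_words[where f = "heis_act (c *\<^sub>C x)" and g = "\<lambda>v. c *\<^sub>C heis_act x v"])
  fix w :: "'a heis list"
  show "heis_act (c *\<^sub>C x) (foldr heis_act w vacuum) = c *\<^sub>C heis_act x (foldr heis_act w vacuum)"
    using abs_fock_eq_0[OF env_relator_null[OF env_relators.scale[of "[]" c x w]]]
    by (simp add: fock_word_abs heis_act.abs_eq left_mult_word abs_fock_linear)
qed (auto intro!: clinear_scaleC clinear_heis_act)

lemma heis_act_commute:
  "heis_act x (heis_act y v) = heis_act y (heis_act x v) + heis_act (heis_bracket x y) v"
proof (rule clinear_eq_on_words[where f = "\<lambda>v. heis_act x (heis_act y v)"
      and g = "\<lambda>v. heis_act y (heis_act x v) + heis_act (heis_bracket x y) v"])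
  fix w :: "'a heis list"
  show "heis_act x (heis_act y (foldr heis_act w vacuum))
    = heis_act y (heis_act x (foldr heis_act w vacuum)) + heis_act (heis_bracket x y) (foldr heis_act w vacuum)"
    using abs_fock_eq_0[OF env_relator_null[OF env_relators.bracket[of "[]" x y w]]]
    by (simp add: fock_word_abs heis_act.abs_eq left_mult_word abs_fock_linear algebra_simps)
qed (auto intro!: clinear_plus clinear_comp[OF clinear_heis_act clinear_heis_act] clinear_heis_act)

lemma heis_act_zero [simp]: "heis_act 0 v = 0"
  using heis_act_scale[of 0 0 v] by simp

lemma heis_act_vacuum:
  assumes "\<forall>n\<in>Poly_Mapping.keys f. 0 \<le> n"
  shows "heis_act (f, c) vacuum = c *\<^sub>C vacuum"
proof -
  have "word ([] @ [(f, c)]) - c *\<^sub>C word [] \<in> vacuum_relators"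
    unfolding vacuum_relators_def using assms by blast
  then have "word ([] @ [(f, c)]) - c *\<^sub>C word [] \<in> fock_null"
    unfolding fock_null_def by (simp add: complex_vector.span_base)
  from abs_fock_eq_0[OF this] show ?thesis
    by (simp add: abs_fock_linear vacuum_def heis_act.abs_eq left_mult_word)
qed

text \<open>The central element commutes past every letter of a word until it reaches the vacuum,
  where a vacuum relator supplies the scalar.\<close>

lemma heis_act_central: "heis_act (0, c) v = c *\<^sub>C v"
proof (rule clinear_eq_on_words[where f = "heis_act (0, c)" and g = "\<lambda>v. c *\<^sub>C v"])
  fix w :: "'a heis list"
  show "heis_act (0, c) (foldr heis_act w vacuum) = c *\<^sub>C foldr heis_act w vacuum"
  proof (induction w)
    case Nil
    then show ?case by (simp add: heis_act_vacuum)
  next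
    case (Cons x w)
    have "heis_bracket (0, c) x = 0" by (simp add: heis_bracket_def zero_prod_def)
    then show ?case
      using Cons by (simp add: heis_act_commute[of "(0, c)" x] clinear_scale[OF clinear_heis_act])
  qed
qed (auto intro!: clinear_heis_act clinear_scaleC clinear_ident)

lemma heis_bracket_single:
  "heis_bracket (Poly_Mapping.single m a, 0) (f, 0) = (0, of_int m * bform a (Poly_Mapping.lookup f (- m)))"
  by (simp add: heis_bracket_def)

lemma clinear_mode: "clinear (mode a n)"
  unfolding mode_def by (rule clinear_heis_act)

lemmas mode_linear =
  clinear_add[OF clinear_mode] clinear_scale[OF clinear_mode] clinear_diff[OF clinear_mode]
  clinear_0[OF clinear_mode] clinear_sum[OF clinear_mode]

lemma mode_commute:
  "mode a m (mode b n v) =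
    mode b n (mode a m v) + (if m + n = 0 then of_int m * bform a b else 0) *\<^sub>C v"
  unfolding mode_def
  by (subst heis_act_commute)
    (auto simp: heis_bracket_single heis_act_central lookup_single when_def add_eq_0_iff)

lemma mode_add_left: "mode (a + b) n v = mode a n v + mode b n v"
proof -
  have "(Poly_Mapping.single n (a + b), 0 :: complex) = (Poly_Mapping.single n a, 0) + (Poly_Mapping.single n b, 0)"
    by (simp add: single_add)
  then show ?thesis unfolding mode_def by (simp only: heis_act_add)
qed

lemma mode_scale_left: "mode (c *\<^sub>C a) n v = c *\<^sub>C mode a n v"
proof -
  have "(Poly_Mapping.single n (c *\<^sub>C a), 0 :: complex) = c *\<^sub>C (Poly_Mapping.single n a, 0)"
    by (simp add: scaleC_prod_def poly_mapping_eq_iff fun_eq_iff lookup_scaleC lookup_single when_def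
        scaleC_complex_def)
  then show ?thesis unfolding mode_def by (simp only: heis_act_scale)
qed

lemma clinear_mode_left: "clinear (\<lambda>a. mode a n v)"
  by (rule clinearI) (simp_all add: mode_add_left mode_scale_left)

lemma mode_onb: "mode a n v = (\<Sum>b\<in>onb. bform a b *\<^sub>C mode b n v)"
proof -
  have "mode a n v = mode (\<Sum>b\<in>onb. bform a b *\<^sub>C b) n v"
    by (subst onb_expand[of a]) (rule refl)
  also have "\<dots> = (\<Sum>b\<in>onb. bform a b *\<^sub>C mode b n v)"
    by (simp add: clinear_sum[OF clinear_mode_left] mode_scale_left)
  finally show ?thesis .
qed

lemma mode_vacuum: "0 \<le> n \<Longrightarrow> mode a n vacuum = 0"
  unfolding mode_def by (subst heis_act_vacuum) auto

lemma heis_act_modes: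
  "heis_act (f, c) v = (\<Sum>n\<in>Poly_Mapping.keys f. mode (Poly_Mapping.lookup f n) n v) + c *\<^sub>C v"
proof -
  have "heis_act (\<Sum>n\<in>A. (Poly_Mapping.single n (g n), 0)) v = (\<Sum>n\<in>A. mode (g n) n v)"
    if "finite A" for A g
    using that by (induction A) (simp_all add: heis_act_add mode_def)
  moreover have "(\<Sum>n\<in>A. h n, 0 :: complex) = (\<Sum>n\<in>A. (h n, 0))" if "finite A" for A and h :: "int \<Rightarrow> int \<Rightarrow>\<^sub>0 'a"
    by (simp add: prod_eq_iff fst_sum snd_sum)
  ultimately have "(\<Sum>n\<in>Poly_Mapping.keys f. mode (Poly_Mapping.lookup f n) n v)
      = heis_act (\<Sum>n\<in>Poly_Mapping.keys f. Poly_Mapping.single n (Poly_Mapping.lookup f n), 0) v"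
    by (simp only: finite_keys)
  also have "\<dots> = heis_act (f, 0) v"
    by (simp only: poly_mapping_sum_single[symmetric])
  finally have "heis_act (f, 0) v = (\<Sum>n\<in>Poly_Mapping.keys f. mode (Poly_Mapping.lookup f n) n v)" ..
  moreover have "heis_act (f, c) v = heis_act (f, 0) v + heis_act (0, c) v"
    by (subst heis_act_add[symmetric]) simp
  ultimately show ?thesis by (simp add: heis_act_central)
qed

section \<open>Monomials in the creation modes\<close>

definition mon :: "('h::bilinear_form_space \<times> nat) multiset \<Rightarrow> 'h fock"
  where "mon M = fold_mset (\<lambda>x. mode (fst x) (- int (snd x))) vacuum M"

lemma mon_empty [simp]: "mon {#} = vacuum"
  by (simp add: mon_def)

lemma mon_add_mset:
  fixes M :: "('a::bilinear_form_space \<times> nat) multiset"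
  shows "mon (add_mset x M) = mode (fst x) (- int (snd x)) (mon M)"
proof -
  interpret comp_fun_commute "\<lambda>x :: 'a \<times> nat. mode (fst x) (- int (snd x))"
  proof
    fix x y :: "'a \<times> nat"
    \<comment> \<open>Two such indices add up to 0 only if both are 0, and then the commutator
      carries the factor 0.\<close>
    have "mode (fst y) (- int (snd y)) (mode (fst x) (- int (snd x)) v)
        = mode (fst x) (- int (snd x)) (mode (fst y) (- int (snd y)) v)" for v
      by (subst mode_commute) auto
    then show "(\<lambda>x. mode (fst x) (- int (snd x))) y \<circ> (\<lambda>x. mode (fst x) (- int (snd x))) x =
        (\<lambda>x. mode (fst x) (- int (snd x))) x \<circ> (\<lambda>x. mode (fst x) (- int (snd x))) y"
      by (simp add: fun_eq_iff)
  qed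
  show ?thesis by (simp add: mon_def)
qed

lemma fock_monomial_mon: "fock_monomial xs = mon (mset xs)"
  by (induction xs) (auto simp: fock_monomial_def mode_prod_def mon_add_mset)

text \<open>Index 0 is excluded because zero modes annihilate the whole module
  (\<open>mode_zero\<close>).\<close>

definition osc_basis :: "('h::bilinear_form_space \<times> nat) multiset set"
  where "osc_basis = {M. set_mset M \<subseteq> onb \<times> {1..}}"

lemma coef_mode_onb: "b \<in> onb \<Longrightarrow> coef (mode b n v) M = osc b n (coef v) M"
proof -
  assume b: "b \<in> onb"
  have "(\<Sum>c\<in>onb. bform b c * osc c n (coef v) M) = (\<Sum>c\<in>onb. if c = b then osc b n (coef v) M else 0)"
    by (rule sum.cong) (use b in \<open>auto simp: bform_onb\<close>)
  with b show ?thesis by (simp add: coef_mode)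
qed

text \<open>The coordinates are dual to the monomials. This is the source of linear independence in
  a module given only by generators and relators.\<close>

lemma coef_mon:
  assumes "N \<in> osc_basis"
  shows "coef (mon N) M = (if M = N then 1 else 0)"
  using assms
proof (induction N arbitrary: M)
  case empty
  then show ?case by (simp add: coef_vacuum)
next
  case (add x N)
  have x: "fst x \<in> onb" "1 \<le> snd x" and N: "N \<in> osc_basis" using add.prems by (auto simp: osc_basis_def)
  have "coef (mon (add_mset x N)) M = (if x \<in># M then coef (mon N) (M - {#x#}) else 0)"
    using x by (simp add: mon_add_mset coef_mode_onb osc_def)
  also have "\<dots> = (if M = add_mset x N then 1 else 0)"
    using add.IH[OF N] by (auto dest: multi_member_split)
  finally show ?case .
qed

text \<open>The mode \<open>b(m)\<close> acts as the derivation \<open>m d/d(b(-m))\<close>. If the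
  variable does not occur, the multiset difference is just \<open>N\<close>, but the count makes the
  right-hand side 0.\<close>

lemma mode_pos_mon:
  assumes "N \<in> osc_basis" "b \<in> onb" "0 \<le> m"
  shows "mode b m (mon N) = (of_int m * of_nat (count N (b, nat m))) *\<^sub>C mon (N - {#(b, nat m)#})"
  using assms
proof (induction N)
  case empty
  then show ?case by (simp add: mode_vacuum)
next
  case (add x N)
  have x: "fst x \<in> onb" "1 \<le> snd x" and N: "N \<in> osc_basis" using add.prems by (auto simp: osc_basis_def)
  have *: "mode b m (mon (add_mset x N)) =
      (of_int m * of_nat (count N (b, nat m))) *\<^sub>C mode (fst x) (- int (snd x)) (mon (N - {#(b, nat m)#}))
      + (if m = int (snd x) then of_int m * bform b (fst x) else 0) *\<^sub>C mon N"
    using add.IH[OF N add.prems(2,3)]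
    by (simp add: mon_add_mset mode_commute[of b m] mode_linear)
  show ?case
  proof (cases "x = (b, nat m)")
    case True
    have "(of_int m * of_nat (count N (b, nat m))) *\<^sub>C mode (fst x) (- int (snd x)) (mon (N - {#(b, nat m)#}))
      = (of_int m * of_nat (count N (b, nat m))) *\<^sub>C mon N"
    proof (cases "x \<in># N")
      case True
      then show ?thesis using \<open>x = (b, nat m)\<close>
        by (metis insert_DiffM mon_add_mset)
    next
      case False
      then have "count N (b, nat m) = 0" using \<open>x = (b, nat m)\<close> by (simp add: not_in_iff)
      then show ?thesis by simp
    qed
    moreover have "(if m = int (snd x) then of_int m * bform b (fst x) else 0) = (of_int m :: complex)"
      using True assms by (simp add: bform_onb)
    moreover have "of_int m * of_nat (count (add_mset x N) (b, nat m))
        = (of_int m * of_nat (count N (b, nat m)) + of_int m :: complex)"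
      using True by (simp add: algebra_simps)
    moreover have "add_mset x N - {#(b, nat m)#} = N" using True by simp
    ultimately show ?thesis unfolding * by (simp only: scaleC_add_left)
  next
    case False
    then have 0: "(if m = int (snd x) then of_int m * bform b (fst x) else 0) = 0"
      using x add.prems by (cases x) (auto simp: bform_onb)
    have "mode (fst x) (- int (snd x)) (mon (N - {#(b, nat m)#})) = mon (add_mset x N - {#(b, nat m)#})"
      if "(b, nat m) \<in># N"
      using False that by (simp add: mon_add_mset[symmetric])
    then show ?thesis using False 0 *
      by (cases "(b, nat m) \<in># N") (auto simp: not_in_iff)
  qed
qed

text \<open>Zero modes commute with everything, since their bracket carries the factor
  \<open>m = 0\<close>, and they kill the vacuum.\<close>

lemma mode_zero: "mode a 0 v = 0"
proof (rule clinear_eq_on_words[where f = "mode a 0" and g = "\<lambda>v. 0", OF clinear_mode clinear_zero])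
  fix w :: "'a heis list"
  show "mode a 0 (foldr heis_act w vacuum) = 0"
  proof (induction w)
    case Nil
    then show ?case by (simp add: mode_vacuum)
  next
    case (Cons x w)
    have "heis_bracket (Poly_Mapping.single 0 a, 0) x = 0"
      by (simp add: heis_bracket_def zero_prod_def)
    then show ?case
      using Cons by (simp add: mode_def heis_act_commute[of "(Poly_Mapping.single 0 a, 0)" x]
          clinear_0[OF clinear_heis_act])
  qed
qed

text \<open>The span contains the vacuum and is stable under all modes: creators enlarge a monomial,
  the other modes act by \<open>mode_pos_mon\<close>. Hence it contains every word applied to the
  vacuum.\<close>

lemma span_mon: "complex_vector.span (mon ` osc_basis) = (UNIV :: 'h::bilinear_form_space fock set)"
proof -
  let ?S = "complex_vector.span (mon ` osc_basis) :: 'h fock set"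
  have mon_mode: "mode b n (mon N) \<in> ?S" if "b \<in> onb" "N \<in> osc_basis" for b n N
  proof (cases "n < 0")
    case True
    then have "mode b n (mon N) = mon (add_mset (b, nat (- n)) N)" by (simp add: mon_add_mset)
    moreover have "add_mset (b, nat (- n)) N \<in> osc_basis" using that True by (auto simp: osc_basis_def)
    ultimately show ?thesis by (simp add: complex_vector.span_base)
  next
    case False
    have "N - {#(b, nat n)#} \<in> osc_basis" using that by (auto simp: osc_basis_def dest: in_diffD)
    then show ?thesis using mode_pos_mon[OF that(2,1), of n] False
      by (simp add: complex_vector.span_base complex_vector.span_scale)
  qed
  have mode_b: "mode b n v \<in> ?S" if "b \<in> onb" "v \<in> ?S" for b n v
    using that(2)
  proof (induction rule: complex_vector.span_induct_alt)
    case base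
    then show ?case by (simp add: mode_linear complex_vector.span_zero)
  next
    case (step c x y)
    then show ?case using mon_mode[OF that(1)]
      by (auto simp: mode_linear intro!: complex_vector.span_add complex_vector.span_scale)
  qed
  have mode: "mode a n v \<in> ?S" if "v \<in> ?S" for a n v
    unfolding mode_onb[of a] by (intro complex_vector.span_sum complex_vector.span_scale mode_b that)
  have vac: "vacuum \<in> ?S"
    by (rule complex_vector.span_base) (auto simp: osc_basis_def intro!: image_eqI[of _ _ "{#}"])
  have "foldr heis_act w vacuum \<in> ?S" for w
  proof (induction w)
    case Nil
    then show ?case using vac by simp
  next
    case (Cons x w)
    then show ?case
      by (cases x) (auto simp: heis_act_modes intro!: complex_vector.span_add complex_vector.span_sum
          complex_vector.span_scale mode)
  qed
  then have "complex_vector.span (range (\<lambda>w. foldr heis_act w vacuum)) \<subseteq> ?S"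
    by (intro complex_vector.span_minimal) auto
  then show ?thesis by (auto simp: span_fock_words)
qed

lemma inj_on_mon: "inj_on mon osc_basis"
proof (rule inj_onI)
  fix M N :: "('a::bilinear_form_space \<times> nat) multiset"
  assume "M \<in> osc_basis" "N \<in> osc_basis" "mon M = mon N"
  then show "M = N" using coef_mon[of M M] coef_mon[of N M] by (auto split: if_splits)
qed

lemma coef_sum_mon:
  assumes "finite T" "T \<subseteq> osc_basis"
  shows "coef (\<Sum>N\<in>T. g N *\<^sub>C mon N) M = (if M \<in> T then g M else 0)"
proof -
  have "coef (\<Sum>N\<in>T. g N *\<^sub>C mon N) M = (\<Sum>N\<in>T. if N = M then g N else 0)"
    unfolding coef_sum by (rule sum.cong) (use assms(2) in \<open>auto simp: coef_linear coef_mon\<close>)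
  then show ?thesis using assms(1) by simp
qed

lemma fock_expand:
  fixes v :: "'a::bilinear_form_space fock"
  shows "finite {M. coef v M \<noteq> 0}" "{M. coef v M \<noteq> 0} \<subseteq> osc_basis"
  "v = (\<Sum>M | coef v M \<noteq> 0. coef v M *\<^sub>C mon M)"
proof -
  have "finite {M. coef v M \<noteq> 0} \<and> {M. coef v M \<noteq> 0} \<subseteq> osc_basis
    \<and> v = (\<Sum>M | coef v M \<noteq> 0. coef v M *\<^sub>C mon M)"
  proof -
    have "v \<in> complex_vector.span (mon ` osc_basis)" by (simp add: span_mon)
    then obtain t r where t: "finite t" "t \<subseteq> mon ` osc_basis" "v = (\<Sum>a\<in>t. r a *\<^sub>C a)"
      unfolding complex_vector.span_explicit by blast
    obtain T where T: "T \<subseteq> osc_basis" "t = mon ` T" using t(2) by (meson subset_imageE)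
    have injT: "inj_on mon T" using inj_on_mon T(1) by (rule inj_on_subset)
    have finT: "finite T" using t(1) T(2) injT by (simp add: finite_image_iff)
    have v: "v = (\<Sum>M\<in>T. r (mon M) *\<^sub>C mon M)" using t(3) T(2) by (simp add: sum.reindex[OF injT])
    have c: "coef v M = (if M \<in> T then r (mon M) else 0)" for M
      unfolding v by (rule coef_sum_mon[OF finT T(1)])
    have s: "{M. coef v M \<noteq> 0} \<subseteq> T" using c by (auto split: if_splits)
    have "(\<Sum>M | coef v M \<noteq> 0. coef v M *\<^sub>C mon M) = (\<Sum>M\<in>T. coef v M *\<^sub>C mon M)"
      by (rule sum.mono_neutral_left) (use finT s in auto)
    also have "\<dots> = (\<Sum>M\<in>T. r (mon M) *\<^sub>C mon M)"
      by (rule sum.cong) (simp_all add: c)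
    also have "\<dots> = v" using v by (rule sym)
    finally show ?thesis using s T(1) finite_subset[OF s finT] by auto
  qed
  then show "finite {M. coef v M \<noteq> 0}" "{M. coef v M \<noteq> 0} \<subseteq> osc_basis"
    "v = (\<Sum>M | coef v M \<noteq> 0. coef v M *\<^sub>C mon M)" by blast+
qed

lemma fock_eqI:
  fixes v w :: "'a::bilinear_form_space fock"
  assumes "\<And>M. M \<in> osc_basis \<Longrightarrow> coef v M = coef w M"
  shows "v = w"
proof -
  have "coef u M = 0" if "M \<notin> osc_basis" for u and M :: "('a \<times> nat) multiset"
    using fock_expand(2)[of u] that by blast
  then have "coef v M = coef w M" for M
    using assms by (cases "M \<in> osc_basis") simp_all
  then have "coef v = coef w" by (rule ext)
  then have "(\<Sum>M | coef v M \<noteq> 0. coef v M *\<^sub>C mon M) = (\<Sum>M | coef w M \<noteq> 0. coef w M *\<^sub>C mon M)"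
    by simp
  with fock_expand(3)[of v] have "v = (\<Sum>M | coef w M \<noteq> 0. coef w M *\<^sub>C mon M)" by (rule trans)
  also have "\<dots> = w" by (rule fock_expand(3)[symmetric])
  finally show ?thesis .
qed

lemma fock_mon_induct [case_names zero step]:
  fixes v :: "'h::bilinear_form_space fock"
  assumes "P 0" "\<And>c N v. N \<in> osc_basis \<Longrightarrow> P v \<Longrightarrow> P (c *\<^sub>C mon N + v)"
  shows "P v"
proof -
  have "v \<in> complex_vector.span (mon ` osc_basis)"
    by (simp add: span_mon)
  then show ?thesis
    by (induction rule: complex_vector.span_induct_alt) (use assms in auto)
qed

lemma clinear_eq_on_mon:
  fixes f g :: "'h::bilinear_form_space fock \<Rightarrow> 'b::complex_vector"
  assumes "clinear f" "clinear g" "\<And>N. N \<in> osc_basis \<Longrightarrow> f (mon N) = g (mon N)"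
  shows "f v = g v"
  by (induction v rule: fock_mon_induct)
    (simp_all add: assms(3) clinear_simps[OF assms(1)] clinear_simps[OF assms(2)])

section \<open>Normally ordered products of fields\<close>

definition wt :: "('h \<times> nat) multiset \<Rightarrow> nat"
  where "wt M = (\<Sum>x\<in>#M. snd x)"

lemma wt_simps [simp]: "wt {#} = 0" "wt (add_mset x M) = snd x + wt M"
  by (simp_all add: wt_def)

lemma coef_mode_shift:
  assumes "coef (mode a m v) M \<noteq> 0"
  shows "\<exists>M'. coef v M' \<noteq> 0 \<and> int (wt M') = int (wt M) + m"
proof -
  obtain b where b: "osc b m (coef v) M \<noteq> 0"
    using assms unfolding coef_mode by (metis (no_types, lifting) mult_zero_right sum.neutral)
  show ?thesis
  proof (cases "m < 0")
    case True
    then have *: "(b, nat (- m)) \<in># M" "coef v (M - {#(b, nat (- m))#}) \<noteq> 0"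
      using b by (auto simp: osc_def split: if_splits)
    then obtain K where "M = add_mset (b, nat (- m)) K" by (metis insert_DiffM)
    then show ?thesis using * True by (intro exI[of _ K]) auto
  next
    case False
    then have "coef v (add_mset (b, nat m) M) \<noteq> 0"
      using b by (auto simp: osc_def split: if_splits)
    then show ?thesis using False by (intro exI[of _ "add_mset (b, nat m) M"]) auto
  qed
qed

text \<open>A bound rather than a grading: it applies to every vector, non-negative modes preserve
  it, and a negative bound forces the vector to be 0.\<close>

definition wt_le :: "int \<Rightarrow> 'h::bilinear_form_space fock \<Rightarrow> bool"
  where "wt_le W v \<longleftrightarrow> (\<forall>M. coef v M \<noteq> 0 \<longrightarrow> int (wt M) \<le> W)"

lemma wt_le_mode: "wt_le W v \<Longrightarrow> wt_le (W - m) (mode a m v)"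
  unfolding wt_le_def using coef_mode_shift by fastforce

lemma wt_le_neg: "wt_le W v \<Longrightarrow> W < 0 \<Longrightarrow> v = 0"
  by (rule fock_eqI) (force simp: wt_le_def coef_linear)

lemma wt_le_mono: "wt_le W v \<Longrightarrow> W \<le> W' \<Longrightarrow> wt_le W' v"
  unfolding wt_le_def by force

lemma wt_le_exists: "\<exists>W\<ge>0. wt_le W v"
proof -
  have "finite (wt ` {M. coef v M \<noteq> 0})" using fock_expand(1) by blast
  then obtain n where "\<forall>x\<in>wt ` {M. coef v M \<noteq> 0}. x \<le> n"
    using finite_nat_set_iff_bounded_le by blast
  then show ?thesis by (intro exI[of _ "int n"]) (auto simp: wt_le_def)
qed

lemma mode_prod_simps:
  "mode_prod [] w = w" "mode_prod (x # xs) w = mode (fst x) (snd x) (mode_prod xs w)"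
  "mode_prod (xs @ ys) w = mode_prod xs (mode_prod ys w)"
  by (simp_all add: mode_prod_def case_prod_unfold)

lemma clinear_mode_prod:
  fixes xs :: "('a::bilinear_form_space \<times> int) list"
  shows "clinear (mode_prod xs)"
proof (induction xs)
  case Nil
  have "mode_prod ([] :: ('a \<times> int) list) = (\<lambda>w. w)" by (rule ext) (simp add: mode_prod_simps)
  then show ?case by (simp add: clinear_ident)
next
  case (Cons x xs)
  have "mode_prod (x # xs) = (\<lambda>w. mode (fst x) (snd x) (mode_prod xs w))"
    by (rule ext) (simp add: mode_prod_simps)
  then show ?case using clinear_comp[OF clinear_mode Cons.IH] by simp
qed

lemma mode_commute_nonneg: "0 \<le> m \<Longrightarrow> 0 \<le> n \<Longrightarrow> mode a m (mode b n v) = mode b n (mode a m v)"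
  by (subst mode_commute) auto

lemma mode_commute_neg: "m < 0 \<Longrightarrow> n < 0 \<Longrightarrow> mode a m (mode b n v) = mode b n (mode a m v)"
  by (subst mode_commute) auto

lemma mode_prod_nonneg_commute:
  assumes "\<forall>x\<in>set xs. 0 \<le> snd x" "0 \<le> m"
  shows "mode a m (mode_prod xs w) = mode_prod xs (mode a m w)"
  using assms
proof (induction xs)
  case (Cons x xs)
  then show ?case using mode_commute_nonneg[of m "snd x" a "fst x"] by (simp add: mode_prod_simps)
qed (simp add: mode_prod_simps)

lemma normal_ordered_Nil: "normal_ordered [] w = w"
  by (simp add: normal_ordered_def mode_prod_simps)

lemma normal_ordered_Cons:
  "normal_ordered ((a, m) # xs) w =
    (if m < 0 then mode a m (normal_ordered xs w) else normal_ordered xs (mode a m w))"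
  by (simp add: normal_ordered_def mode_prod_simps mode_prod_nonneg_commute case_prod_unfold)

lemma clinear_normal_ordered: "clinear (normal_ordered xs)"
  unfolding normal_ordered_def by (rule clinear_mode_prod)

text \<open>The non-negative modes act first and never raise the bound \<open>W\<close>. A mode
  \<open>m > W\<close> therefore pushes the vector below weight 0, and the creators to its left act
  on 0.\<close>

lemma normal_ordered_eq_0:
  assumes "wt_le W w" "0 \<le> W" "(a, m) \<in> set xs" "W < m"
  shows "normal_ordered xs w = 0"
  using assms
proof (induction xs arbitrary: w)
  case (Cons x xs)
  obtain b n where x: "x = (b, n)" by fastforce
  show ?case
  proof (cases "x = (a, m)")
    case True
    have "mode a m w = 0" using wt_le_neg[OF wt_le_mode[OF Cons.prems(1)], of m a] Cons.prems by simp
    then show ?thesis using True Cons.prems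
      by (simp add: normal_ordered_Cons clinear_0[OF clinear_normal_ordered])
  next
    case False
    then have in_xs: "(a, m) \<in> set xs" using Cons.prems by auto
    show ?thesis
    proof (cases "n < 0")
      case True
      then show ?thesis using x in_xs Cons by (simp add: normal_ordered_Cons mode_linear)
    next
      case False
      have "wt_le W (mode b n w)" using wt_le_mono[OF wt_le_mode[OF Cons.prems(1)]] False by simp
      then show ?thesis using x in_xs Cons False by (simp add: normal_ordered_Cons)
    qed
  qed
qed simp

text \<open>
  A field is given by its mode coefficients: the function \<open>x\<close> stands for the formal sum of the
  operators \<open>(x m)(m)\<close>. Truncating to \<open>\<bar>m\<bar> \<le> K\<close> makes the part of total mode \<open>s\<close> of a normally ordered
  product a finite sum; on a fixed vector it does not depend on \<open>K\<close> when \<open>K\<close> is large.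
\<close>

fun fld :: "int \<Rightarrow> (int \<Rightarrow> 'h::bilinear_form_space) list \<Rightarrow> int \<Rightarrow> 'h fock \<Rightarrow> 'h fock" where
  "fld K [] s w = (if s = 0 then w else 0)"
| "fld K (x # xs) s w = (\<Sum>m\<in>{-K..K}.
     if m < 0 then mode (x m) m (fld K xs (s - m) w) else fld K xs (s - m) (mode (x m) m w))"

lemma clinear_finite_sum:
  assumes "\<And>i. i \<in> A \<Longrightarrow> clinear (f i)"
  shows "clinear (\<lambda>v. \<Sum>i\<in>A. f i v)"
  using assms
  by (induction A rule: infinite_finite_induct) (simp_all add: clinear_zero clinear_plus)

lemma clinear_fld: "clinear (fld K xs s)"
proof (induction xs arbitrary: s)
  case Nil
  show ?case by (cases "s = 0") (simp_all add: clinear_ident clinear_zero fun_eq_iff[symmetric])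
next
  case (Cons x xs)
  have "clinear (\<lambda>w. \<Sum>m\<in>{-K..K}.
     if m < 0 then mode (x m) m (fld K xs (s - m) w) else fld K xs (s - m) (mode (x m) m w))"
  proof (rule clinear_finite_sum)
    fix m
    show "clinear (\<lambda>w. if m < 0 then mode (x m) m (fld K xs (s - m) w) else fld K xs (s - m) (mode (x m) m w))"
      using clinear_comp[OF clinear_mode Cons.IH] clinear_comp[OF Cons.IH clinear_mode]
      by (cases "m < 0") simp_all
  qed
  then show ?case by simp
qed

lemmas fld_linear = clinear_simps[OF clinear_fld] clinear_sum[OF clinear_fld]

lemma fld_multilinear:
  "fld K (us @ (\<lambda>m. c *\<^sub>C x m + y m) # vs) s w =
    c *\<^sub>C fld K (us @ x # vs) s w + fld K (us @ y # vs) s w"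
proof (induction us arbitrary: s w)
  case Nil
  show ?case
    unfolding append_Nil fld.simps complex_vector.scale_sum_right sum.distrib[symmetric]
    by (rule sum.cong) (auto simp: mode_add_left mode_scale_left fld_linear)
next
  case (Cons u us)
  show ?case
    unfolding append_Cons fld.simps complex_vector.scale_sum_right sum.distrib[symmetric]
    by (rule sum.cong) (auto simp: Cons mode_linear)
qed

text \<open>Two creators commute, two non-negative modes commute, and for a mixed pair normal
  ordering prescribes the same product for either order of the fields.\<close>

lemma fld_swap: "fld K (x # y # xs) s w = fld K (y # x # xs) s w"
proof -
  have "fld K (x # y # xs) s w = (\<Sum>m\<in>{-K..K}. \<Sum>n\<in>{-K..K}.
     if m < 0 then
       if n < 0 then mode (x m) m (mode (y n) n (fld K xs (s - m - n) w))
       else mode (x m) m (fld K xs (s - m - n) (mode (y n) n w))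
     else
       if n < 0 then mode (y n) n (fld K xs (s - m - n) (mode (x m) m w))
       else fld K xs (s - m - n) (mode (y n) n (mode (x m) m w)))"
    unfolding fld.simps by (rule sum.cong) (auto simp: mode_linear intro!: sum.cong)
  also have "\<dots> = (\<Sum>n\<in>{-K..K}. \<Sum>m\<in>{-K..K}.
     if m < 0 then
       if n < 0 then mode (x m) m (mode (y n) n (fld K xs (s - m - n) w))
       else mode (x m) m (fld K xs (s - m - n) (mode (y n) n w))
     else
       if n < 0 then mode (y n) n (fld K xs (s - m - n) (mode (x m) m w))
       else fld K xs (s - m - n) (mode (y n) n (mode (x m) m w)))"
    by (rule sum.swap)
  also have "\<dots> = fld K (y # x # xs) s w"
    unfolding fld.simps
    by (rule sum.cong)
      (auto simp: mode_linear diff_diff_eq add.commute mode_commute_neg[of _ _ "x _"]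
        mode_commute_nonneg[of _ _ "x _"] intro!: sum.cong)
  finally show ?thesis .
qed

lemma fld_Cons_cong:
  "(\<And>s w. fld K xs s w = fld K ys s w) \<Longrightarrow> fld K (x # xs) s w = fld K (x # ys) s w"
  by (auto intro!: sum.cong)

lemma fld_move_front: "fld K (us @ x # vs) s w = fld K (x # us @ vs) s w"
proof (induction us arbitrary: s w)
  case (Cons u us)
  have "fld K ((u # us) @ x # vs) s w = fld K (u # x # us @ vs) s w"
    unfolding append_Cons by (rule fld_Cons_cong) (rule Cons)
  also have "\<dots> = fld K (x # u # us @ vs) s w" by (rule fld_swap)
  finally show ?case by simp
qed simp

lemma fld_mset: "mset xs = mset ys \<Longrightarrow> fld K xs s w = fld K ys s w"
proof (induction xs arbitrary: ys s w)
  case (Cons x xs)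
  then have "x \<in> set ys" by (metis list.set_intros(1) set_mset_mset)
  then obtain us vs where ys: "ys = us @ x # vs" by (meson split_list)
  then have "mset xs = mset (us @ vs)" using Cons.prems by simp
  then have "fld K (x # xs) s w = fld K (x # us @ vs) s w"
    by (intro fld_Cons_cong Cons.IH)
  then show ?case using ys by (simp only: fld_move_front)
qed simp

definition derivative_field :: "'h::bilinear_form_space \<times> nat \<Rightarrow> int \<Rightarrow> 'h"
  where "derivative_field x m = (of_int (- m - 1) gchoose (snd x - 1)) *\<^sub>C fst x"

text \<open>Splitting off the first entry of a mode list turns the defining sum into the recursion
  of \<open>fld\<close>; the binomial factor of that entry is absorbed into
  \<open>derivative_field\<close>.\<close>

lemma sum_lists_eq_fld:
  "(\<Sum>ms | set ms \<subseteq> {-K..K} \<and> length ms = length xs.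
      if (\<Sum>i<length xs. ms ! i) = s
      then (\<Prod>i<length xs. of_int (- (ms ! i) - 1) gchoose (snd (xs ! i) - 1))
             *\<^sub>C normal_ordered (zip (map fst xs) ms) w
      else 0) = fld K (map derivative_field xs) s w"
proof (induction xs arbitrary: s w)
  case Nil
  have "{ms. set ms \<subseteq> {-K..K} \<and> length ms = length []} = {[] :: int list}" by auto
  then show ?case by (simp add: normal_ordered_Nil)
next
  case (Cons x xs)
  define P where "P xs ms = (\<Prod>i<length xs. of_int (- (ms ! i) - 1) gchoose (snd (xs ! i) - 1) :: complex)"
    for xs :: "('a \<times> nat) list" and ms
  define T where "T xs ms s w = (if (\<Sum>i<length xs. ms ! i) = s
      then P xs ms *\<^sub>C normal_ordered (zip (map fst xs) ms) w else 0)" for xs :: "('a \<times> nat) list" and ms s w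
  define L where "L n = {ms. set ms \<subseteq> {-K..K} \<and> length ms = n}" for n :: nat
  have L: "L (Suc n) = (\<lambda>p. fst p # snd p) ` ({-K..K} \<times> L n)" for n
    by (auto simp: L_def length_Suc_conv image_iff)
  have inj: "inj_on (\<lambda>p. fst p # snd p) X" for X :: "(int \<times> int list) set"
    by (auto simp: inj_on_def prod_eq_iff)
  have PC: "P (x # xs) (m # ms) = (of_int (- m - 1) gchoose (snd x - 1)) * P xs ms" for m ms
    by (simp add: P_def prod.lessThan_Suc_shift del: prod.lessThan_Suc)
  have IH: "(\<Sum>ms\<in>L (length xs). T xs ms s w) = fld K (map derivative_field xs) s w" for s w
    unfolding T_def P_def L_def by (rule Cons.IH)
  have T: "T (x # xs) (m # ms) s w =
      (if m < 0 then mode (derivative_field x m) m (T xs ms (s - m) w)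
       else T xs ms (s - m) (mode (derivative_field x m) m w))" for m ms
  proof -
    have s: "(\<Sum>i<length (x # xs). (m # ms) ! i) = s \<longleftrightarrow> (\<Sum>i<length xs. ms ! i) = s - m"
      by (auto simp add: sum.lessThan_Suc_shift simp del: sum.lessThan_Suc)
    show ?thesis
      unfolding T_def s PC
      by (auto simp: normal_ordered_Cons derivative_field_def mode_linear mode_scale_left
          clinear_simps[OF clinear_normal_ordered] scaleC_scaleC mult.commute)
  qed
  have "(\<Sum>ms\<in>L (Suc (length xs)). T (x # xs) ms s w)
      = (\<Sum>m\<in>{-K..K}. \<Sum>ms\<in>L (length xs). T (x # xs) (m # ms) s w)"
    unfolding L by (simp add: sum.reindex[OF inj] sum.cartesian_product case_prod_unfold comp_def)
  also have "\<dots> = fld K (map derivative_field (x # xs)) s w"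
    unfolding list.map fld.simps IH[symmetric]
    by (rule sum.cong) (auto simp: T mode_linear)
  finally show ?case by (simp only: T_def P_def L_def length_Cons)
qed

text \<open>With the total fixed and all entries at most \<open>W\<close>, no single entry can be
  very negative.\<close>

lemma sum_list_le_elem:
  fixes ms :: "int list"
  assumes "\<forall>m\<in>set ms. m \<le> W" "m \<in> set ms" "0 \<le> W"
  shows "sum_list ms \<le> m + int (length ms) * W"
proof -
  obtain us vs where ms: "ms = us @ m # vs" using assms(2) by (meson split_list)
  have b: "\<forall>m\<in>set xs. m \<le> W \<Longrightarrow> sum_list xs \<le> int (length xs) * W" for xs
    by (induction xs) (auto simp: algebra_simps)
  have "sum_list us \<le> int (length us) * W" "sum_list vs \<le> int (length vs) * W"
    using assms(1) by (auto intro!: b simp: ms)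
  then show ?thesis using assms(3) by (simp add: ms algebra_simps)
qed

definition total_degree :: "('h \<times> nat) list \<Rightarrow> int"
  where "total_degree xs = int (\<Sum>x\<leftarrow>xs. snd x)"

text \<open>Contributing modes are bounded above by the weights occurring in \<open>w\<close>, and
  then below because their total is prescribed. Every truncation beyond these bounds sees all of
  them; the threshold depends on \<open>w\<close>.\<close>

lemma normal_product_coeff_eq_fld:
  "\<exists>K0. \<forall>K\<ge>K0. normal_product_coeff xs N w = fld K (map derivative_field xs) (N + 1 - total_degree xs) w"
proof -
  obtain W where W: "wt_le W w" "0 \<le> W" using wt_le_exists by blast
  define s where "s = N + 1 - total_degree xs"
  have deg: "(\<Sum>i<length xs. ms ! i + int (snd (xs ! i))) = N + 1 \<longleftrightarrow> (\<Sum>i<length xs. ms ! i) = s"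
    for ms :: "int list"
  proof -
    have "total_degree xs = (\<Sum>i<length xs. int (snd (xs ! i)))"
      by (simp add: total_degree_def sum_list_sum_nth atLeast0LessThan)
    then show ?thesis by (auto simp: sum.distrib s_def)
  qed
  let ?T = "\<lambda>ms :: int list. if length ms = length xs \<and> (\<Sum>i<length xs. ms ! i + int (snd (xs ! i))) = N + 1
      then (\<Prod>i<length xs. of_int (- (ms ! i) - 1) gchoose (snd (xs ! i) - 1))
             *\<^sub>C normal_ordered (zip (map fst xs) ms) w
      else 0"
  have "normal_product_coeff xs N w = fld K (map derivative_field xs) s w"
    if K: "\<bar>s\<bar> + (int (length xs) + 1) * W \<le> K" for K
  proof -
    have supp: "set ms \<subseteq> {-K..K} \<and> length ms = length xs" if T: "?T ms \<noteq> 0" for ms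
    proof -
      have len: "length ms = length xs" and sum: "(\<Sum>i<length xs. ms ! i) = s"
        and no: "normal_ordered (zip (map fst xs) ms) w \<noteq> 0"
        using T deg by (auto split: if_splits)
      have le: "m \<le> W" if "m \<in> set ms" for m
      proof (rule ccontr)
        assume "\<not> m \<le> W"
        obtain i where i: "i < length ms" "ms ! i = m" using \<open>m \<in> set ms\<close> by (meson in_set_conv_nth)
        then have "(fst (xs ! i), m) \<in> set (zip (map fst xs) ms)"
          using len by (auto simp: set_zip intro!: exI[of _ i])
        then show False using normal_ordered_eq_0[OF W] no \<open>\<not> m \<le> W\<close> by fastforce
      qed
      have sl: "sum_list ms = s" using sum len by (simp add: sum_list_sum_nth atLeast0LessThan)
      have "- K \<le> m \<and> m \<le> K" if m: "m \<in> set ms" for m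
      proof -
        have "s \<le> m + int (length xs) * W"
          using sum_list_le_elem[OF _ m W(2)] le sl len by auto
        moreover have "(int (length xs) + 1) * W = int (length xs) * W + W" by (simp add: algebra_simps)
        moreover have "0 \<le> int (length xs) * W" using W(2) by simp
        ultimately show ?thesis using le[OF m] K W(2) by linarith
      qed
      then show ?thesis using len by auto
    qed
    have fin: "finite {ms. set ms \<subseteq> {-K..K} \<and> length ms = length xs}"
      by (rule finite_lists_length_eq) simp
    have "normal_product_coeff xs N w = (\<Sum>ms | set ms \<subseteq> {-K..K} \<and> length ms = length xs. ?T ms)"
      unfolding normal_product_coeff_def
      by (rule Sum_any.expand_superset[OF fin]) (use supp in blast)
    also have "\<dots> = fld K (map derivative_field xs) s w"
      unfolding sum_lists_eq_fld[symmetric] by (rule sum.cong) (auto simp: deg)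
    finally show ?thesis .
  qed
  then show ?thesis unfolding s_def by blast
qed

section \<open>Vertex operators and zero modes\<close>

definition multilinear :: "(('h::bilinear_form_space \<times> nat) list \<Rightarrow> 'b::complex_vector) \<Rightarrow> bool"
  where "multilinear F \<longleftrightarrow> (\<forall>us a b c n vs.
    F (us @ (c *\<^sub>C a + b, n) # vs) = c *\<^sub>C F (us @ (a, n) # vs) + F (us @ (b, n) # vs))"

lemma multilinear_zero: "multilinear F \<Longrightarrow> F (us @ (0, n) # vs) = 0"
  unfolding multilinear_def by (drule spec[of _ us], drule spec[of _ 0], drule spec[of _ 0], drule spec[of _ 1]) simp

text \<open>The specification of \<open>vertex_op\<close> ranges over arbitrary vectors, whereas the
  monomial basis uses only \<open>onb\<close>. The slots are expanded in \<open>onb\<close> one at a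
  time, starting from the right.\<close>

lemma multilinear_eq_on_onb:
  fixes F G :: "('h::bilinear_form_space \<times> nat) list \<Rightarrow> 'b::complex_vector"
  assumes F: "multilinear F" and G: "multilinear G"
    and eq: "\<And>xs. set xs \<subseteq> onb \<times> {1..} \<Longrightarrow> F xs = G xs"
    and xs: "\<forall>(a, k)\<in>set xs. 1 \<le> k"
  shows "F xs = G xs"
proof -
  have "F (us @ vs) = G (us @ vs)" if "\<forall>(a, k)\<in>set us. 1 \<le> k" "set vs \<subseteq> onb \<times> {1..}" for us vs
    using that
  proof (induction us arbitrary: vs rule: rev_induct)
    case Nil
    then show ?case by (simp add: eq)
  next
    case (snoc x us)
    obtain a n where x: "x = (a, n)" by fastforce
    have "a \<in> complex_vector.span onb"
      using orthonormal_basis_onb unfolding orthonormal_basis_def by blast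
    then have "F (us @ (a, n) # vs) = G (us @ (a, n) # vs)"
    proof (induction rule: complex_vector.span_induct_alt)
      case base
      then show ?case using multilinear_zero[OF F] multilinear_zero[OF G] by simp
    next
      case (step c a b)
      have "F (us @ (a, n) # vs) = G (us @ (a, n) # vs)"
        using snoc.prems step(1) x by (intro snoc.IH) auto
      then show ?case using step.IH F G unfolding multilinear_def by simp
    qed
    then show ?case by (simp add: x)
  qed
  from this[of xs "[]"] show ?thesis using xs by simp
qed

lemma multilinear_fock_monomial: "multilinear fock_monomial"
  unfolding multilinear_def
proof (intro allI)
  fix us vs and a b :: 'a and c n
  show "fock_monomial (us @ (c *\<^sub>C a + b, n) # vs)
    = c *\<^sub>C fock_monomial (us @ (a, n) # vs) + fock_monomial (us @ (b, n) # vs)"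
    by (induction us) (simp_all add: fock_monomial_def mode_prod_simps mode_add_left mode_scale_left
        mode_linear)
qed

lemma total_degree_simps [simp]:
  "total_degree [] = 0" "total_degree (x # xs) = int (snd x) + total_degree xs"
  "total_degree (xs @ ys) = total_degree xs + total_degree ys"
  by (simp_all add: total_degree_def)

lemma multilinear_normal_product_coeff:
  fixes w :: "'a::bilinear_form_space fock"
  shows "multilinear (\<lambda>xs. normal_product_coeff xs N w)"
  unfolding multilinear_def
proof (intro allI)
  fix us vs :: "('a \<times> nat) list" and a b :: 'a and c and n :: nat
  let ?xs = "\<lambda>a. us @ (a, n) # vs"
  obtain K1 where K1: "\<And>K. K1 \<le> K \<Longrightarrow> normal_product_coeff (?xs (c *\<^sub>C a + b)) N w
      = fld K (map derivative_field (?xs (c *\<^sub>C a + b))) (N + 1 - total_degree (?xs (c *\<^sub>C a + b))) w"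
    using normal_product_coeff_eq_fld by blast
  obtain K2 where K2: "\<And>K. K2 \<le> K \<Longrightarrow> normal_product_coeff (?xs a) N w
      = fld K (map derivative_field (?xs a)) (N + 1 - total_degree (?xs a)) w"
    using normal_product_coeff_eq_fld by blast
  obtain K3 where K3: "\<And>K. K3 \<le> K \<Longrightarrow> normal_product_coeff (?xs b) N w
      = fld K (map derivative_field (?xs b)) (N + 1 - total_degree (?xs b)) w"
    using normal_product_coeff_eq_fld by blast
  define K where "K = max K1 (max K2 K3)"
  have f: "derivative_field (c *\<^sub>C a + b, n) = (\<lambda>m. c *\<^sub>C derivative_field (a, n) m + derivative_field (b, n) m)"
    by (rule ext) (simp add: derivative_field_def scaleC_add_right scaleC_scaleC mult.commute)
  show "normal_product_coeff (?xs (c *\<^sub>C a + b)) N w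
    = c *\<^sub>C normal_product_coeff (?xs a) N w + normal_product_coeff (?xs b) N w"
    using K1[of K] K2[of K] K3[of K] by (simp add: K_def f fld_multilinear)
qed

text \<open>A monomial remembers only the multiset of its factors, so a vertex operator can be
  attached to it only if the order of the fields is irrelevant.\<close>

lemma normal_product_coeff_mset:
  assumes "mset xs = mset ys"
  shows "normal_product_coeff xs N w = normal_product_coeff ys N w"
proof -
  obtain K1 where K1: "\<And>K. K1 \<le> K \<Longrightarrow> normal_product_coeff xs N w
      = fld K (map derivative_field xs) (N + 1 - total_degree xs) w"
    using normal_product_coeff_eq_fld by blast
  obtain K2 where K2: "\<And>K. K2 \<le> K \<Longrightarrow> normal_product_coeff ys N w
      = fld K (map derivative_field ys) (N + 1 - total_degree ys) w"
    using normal_product_coeff_eq_fld by blast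
  have "total_degree xs = total_degree ys"
    using assms unfolding total_degree_def by (metis mset_map sum_mset_sum_list)
  moreover have "mset (map derivative_field xs) = mset (map derivative_field ys)"
    using assms by simp
  ultimately show ?thesis
    using K1[of "max K1 K2"] K2[of "max K1 K2"] fld_mset by (metis max.cobounded1 max.cobounded2)
qed

definition mon_extend ::
  "(('h::bilinear_form_space \<times> nat) multiset \<Rightarrow> 'b::complex_vector) \<Rightarrow> 'h fock \<Rightarrow> 'b"
  where "mon_extend g v = (\<Sum>M | coef v M \<noteq> 0. coef v M *\<^sub>C g M)"

lemma mon_extend_superset:
  assumes "finite A" "{M. coef v M \<noteq> 0} \<subseteq> A"
  shows "mon_extend g v = (\<Sum>M\<in>A. coef v M *\<^sub>C g M)"
  unfolding mon_extend_def by (rule sum.mono_neutral_left) (use assms in auto)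

lemma clinear_mon_extend:
  fixes g :: "('h::bilinear_form_space \<times> nat) multiset \<Rightarrow> 'b::complex_vector"
  shows "clinear (mon_extend g)"
proof (rule clinearI)
  fix v w :: "'h fock" and c
  let ?A = "{M. coef v M \<noteq> 0} \<union> {M. coef w M \<noteq> 0}"
  have fin: "finite ?A" using fock_expand(1) by blast
  have "{M. coef (v + w) M \<noteq> 0} \<subseteq> ?A" by (auto simp: coef_linear)
  then show "mon_extend g (v + w) = mon_extend g v + mon_extend g w"
    by (simp add: mon_extend_superset[OF fin] coef_linear scaleC_add_left sum.distrib)
  have "{M. coef (c *\<^sub>C v) M \<noteq> 0} \<subseteq> ?A" by (auto simp: coef_linear)
  then show "mon_extend g (c *\<^sub>C v) = c *\<^sub>C mon_extend g v"
    by (simp add: mon_extend_superset[OF fin] coef_linear complex_vector.scale_sum_right)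
qed

lemma mon_extend_mon:
  assumes "N \<in> osc_basis"
  shows "mon_extend g (mon N) = g N"
  by (subst mon_extend_superset[of "{N}"]) (use assms in \<open>auto simp: coef_mon\<close>)

lemma osc_basis_list:
  assumes "N \<in> osc_basis"
  shows "\<exists>xs. mset xs = N \<and> set xs \<subseteq> onb \<times> {1..} \<and> mon N = fock_monomial xs"
proof -
  obtain xs where xs: "mset xs = N" using ex_mset by blast
  then have "set xs \<subseteq> onb \<times> {1..}" using assms by (auto simp: osc_basis_def)
  then show ?thesis using xs by (auto simp: fock_monomial_mon)
qed

text \<open>Existence: prescribe the values on basis monomials through an arbitrary listing of their
  factors, then pass to general vectors by multilinearity. Uniqueness: the basis monomials
  span.\<close>

lemma vertex_op_ex1:
  "\<exists>!Y. (\<forall>n w. clinear (\<lambda>v :: 'h::bilinear_form_space fock. Y v n w)) \<and>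
    (\<forall>xs n w. (\<forall>(a, k)\<in>set xs. 1 \<le> k) \<longrightarrow> Y (fock_monomial xs) n w = normal_product_coeff xs n w)"
proof (rule ex_ex1I)
  define Y where "Y v n w = mon_extend (\<lambda>M. normal_product_coeff (SOME xs. mset xs = M) n w) v"
    for v :: "'h fock" and n w
  have lin: "clinear (\<lambda>v. Y v n w)" for n w
    unfolding Y_def by (rule clinear_mon_extend)
  have "Y (fock_monomial xs) n w = normal_product_coeff xs n w" if "\<forall>(a, k)\<in>set xs. 1 \<le> k" for xs n w
  proof (rule multilinear_eq_on_onb[where F = "\<lambda>xs. Y (fock_monomial xs) n w"
        and G = "\<lambda>xs. normal_product_coeff xs n w", OF _ multilinear_normal_product_coeff _ that])
    show "multilinear (\<lambda>xs. Y (fock_monomial xs) n w)"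
      using multilinear_fock_monomial[where ?'a = 'h] unfolding multilinear_def
      by (simp add: clinear_simps[OF lin])
  next
    fix xs :: "('h \<times> nat) list"
    assume "set xs \<subseteq> onb \<times> {1..}"
    then have "mset xs \<in> osc_basis" by (simp add: osc_basis_def)
    then have "Y (fock_monomial xs) n w = normal_product_coeff (SOME ys. mset ys = mset xs) n w"
      by (simp add: Y_def fock_monomial_mon mon_extend_mon)
    also have "\<dots> = normal_product_coeff xs n w"
      by (rule normal_product_coeff_mset) (rule someI_ex, blast)
    finally show "Y (fock_monomial xs) n w = normal_product_coeff xs n w" .
  qed
  then show "\<exists>Y. (\<forall>n w. clinear (\<lambda>v :: 'h fock. Y v n w)) \<and>
    (\<forall>xs n w. (\<forall>(a, k)\<in>set xs. 1 \<le> k) \<longrightarrow> Y (fock_monomial xs) n w = normal_product_coeff xs n w)"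
    using lin by blast
next
  fix Y Z :: "'h fock \<Rightarrow> int \<Rightarrow> 'h fock \<Rightarrow> 'h fock"
  assume Y: "(\<forall>n w. clinear (\<lambda>v. Y v n w)) \<and>
    (\<forall>xs n w. (\<forall>(a, k)\<in>set xs. 1 \<le> k) \<longrightarrow> Y (fock_monomial xs) n w = normal_product_coeff xs n w)"
  assume Z: "(\<forall>n w. clinear (\<lambda>v. Z v n w)) \<and>
    (\<forall>xs n w. (\<forall>(a, k)\<in>set xs. 1 \<le> k) \<longrightarrow> Z (fock_monomial xs) n w = normal_product_coeff xs n w)"
  have "Y v n w = Z v n w" for v n w
  proof (rule clinear_eq_on_mon[where f = "\<lambda>v. Y v n w" and g = "\<lambda>v. Z v n w"])
    fix N :: "('h \<times> nat) multiset"
    assume "N \<in> osc_basis"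
    then obtain xs where "set xs \<subseteq> onb \<times> {1..}" "mon N = fock_monomial xs" using osc_basis_list by blast
    then show "Y (mon N) n w = Z (mon N) n w" using Y Z by fastforce
  qed (use Y Z in auto)
  then show "Y = Z" by blast
qed

lemma clinear_vertex_op: "clinear (\<lambda>v. vertex_op v n w)"
  using theI'[OF vertex_op_ex1] unfolding vertex_op_def[symmetric] by blast

lemma vertex_op_fock_monomial:
  "\<forall>(a, k)\<in>set xs. 1 \<le> k \<Longrightarrow> vertex_op (fock_monomial xs) n w = normal_product_coeff xs n w"
  using theI'[OF vertex_op_ex1] unfolding vertex_op_def[symmetric] by blast

text \<open>Both sides are the Casimir element of the form: expanding each \<open>h\<close> in
  \<open>onb\<close>, the coefficient of a pair \<open>b\<close>, \<open>b'\<close> is the Parseval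
  sum over \<open>B\<close>, that is \<open>bform b b'\<close>.\<close>

lemma sum_orthonormal_basis_squares:
  assumes "orthonormal_basis (B :: 'h::bilinear_form_space set)"
  shows "(\<Sum>h\<in>B. mode h (- 1) (mode h (- 1) vacuum)) = (\<Sum>b\<in>onb. mode b (- 1) (mode b (- 1) vacuum))"
proof -
  let ?m = "\<lambda>a b. mode a (- 1) (mode b (- 1) (vacuum :: 'h fock))"
  have e: "?m h h = (\<Sum>b\<in>onb. \<Sum>b'\<in>onb. (bform h b * bform h b') *\<^sub>C ?m b b')" for h
  proof -
    have "?m h h = (\<Sum>b\<in>onb. bform h b *\<^sub>C mode b (- 1) (mode h (- 1) vacuum))"
      by (rule mode_onb)
    also have "\<dots> = (\<Sum>b\<in>onb. \<Sum>b'\<in>onb. (bform h b * bform h b') *\<^sub>C ?m b b')"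
      by (subst (2) mode_onb) (simp add: mode_linear complex_vector.scale_sum_right scaleC_scaleC)
    finally show ?thesis .
  qed
  have "(\<Sum>h\<in>B. ?m h h) = (\<Sum>b\<in>onb. \<Sum>b'\<in>onb. \<Sum>h\<in>B. (bform h b * bform h b') *\<^sub>C ?m b b')"
    by (subst sum.cong[OF refl e], subst sum.swap) (intro sum.cong refl sum.swap)
  also have "\<dots> = (\<Sum>b\<in>onb. \<Sum>b'\<in>onb. bform b b' *\<^sub>C ?m b b')"
  proof (intro sum.cong refl)
    fix b b' :: 'h
    have "bform b b' = (\<Sum>h\<in>B. bform h b * bform h b')"
      unfolding bform_parseval[OF assms, of b b']
      by (intro sum.cong refl arg_cong2[where f = "(*)"] bform_sym)
    then show "(\<Sum>h\<in>B. (bform h b * bform h b') *\<^sub>C ?m b b') = bform b b' *\<^sub>C ?m b b'"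
      by (simp add: complex_vector.scale_sum_left)
  qed
  also have "\<dots> = (\<Sum>b\<in>onb. \<Sum>b'\<in>onb. if b' = b then ?m b b else 0)"
    by (intro sum.cong refl) (auto simp: bform_onb)
  also have "\<dots> = (\<Sum>b\<in>onb. ?m b b)" by simp
  finally show ?thesis .
qed

lemma virasoro_element_onb:
  "(virasoro_element :: 'a::bilinear_form_space fock) = (1 / 2) *\<^sub>C (\<Sum>b\<in>onb. fock_monomial [(b, 1), (b, 1)])"
proof -
  have "(virasoro_element :: 'a fock) = (1 / 2) *\<^sub>C (\<Sum>b\<in>onb. mode b (- 1) (mode b (- 1) vacuum))"
    unfolding virasoro_element_def
  proof (rule the_equality)
    show "\<exists>B :: 'a set. orthonormal_basis B \<and> (1 / 2) *\<^sub>C (\<Sum>b\<in>onb. mode b (- 1) (mode b (- 1) (vacuum :: 'a fock)))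
        = (1 / 2) *\<^sub>C (\<Sum>h\<in>B. mode h (- 1) (mode h (- 1) vacuum))"
      using orthonormal_basis_onb by blast
  qed (use sum_orthonormal_basis_squares in auto)
  then show ?thesis by (simp add: fock_monomial_def mode_prod_simps)
qed

lemma fld_single:
  assumes "\<bar>s\<bar> \<le> K"
  shows "fld K [x] s w = mode (x s) s w"
proof -
  have "fld K [x] s w = (\<Sum>m\<in>{-K..K}. if m = s then mode (x s) s w else 0)"
    unfolding fld.simps by (rule sum.cong) (auto simp: mode_linear)
  then show ?thesis using assms by auto
qed

lemma fld_pair:
  "fld K [\<lambda>m. b, \<lambda>m. b] 0 w = 2 *\<^sub>C (\<Sum>m=1..K. mode b (- m) (mode b m w))"
proof -
  \<comment> \<open>Normal ordering gives the terms for \<open>m\<close> and \<open>- m\<close> the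
    same value and the zero mode contributes nothing. The resulting factor 2 cancels the
    \<open>1 / 2\<close> of the Virasoro element.\<close>
  define T where "T m = mode b (- \<bar>m\<bar>) (mode b \<bar>m\<bar> w)" for m :: int
  have "fld K [\<lambda>m. b, \<lambda>m. b] 0 w = (\<Sum>m\<in>{-K..K}. T m)"
    unfolding fld.simps(2)[of K "\<lambda>m. b" "[\<lambda>m. b]"]
    by (rule sum.cong) (auto simp: fld_single T_def simp del: fld.simps)
  also have "\<dots> = (\<Sum>m\<in>{-K..-1} \<union> {1..K}. T m)"
  proof (rule sum.mono_neutral_right)
    show "\<forall>m\<in>{-K..K} - ({-K..-1} \<union> {1..K}). T m = 0"
    proof
      fix m
      assume "m \<in> {-K..K} - ({-K..-1} \<union> {1..K})"
      then have "m = 0" by auto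
      then show "T m = 0" by (simp add: T_def mode_zero)
    qed
  qed auto
  also have "\<dots> = (\<Sum>m\<in>{-K..-1}. T m) + (\<Sum>m\<in>{1..K}. T m)"
    by (rule sum.union_disjoint) auto
  also have "(\<Sum>m\<in>{-K..-1}. T m) = (\<Sum>m\<in>{1..K}. T m)"
    by (rule sum.reindex_bij_witness[of _ uminus uminus]) (auto simp: T_def)
  also have "(\<Sum>m\<in>{1..K}. T m) = (\<Sum>m=1..K. mode b (- m) (mode b m w))"
    by (rule sum.cong) (auto simp: T_def)
  finally show ?thesis
    by (simp only: scaleC_add_left scaleC_one flip: one_add_one)
qed

text \<open>The product \<open>b(-m) b(m)\<close> is \<open>m\<close> times the operator counting
  the variable \<open>b(-m)\<close>.\<close>

lemma coef_mode_neg_pos: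
  assumes "b \<in> onb" "1 \<le> m"
  shows "coef (mode b (- m) (mode b m w)) M = of_int m * of_nat (count M (b, nat m)) * coef w M"
proof (cases "(b, nat m) \<in># M")
  case True
  then obtain K where "M = add_mset (b, nat m) K" by (metis insert_DiffM)
  then show ?thesis using assms by (simp add: coef_mode_onb osc_def)
next
  case False
  then show ?thesis using assms by (simp add: coef_mode_onb osc_def count_eq_zero_iff)
qed

lemma sum_count_eq_wt:
  assumes "M \<in> osc_basis" "int (wt M) \<le> K"
  shows "(\<Sum>b\<in>onb. \<Sum>m=1..K. of_int m * of_nat (count M (b, nat m))) = (of_nat (wt M) :: complex)"
  using assms
proof (induction M)
  case empty
  then show ?case by simp
next
  case (add x M)
  obtain b n where x: "x = (b, n)" by fastforce
  have bn: "b \<in> onb" "1 \<le> n" "int n \<le> K" using add.prems by (auto simp: osc_basis_def x)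
  have "(\<Sum>c\<in>onb. \<Sum>m=1..K. of_int m * of_nat (count (add_mset x M) (c, nat m))) =
      (\<Sum>c\<in>onb. \<Sum>m=1..K. of_int m * of_nat (count M (c, nat m)) + (if c = b \<and> m = int n then of_nat n else (0::complex)))"
    by (intro sum.cong refl) (auto simp: x algebra_simps)
  also have "\<dots> = of_nat (wt M) + (\<Sum>c\<in>onb. \<Sum>m=1..K. if c = b \<and> m = int n then of_nat n else 0)"
    using add by (simp add: sum.distrib osc_basis_def)
  also have "(\<Sum>c\<in>onb. \<Sum>m=1..K. if c = b \<and> m = int n then of_nat n else (0::complex))
      = (\<Sum>c\<in>onb. if c = b then of_nat n else 0)"
    using bn by (intro sum.cong refl) auto
  also have "\<dots> = of_nat n" using bn by simp
  finally show ?case by (simp add: x)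
qed

lemma coef_virasoro_L0:
  assumes M: "M \<in> osc_basis"
  shows "coef (virasoro_L0 v) M = of_nat (wt M) * coef v M"
proof -
  let ?F = "\<lambda>b K. fld K (map derivative_field [(b, 1), (b, 1)]) (1 + 1 - total_degree [(b, 1), (b, 1)]) v"
  have "\<forall>b. \<exists>K0. \<forall>K\<ge>K0. normal_product_coeff [(b, 1), (b, 1)] 1 v = ?F b K"
    using normal_product_coeff_eq_fld by blast
  then obtain K0 where K0: "\<And>b K. K0 b \<le> K \<Longrightarrow> normal_product_coeff [(b, 1), (b, 1)] 1 v = ?F b K"
    by metis
  \<comment> \<open>One truncation has to work for all basis vectors and reach every variable of
    \<open>M\<close>, whose indices are at most \<open>wt M\<close>.\<close>
  define K where "K = max (int (wt M)) (Max (insert 0 (K0 ` onb)))"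
  have K: "K0 b \<le> K" if "b \<in> onb" for b
  proof -
    have "K0 b \<le> Max (insert 0 (K0 ` onb))" using that by (intro Max_ge) auto
    then show ?thesis by (simp add: K_def)
  qed
  have F: "?F b K = 2 *\<^sub>C (\<Sum>m=1..K. mode b (- m) (mode b m v))" for b
  proof -
    have "derivative_field (b, 1) = (\<lambda>m. b)" by (rule ext) (simp add: derivative_field_def)
    then show ?thesis using fld_pair[of K b v] by simp
  qed
  have "virasoro_L0 v = (1 / 2) *\<^sub>C (\<Sum>b\<in>onb. vertex_op (fock_monomial [(b, 1), (b, 1)]) 1 v)"
    unfolding virasoro_L0_def virasoro_element_onb
    by (simp only: clinear_simps[OF clinear_vertex_op] clinear_sum[OF clinear_vertex_op])
  also have "\<dots> = (1 / 2) *\<^sub>C (\<Sum>b\<in>onb. 2 *\<^sub>C (\<Sum>m=1..K. mode b (- m) (mode b m v)))"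
  proof (intro arg_cong[where f = "scaleC (1 / 2)"] sum.cong refl)
    fix b :: 'a
    assume "b \<in> onb"
    have "vertex_op (fock_monomial [(b, 1), (b, 1)]) 1 v = normal_product_coeff [(b, 1), (b, 1)] 1 v"
      by (rule vertex_op_fock_monomial) simp
    also have "\<dots> = ?F b K" by (rule K0) (rule K, fact)
    also have "\<dots> = 2 *\<^sub>C (\<Sum>m=1..K. mode b (- m) (mode b m v))" by (rule F)
    finally show "vertex_op (fock_monomial [(b, 1), (b, 1)]) 1 v
        = 2 *\<^sub>C (\<Sum>m=1..K. mode b (- m) (mode b m v))" .
  qed
  finally have "coef (virasoro_L0 v) M = (\<Sum>b\<in>onb. \<Sum>m=1..K. coef (mode b (- m) (mode b m v)) M)"
    by (simp add: coef_linear coef_sum sum_distrib_left)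
  also have "\<dots> = (\<Sum>b\<in>onb. \<Sum>m=1..K. of_int m * of_nat (count M (b, nat m)) * coef v M)"
    by (intro sum.cong refl coef_mode_neg_pos) auto
  also have "\<dots> = of_nat (wt M) * coef v M"
    using sum_count_eq_wt[OF M, of K] by (simp add: K_def sum_distrib_right[symmetric])
  finally show ?thesis .
qed

lemma weight_space_iff: "v \<in> weight_space n \<longleftrightarrow> (\<forall>M. coef v M \<noteq> 0 \<longrightarrow> wt M = n)"
proof
  assume v: "v \<in> weight_space n"
  show "\<forall>M. coef v M \<noteq> 0 \<longrightarrow> wt M = n"
  proof (intro allI impI)
    fix M
    assume M: "coef v M \<noteq> 0"
    then have "M \<in> osc_basis" using fock_expand(2) by blast
    from coef_virasoro_L0[OF this, of v] show "wt M = n"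
      using v M by (simp add: weight_space_def coef_linear)
  qed
next
  assume "\<forall>M. coef v M \<noteq> 0 \<longrightarrow> wt M = n"
  then have "virasoro_L0 v = of_nat n *\<^sub>C v"
    by (intro fock_eqI) (auto simp: coef_virasoro_L0 coef_linear)
  then show "v \<in> weight_space n" by (simp add: weight_space_def)
qed

lemma fock_monomial_weight: "fock_monomial xs \<in> weight_space (\<Sum>x\<leftarrow>xs. snd x)"
proof (induction xs)
  case Nil
  then show ?case by (auto simp: weight_space_iff fock_monomial_def mode_prod_simps coef_vacuum)
next
  case (Cons x xs)
  have "fock_monomial (x # xs) = mode (fst x) (- int (snd x)) (fock_monomial xs)"
    by (simp add: fock_monomial_def mode_prod_simps case_prod_unfold)
  then show ?case
    using Cons coef_mode_shift[of "fst x" "- int (snd x)" "fock_monomial xs"]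
    by (force simp: weight_space_iff)
qed

lemma mon_weight: "mon N \<in> weight_space (wt N)"
proof -
  obtain xs where "mset xs = N" using ex_mset by blast
  moreover from this have "wt N = (\<Sum>x\<leftarrow>xs. snd x)"
    by (metis mset_map sum_mset_sum_list wt_def)
  ultimately show ?thesis using fock_monomial_weight[of xs] by (simp add: fock_monomial_mon)
qed

text \<open>By \<open>weight_space_iff\<close> a vector of weight \<open>k\<close> involves only
  monomials of weight \<open>k\<close>, so the linear extension from monomials, each taken with its
  own weight, agrees with the mode prescribed on every weight space.\<close>

lemma zero_mode_ex1:
  "\<exists>!o'. (\<forall>w. clinear (\<lambda>v :: 'h::bilinear_form_space fock. o' v w)) \<and>
    (\<forall>k. \<forall>v\<in>weight_space k. \<forall>w. o' v w = vertex_op v (int k - 1) w)"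
proof (rule ex_ex1I)
  define Z where "Z v w = mon_extend (\<lambda>M. vertex_op (mon M) (int (wt M) - 1) w) v" for v w :: "'h fock"
  have "Z v w = vertex_op v (int k - 1) w" if v: "v \<in> weight_space k" for v k w
  proof -
    have "vertex_op v (int k - 1) w = vertex_op (\<Sum>M | coef v M \<noteq> 0. coef v M *\<^sub>C mon M) (int k - 1) w"
      by (rule arg_cong[where f = "\<lambda>v. vertex_op v (int k - 1) w", OF fock_expand(3)])
    also have "\<dots> = (\<Sum>M | coef v M \<noteq> 0. coef v M *\<^sub>C vertex_op (mon M) (int k - 1) w)"
      by (simp only: clinear_simps[OF clinear_vertex_op] clinear_sum[OF clinear_vertex_op])
    also have "\<dots> = Z v w"
      unfolding Z_def mon_extend_def using v by (intro sum.cong) (auto simp: weight_space_iff)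
    finally show ?thesis by simp
  qed
  moreover have "clinear (\<lambda>v. Z v w)" for w unfolding Z_def by (rule clinear_mon_extend)
  ultimately show "\<exists>o'. (\<forall>w. clinear (\<lambda>v :: 'h fock. o' v w)) \<and>
    (\<forall>k. \<forall>v\<in>weight_space k. \<forall>w. o' v w = vertex_op v (int k - 1) w)" by blast
next
  fix Y Z :: "'h fock \<Rightarrow> 'h fock \<Rightarrow> 'h fock"
  assume Y: "(\<forall>w. clinear (\<lambda>v. Y v w)) \<and> (\<forall>k. \<forall>v\<in>weight_space k. \<forall>w. Y v w = vertex_op v (int k - 1) w)"
    and Z: "(\<forall>w. clinear (\<lambda>v. Z v w)) \<and> (\<forall>k. \<forall>v\<in>weight_space k. \<forall>w. Z v w = vertex_op v (int k - 1) w)"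
  have "Y v w = Z v w" for v w
  proof (rule clinear_eq_on_mon[where f = "\<lambda>v. Y v w" and g = "\<lambda>v. Z v w"])
    fix N :: "('h \<times> nat) multiset"
    have "Y (mon N) w = vertex_op (mon N) (int (wt N) - 1) w" using Y mon_weight[of N] by blast
    moreover have "Z (mon N) w = vertex_op (mon N) (int (wt N) - 1) w" using Z mon_weight[of N] by blast
    ultimately show "Y (mon N) w = Z (mon N) w" by simp
  qed (use Y Z in auto)
  then show "Y = Z" by blast
qed

lemma clinear_zero_mode: "clinear (\<lambda>v. zero_mode v w)"
  using theI'[OF zero_mode_ex1] unfolding zero_mode_def[symmetric] by blast

lemma zero_mode_weight_space: "v \<in> weight_space k \<Longrightarrow> zero_mode v w = vertex_op v (int k - 1) w"
  using theI'[OF zero_mode_ex1] unfolding zero_mode_def[symmetric] by blast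

lemma zero_mode_fock_monomial:
  assumes "\<forall>(a, k)\<in>set xs. 1 \<le> k"
  shows "\<exists>K0. \<forall>K\<ge>K0. zero_mode (fock_monomial xs) w = fld K (map derivative_field xs) 0 w"
proof -
  have "zero_mode (fock_monomial xs) w = normal_product_coeff xs (total_degree xs - 1) w"
    using zero_mode_weight_space[OF fock_monomial_weight[of xs], of w] vertex_op_fock_monomial[OF assms]
    by (simp add: total_degree_def)
  then show ?thesis using normal_product_coeff_eq_fld[of xs "total_degree xs - 1" w] by simp
qed

section \<open>Traces and the Wick formula\<close>

text \<open>The weight is an integer so that shifts by mode numbers need no side condition; for
  negative \<open>k\<close> the set is empty.\<close>

definition osc_weight :: "int \<Rightarrow> ('h::bilinear_form_space \<times> nat) multiset set"
  where "osc_weight k = {M \<in> osc_basis. int (wt M) = k}"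

lemma size_le_wt: "M \<in> osc_basis \<Longrightarrow> size M \<le> wt M"
  by (induction M) (auto simp: osc_basis_def)

lemma mem_le_wt: "x \<in># M \<Longrightarrow> snd x \<le> wt M"
  by (auto dest!: multi_member_split)

lemma finite_osc_weight [simp]: "finite (osc_weight k :: ('h::bilinear_form_space \<times> nat) multiset set)"
proof -
  let ?A = "onb \<times> {..nat k} :: ('h \<times> nat) set"
  have "finite {xs. set xs \<subseteq> ?A \<and> length xs \<le> nat k}"
    by (rule finite_lists_length_le) simp
  moreover have "osc_weight k \<subseteq> mset ` {xs. set xs \<subseteq> ?A \<and> length xs \<le> nat k}"
  proof
    fix M :: "('h \<times> nat) multiset"
    assume M: "M \<in> osc_weight k"
    obtain xs where xs: "mset xs = M" using ex_mset by blast
    have "set xs \<subseteq> ?A"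
      using M xs mem_le_wt[of _ M] by (fastforce simp: osc_weight_def osc_basis_def)
    moreover have "length xs \<le> nat k"
      using M xs size_le_wt[of M] by (auto simp: osc_weight_def)
    ultimately show "M \<in> mset ` {xs. set xs \<subseteq> ?A \<and> length xs \<le> nat k}" using xs by blast
  qed
  ultimately show ?thesis by (meson finite_imageI finite_subset)
qed

definition homogeneous :: "int \<Rightarrow> 'h::bilinear_form_space fock \<Rightarrow> bool"
  where "homogeneous k v \<longleftrightarrow> (\<forall>M. coef v M \<noteq> 0 \<longrightarrow> int (wt M) = k)"

lemma homogeneous_expand:
  assumes "homogeneous k v"
  shows "v = (\<Sum>M\<in>osc_weight k. coef v M *\<^sub>C mon M)"
proof -
  have "v = (\<Sum>M | coef v M \<noteq> 0. coef v M *\<^sub>C mon M)" by (rule fock_expand(3))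
  also have "\<dots> = (\<Sum>M\<in>osc_weight k. coef v M *\<^sub>C mon M)"
  proof (rule sum.mono_neutral_left)
    show "{M. coef v M \<noteq> 0} \<subseteq> osc_weight k"
      using assms fock_expand(2)[of v] by (auto simp: osc_weight_def homogeneous_def)
  qed auto
  finally show ?thesis .
qed

lemma homogeneous_linear:
  "homogeneous k 0"
  "homogeneous k v \<Longrightarrow> homogeneous k w \<Longrightarrow> homogeneous k (v + w)"
  "homogeneous k v \<Longrightarrow> homogeneous k (c *\<^sub>C v)"
  unfolding homogeneous_def by (auto simp: coef_linear) (metis add.right_neutral)

lemma homogeneous_sum: "(\<And>i. i \<in> A \<Longrightarrow> homogeneous k (f i)) \<Longrightarrow> homogeneous k (\<Sum>i\<in>A. f i)"
  by (induction A rule: infinite_finite_induct) (simp_all add: homogeneous_linear)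

lemma homogeneous_mon: "M \<in> osc_basis \<Longrightarrow> homogeneous (int (wt M)) (mon M)"
  by (simp add: homogeneous_def coef_mon)

definition lowers :: "int \<Rightarrow> ('h::bilinear_form_space fock \<Rightarrow> 'h fock) \<Rightarrow> bool"
  where "lowers s X \<longleftrightarrow> clinear X \<and> (\<forall>k v. homogeneous k v \<longrightarrow> homogeneous (k - s) (X v))"

lemma lowers_mode: "lowers m (mode a m)"
  unfolding lowers_def homogeneous_def using clinear_mode coef_mode_shift by fastforce

lemma lowers_fld: "lowers s (fld K xs s)"
proof (induction xs arbitrary: s)
  case Nil
  show ?case
    unfolding lowers_def by (intro conjI clinear_fld) (auto simp: homogeneous_linear)
next
  case (Cons x xs)
  have "homogeneous (k - s) (fld K (x # xs) s v)" if v: "homogeneous k v" for k v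
    unfolding fld.simps
  proof (rule homogeneous_sum)
    fix m
    have "homogeneous (k - (s - m) - m) (mode (x m) m (fld K xs (s - m) v))"
      using lowers_mode Cons.IH v unfolding lowers_def by blast
    moreover have "homogeneous (k - m - (s - m)) (fld K xs (s - m) (mode (x m) m v))"
      using lowers_mode Cons.IH v unfolding lowers_def by blast
    ultimately show "homogeneous (k - s)
        (if m < 0 then mode (x m) m (fld K xs (s - m) v) else fld K xs (s - m) (mode (x m) m v))"
      by simp
  qed
  then show ?case using clinear_fld by (simp add: lowers_def del: fld.simps)
qed

definition wtrace :: "int \<Rightarrow> ('h::bilinear_form_space fock \<Rightarrow> 'h fock) \<Rightarrow> complex"
  where "wtrace k X = (\<Sum>M\<in>osc_weight k. coef (X (mon M)) M)"

text \<open>On weight \<open>k\<close> the product \<open>X Y\<close> passes through weight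
  \<open>k + s\<close>. Both traces are the same finite double sum of matrix coefficients between
  these two weights, hence the shift on the right.\<close>

lemma wtrace_cyclic:
  assumes X: "lowers s X" and Y: "lowers (- s) Y"
  shows "wtrace k (\<lambda>w. X (Y w)) = wtrace (k + s) (\<lambda>w. Y (X w))"
proof -
  have lin: "clinear X" "clinear Y" using X Y by (auto simp: lowers_def)
  have hom: "homogeneous k (mon M)" if "M \<in> osc_weight k" for M k
    using homogeneous_mon that by (auto simp: osc_weight_def)
  have 1: "coef (X (Y (mon M))) M = (\<Sum>N\<in>osc_weight (k + s). coef (Y (mon M)) N * coef (X (mon N)) M)"
    if "M \<in> osc_weight k" for M
  proof -
    have "homogeneous (k - - s) (Y (mon M))" using Y hom[OF that] by (simp add: lowers_def)
    then have "homogeneous (k + s) (Y (mon M))" by simp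
    then have "X (Y (mon M)) = X (\<Sum>N\<in>osc_weight (k + s). coef (Y (mon M)) N *\<^sub>C mon N)"
      by (intro arg_cong[where f = X] homogeneous_expand)
    also have "\<dots> = (\<Sum>N\<in>osc_weight (k + s). coef (Y (mon M)) N *\<^sub>C X (mon N))"
      by (simp add: clinear_sum[OF lin(1)] clinear_simps[OF lin(1)])
    finally show ?thesis by (simp add: coef_sum coef_linear)
  qed
  have 2: "coef (Y (X (mon N))) N = (\<Sum>M\<in>osc_weight k. coef (X (mon N)) M * coef (Y (mon M)) N)"
    if "N \<in> osc_weight (k + s)" for N
  proof -
    have "homogeneous (k + s - s) (X (mon N))" using X hom[OF that] unfolding lowers_def by blast
    then have "homogeneous k (X (mon N))" by simp
    then have "Y (X (mon N)) = Y (\<Sum>M\<in>osc_weight k. coef (X (mon N)) M *\<^sub>C mon M)"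
      by (intro arg_cong[where f = Y] homogeneous_expand)
    also have "\<dots> = (\<Sum>M\<in>osc_weight k. coef (X (mon N)) M *\<^sub>C Y (mon M))"
      by (simp add: clinear_sum[OF lin(2)] clinear_simps[OF lin(2)])
    finally show ?thesis by (simp add: coef_sum coef_linear)
  qed
  show ?thesis
    unfolding wtrace_def by (simp add: 1 2, subst sum.swap) (simp add: mult.commute)
qed

lemma wtrace_linear:
  "wtrace k (\<lambda>w. X w + Y w) = wtrace k X + wtrace k Y"
  "wtrace k (\<lambda>w. c *\<^sub>C X w) = c * wtrace k X"
  "wtrace k (\<lambda>w. 0) = 0"
  by (simp_all add: wtrace_def coef_linear sum.distrib sum_distrib_left)

text \<open>\<open>removal_sum f [x\<^sub>1, \<dots>, x\<^sub>n]\<close> is the sum over \<open>i\<close> of \<open>f x\<^sub>i [x\<^sub>1, \<dots>, x\<^sub>n]\<close> with \<open>x\<^sub>i\<close> removed from the list.\<close>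

fun removal_sum :: "('a \<Rightarrow> 'a list \<Rightarrow> 'b::comm_monoid_add) \<Rightarrow> 'a list \<Rightarrow> 'b" where
  "removal_sum f [] = 0"
| "removal_sum f (x # xs) = f x xs + removal_sum (\<lambda>y ys. f y (x # ys)) xs"

lemma removal_sum_sum: "removal_sum (\<lambda>y ys. \<Sum>i\<in>A. f i y ys) xs = (\<Sum>i\<in>A. removal_sum (f i) xs)"
  by (induction xs arbitrary: f) (simp_all add: sum.distrib)

lemma removal_sum_hom:
  assumes "h 0 = 0" "\<And>u v. h (u + v) = h u + h v"
  shows "h (removal_sum f xs) = removal_sum (\<lambda>y ys. h (f y ys)) xs"
  by (induction xs arbitrary: f) (simp_all add: assms)

lemma removal_sum_clinear: "clinear h \<Longrightarrow> h (removal_sum f xs) = removal_sum (\<lambda>y ys. h (f y ys)) xs"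
  by (rule removal_sum_hom) (simp_all add: clinear_add clinear_0)

text \<open>Commuting \<open>a(m)\<close> through a normally ordered product contracts it with one
  factor at a time. Only mode \<open>- m\<close> of that factor fails to commute, which leaves the
  remaining factors with total mode \<open>s + m\<close>; the hypothesis keeps \<open>- m\<close>
  inside the truncation.\<close>

lemma mode_fld_commute:
  assumes "\<bar>m\<bar> \<le> K"
  shows "mode a m (fld K xs s w) = fld K xs s (mode a m w) +
    removal_sum (\<lambda>y ys. (of_int m * bform a (y (- m))) *\<^sub>C fld K ys (s + m) w) xs"
proof (induction xs arbitrary: s w)
  case Nil
  then show ?case by (simp add: mode_linear)
next
  case (Cons x xs)
  define c where "c y = of_int m * bform a (y (- m))" for y :: "int \<Rightarrow> 'a"
  define T where "T l xs s w = (if l < 0 then mode (x l) l (fld K xs (s - l) w) else fld K xs (s - l) (mode (x l) l w))"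
    for l xs s w
  have T: "mode a m (T l xs s w) = T l xs s (mode a m w) + (if l = - m then c x *\<^sub>C fld K xs (s + m) w else 0)
      + removal_sum (\<lambda>y ys. c y *\<^sub>C T l ys (s + m) w) xs" for l
  proof -
    define d where "d = (if l = - m then c x else 0)"
    have d: "(if l = - m then c x *\<^sub>C fld K xs (s + m) w else 0) = d *\<^sub>C fld K xs (s - l) w"
      by (simp add: d_def)
    have comm: "mode a m (mode (x l) l v) = mode (x l) l (mode a m v) + d *\<^sub>C v" for v
      by (subst mode_commute) (auto simp: c_def d_def add_eq_0_iff)
    have rl: "mode (x l) l (removal_sum f xs) = removal_sum (\<lambda>y ys. mode (x l) l (f y ys)) xs" for f
      by (rule removal_sum_clinear[OF clinear_mode])
    show ?thesis
      unfolding T_def d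
      by (simp add: comm Cons.IH mode_linear rl fld_linear c_def[symmetric] add_ac add_diff_eq)
  qed
  have "mode a m (fld K (x # xs) s w) = (\<Sum>l\<in>{-K..K}. mode a m (T l xs s w))"
    by (simp add: T_def mode_linear)
  also have "\<dots> = (\<Sum>l\<in>{-K..K}. T l xs s (mode a m w)) + (\<Sum>l\<in>{-K..K}. if l = - m then c x *\<^sub>C fld K xs (s + m) w else 0)
      + (\<Sum>l\<in>{-K..K}. removal_sum (\<lambda>y ys. c y *\<^sub>C T l ys (s + m) w) xs)"
    by (simp add: T sum.distrib)
  also have "(\<Sum>l\<in>{-K..K}. if l = - m then c x *\<^sub>C fld K xs (s + m) w else 0) = c x *\<^sub>C fld K xs (s + m) w"
    using assms by (auto simp: abs_le_iff)
  also have "(\<Sum>l\<in>{-K..K}. T l xs s (mode a m w)) = fld K (x # xs) s (mode a m w)"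
    by (simp add: T_def)
  also have "(\<Sum>l\<in>{-K..K}. removal_sum (\<lambda>y ys. c y *\<^sub>C T l ys (s + m) w) xs)
      = removal_sum (\<lambda>y ys. c y *\<^sub>C fld K (x # ys) (s + m) w) xs"
    by (simp add: removal_sum_sum[symmetric] complex_vector.scale_sum_right[symmetric] T_def)
  finally show ?case by (simp add: c_def add_ac del: fld.simps)
qed

section \<open>Traces as power series and the Wick recursion\<close>

definition geom_fps :: "nat \<Rightarrow> complex fps"
  where "geom_fps m = fps_X ^ m * inverse (1 - fps_X ^ m)"

lemma geom_fps_mult: "1 \<le> m \<Longrightarrow> geom_fps m * (1 - fps_X ^ m) = fps_X ^ m"
  unfolding geom_fps_def mult.assoc
  by (subst inverse_mult_eq_1) (auto simp: fps_X_power_nth)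

lemma one_minus_X_power_nonzero:
  assumes "1 \<le> m"
  shows "(1 - fps_X ^ m :: complex fps) \<noteq> 0"
proof
  assume "(1 - fps_X ^ m :: complex fps) = 0"
  then have "(1 - fps_X ^ m :: complex fps) $ 0 = (0 :: complex fps) $ 0" by (rule arg_cong)
  moreover have "(1 - fps_X ^ m :: complex fps) $ 0 = 1" using assms by (auto simp: fps_X_power_nth)
  ultimately show False by simp
qed

lemma fps_eq_geom_mult:
  fixes t r :: "complex fps"
  assumes m: "1 \<le> m" and t: "t = fps_X ^ m * (t + r)"
  shows "t = geom_fps m * r"
proof -
  have "(1 - fps_X ^ m) * t = fps_X ^ m * r" using t by (simp add: algebra_simps)
  also have "\<dots> = geom_fps m * (1 - fps_X ^ m) * r" by (simp only: geom_fps_mult[OF m])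
  also have "\<dots> = (1 - fps_X ^ m) * (geom_fps m * r)" by (simp only: mult_ac)
  finally have "(1 - fps_X ^ m) * (t - geom_fps m * r) = 0" by (simp add: algebra_simps)
  moreover have "(1 - fps_X ^ m :: complex fps) \<noteq> 0" using m by (rule one_minus_X_power_nonzero)
  ultimately show ?thesis by (simp del: mult_cancel_left)
qed

definition trace_fps :: "('h::bilinear_form_space fock \<Rightarrow> 'h fock) \<Rightarrow> complex fps"
  where "trace_fps X = Abs_fps (\<lambda>n. wtrace (int n) X)"

lemma wtrace_neg: "k < 0 \<Longrightarrow> wtrace k X = 0"
proof -
  assume "k < 0"
  then have "osc_weight k = ({} :: ('a \<times> nat) multiset set)" by (auto simp: osc_weight_def)
  then show ?thesis by (simp add: wtrace_def)
qed

lemma trace_fps_shift: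
  assumes "\<And>k. wtrace k X = wtrace (k - int m) Y"
  shows "trace_fps X = fps_X ^ m * trace_fps Y"
  by (rule fps_ext) (auto simp: trace_fps_def fps_X_power_mult_nth assms wtrace_neg of_nat_diff)

lemma trace_fps_linear:
  "trace_fps (\<lambda>w. X w + Y w) = trace_fps X + trace_fps Y"
  "trace_fps (\<lambda>w. c *\<^sub>C X w) = fps_const c * trace_fps X"
  "trace_fps (\<lambda>w. 0) = 0"
  by (auto simp: trace_fps_def fps_eq_iff wtrace_linear)

lemma trace_fps_minus: "trace_fps (\<lambda>w. - X w) = - trace_fps X"
  using trace_fps_linear(2)[of "- 1" X] by (simp flip: fps_const_neg)

lemma trace_fps_sum: "trace_fps (\<lambda>w. \<Sum>i\<in>A. X i w) = (\<Sum>i\<in>A. trace_fps (X i))"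
  by (induction A rule: infinite_finite_induct) (simp_all add: trace_fps_linear)

lemma trace_fps_removal_sum:
  "trace_fps (\<lambda>w. removal_sum (\<lambda>y ys. X y ys w) xs) = removal_sum (\<lambda>y ys. trace_fps (X y ys)) xs"
  by (induction xs arbitrary: X) (simp_all add: trace_fps_linear)

text \<open>
  Moving the mode \<open>a(m)\<close> around the trace multiplies it by \<open>X\<^sup>m\<close>, and moving it back through the other
  factors produces the contractions; solving for the trace gives the factor \<open>X\<^sup>m / (1 - X\<^sup>m)\<close>.
\<close>

lemma trace_fps_annihilator_term:
  assumes m: "1 \<le> m" "int m \<le> K"
  shows "trace_fps (\<lambda>w. fld K xs (- int m) (mode a (int m) w)) =
    geom_fps m * removal_sum (\<lambda>y ys. fps_const (of_nat m * bform a (y (- int m))) * trace_fps (fld K ys 0)) xs"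
proof (rule fps_eq_geom_mult[OF m(1)])
  have "trace_fps (\<lambda>w. fld K xs (- int m) (mode a (int m) w))
      = fps_X ^ m * trace_fps (\<lambda>w. mode a (int m) (fld K xs (- int m) w))"
    using wtrace_cyclic[OF lowers_fld[of "- int m" K xs], of "mode a (int m)"] lowers_mode[of "int m" a]
    by (intro trace_fps_shift) simp
  also have "trace_fps (\<lambda>w. mode a (int m) (fld K xs (- int m) w))
      = trace_fps (\<lambda>w. fld K xs (- int m) (mode a (int m) w)) +
        removal_sum (\<lambda>y ys. fps_const (of_nat m * bform a (y (- int m))) * trace_fps (fld K ys 0)) xs"
    using m by (subst mode_fld_commute) (simp_all add: trace_fps_linear trace_fps_removal_sum)
  finally show "trace_fps (\<lambda>w. fld K xs (- int m) (mode a (int m) w)) = fps_X ^ m *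
    (trace_fps (\<lambda>w. fld K xs (- int m) (mode a (int m) w)) +
        removal_sum (\<lambda>y ys. fps_const (of_nat m * bform a (y (- int m))) * trace_fps (fld K ys 0)) xs)" .
qed

text \<open>For a creator the sign of the reversed commutation and the negative mode number cancel,
  so the contraction enters with the same sign and the same geometric factor as for an
  annihilator.\<close>

lemma trace_fps_creator_term:
  assumes m: "1 \<le> m" "int m \<le> K"
  shows "trace_fps (\<lambda>w. mode a (- int m) (fld K xs (int m) w)) =
    geom_fps m * removal_sum (\<lambda>y ys. fps_const (of_nat m * bform a (y (int m))) * trace_fps (fld K ys 0)) xs"
proof (rule fps_eq_geom_mult[OF m(1)])
  let ?R = "removal_sum (\<lambda>y ys. fps_const (of_nat m * bform a (y (int m))) * trace_fps (fld K ys 0)) xs"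
  have neg: "removal_sum (\<lambda>y ys. - (fps_const (of_nat m * bform a (y (int m))) * trace_fps (fld K ys 0))) xs = - ?R"
    by (subst removal_sum_hom[where h = uminus]) simp_all
  have "trace_fps (\<lambda>w. mode a (- int m) (fld K xs (int m) w))
      = fps_X ^ m * trace_fps (\<lambda>w. fld K xs (int m) (mode a (- int m) w))"
    using wtrace_cyclic[OF lowers_mode[of "- int m" a], of "fld K xs (int m)"] lowers_fld[of "int m" K xs]
    by (intro trace_fps_shift) simp
  also have "trace_fps (\<lambda>w. mode a (- int m) (fld K xs (int m) w))
      = trace_fps (\<lambda>w. fld K xs (int m) (mode a (- int m) w)) - ?R"
    using m by (subst mode_fld_commute) (simp_all add: trace_fps_linear trace_fps_minus trace_fps_removal_sum neg)
  then have "trace_fps (\<lambda>w. fld K xs (int m) (mode a (- int m) w))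
      = trace_fps (\<lambda>w. mode a (- int m) (fld K xs (int m) w)) + ?R" by simp
  finally show "trace_fps (\<lambda>w. mode a (- int m) (fld K xs (int m) w)) = fps_X ^ m *
    (trace_fps (\<lambda>w. mode a (- int m) (fld K xs (int m) w)) + ?R)" .
qed

text \<open>The trace of a normally ordered product of two fields divided by the character, with
  modes cut off at \<open>K\<close>. The two summands stem from the annihilating and the creating
  half of \<open>x\<close>.\<close>

definition pairing_upto :: "nat \<Rightarrow> (int \<Rightarrow> 'h::bilinear_form_space) \<Rightarrow> (int \<Rightarrow> 'h) \<Rightarrow> complex fps"
  where "pairing_upto K x y = (\<Sum>m=1..K.
    fps_const (of_nat m * (bform (x (int m)) (y (- int m)) + bform (x (- int m)) (y (int m)))) * geom_fps m)"

lemma sum_int_symmetric_interval: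
  fixes T :: "int \<Rightarrow> 'b::comm_monoid_add"
  assumes "T 0 = 0"
  shows "(\<Sum>m\<in>{- int K..int K}. T m) = (\<Sum>m=1..K. T (int m) + T (- int m))"
proof (induction K)
  case (Suc K)
  have "{- int (Suc K)..int (Suc K)} = insert (int (Suc K)) (insert (- int (Suc K)) {- int K..int K})"
    by auto
  then show ?case using Suc by (simp add: add_ac)
qed (simp add: assms)

text \<open>One step of the Wick formula: the first field is paired with each of the others, and
  iteration produces all perfect matchings. Modes \<open>m\<close> and \<open>- m\<close> are
  collected together, and the zero mode drops out.\<close>

lemma trace_fps_fld_Cons:
  "trace_fps (fld (int K) (x # xs) 0) =
    removal_sum (\<lambda>y ys. pairing_upto K x y * trace_fps (fld (int K) ys 0)) xs"
proof -
  define T where "T m w = (if m < 0 then mode (x m) m (fld (int K) xs (0 - m) w) else fld (int K) xs (0 - m) (mode (x m) m w))"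
    for m w
  have "trace_fps (fld (int K) (x # xs) 0) = trace_fps (\<lambda>w. \<Sum>m\<in>{- int K..int K}. T m w)"
    by (rule arg_cong[where f = trace_fps]) (simp add: fun_eq_iff T_def)
  also have "\<dots> = (\<Sum>m\<in>{- int K..int K}. trace_fps (T m))" by (rule trace_fps_sum)
  also have "\<dots> = (\<Sum>m=1..K. trace_fps (T (int m)) + trace_fps (T (- int m)))"
  proof (rule sum_int_symmetric_interval)
    have "T 0 = (\<lambda>w. 0)" by (rule ext) (simp add: T_def mode_zero fld_linear)
    then show "trace_fps (T 0) = 0" by (simp add: trace_fps_linear)
  qed
  also have "\<dots> = (\<Sum>m=1..K. removal_sum (\<lambda>y ys.
      fps_const (of_nat m * (bform (x (int m)) (y (- int m)) + bform (x (- int m)) (y (int m)))) * geom_fps m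
      * trace_fps (fld (int K) ys 0)) xs)"
  proof (rule sum.cong[OF refl])
    fix m
    assume "m \<in> {1..K}"
    then have m: "1 \<le> m" "int m \<le> int K" by auto
    let ?t = "\<lambda>ys. trace_fps (fld (int K) ys 0)"
    have 1: "T (int m) = (\<lambda>w. fld (int K) xs (- int m) (mode (x (int m)) (int m) w))"
      by (simp add: T_def fun_eq_iff)
    have 2: "T (- int m) = (\<lambda>w. mode (x (- int m)) (- int m) (fld (int K) xs (int m) w))"
      using m by (simp add: T_def fun_eq_iff)
    have "trace_fps (T (int m)) + trace_fps (T (- int m)) =
        removal_sum (\<lambda>y ys. geom_fps m * (fps_const (of_nat m * bform (x (int m)) (y (- int m))) * ?t ys)) xs
        + removal_sum (\<lambda>y ys. geom_fps m * (fps_const (of_nat m * bform (x (- int m)) (y (int m))) * ?t ys)) xs"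
      unfolding 1 2 trace_fps_annihilator_term[OF m] trace_fps_creator_term[OF m]
      by (simp add: removal_sum_hom[where h = "\<lambda>f. geom_fps m * f"] distrib_left)
    also have "\<dots> = removal_sum (\<lambda>y ys.
      fps_const (of_nat m * (bform (x (int m)) (y (- int m)) + bform (x (- int m)) (y (int m)))) * geom_fps m
      * ?t ys) xs"
      \<comment> \<open>Two removal sums are added by treating them as one sum over a two-element
        index set.\<close>
      using removal_sum_sum[where A = "{True, False}" and xs = xs and f = "\<lambda>i y ys. if i
        then geom_fps m * (fps_const (of_nat m * bform (x (int m)) (y (- int m))) * ?t ys)
        else geom_fps m * (fps_const (of_nat m * bform (x (- int m)) (y (int m))) * ?t ys)", symmetric]
      by (simp add: distrib_left distrib_right mult_ac flip: fps_const_add)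
    finally show "trace_fps (T (int m)) + trace_fps (T (- int m)) = removal_sum (\<lambda>y ys.
      fps_const (of_nat m * (bform (x (int m)) (y (- int m)) + bform (x (- int m)) (y (int m)))) * geom_fps m
      * ?t ys) xs" .
  qed
  also have "\<dots> = removal_sum (\<lambda>y ys. pairing_upto K x y * trace_fps (fld (int K) ys 0)) xs"
    by (simp add: removal_sum_sum[symmetric] pairing_upto_def sum_distrib_right)
  finally show ?thesis .
qed

section \<open>Trace functions as power series\<close>

text \<open>\<open>subspace_trace\<close> uses an unspecified basis, and this moves it to the
  monomials. Expanding each \<open>b\<close> in \<open>C\<close> before applying \<open>f\<close>
  gives a double sum that can equally be read as the trace over \<open>C\<close>.\<close>

lemma trace_basis_change:
  fixes f :: "'a::complex_vector \<Rightarrow> 'a"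
  assumes B: "complex_vector.independent B" "complex_vector.span B = S" "finite B"
    and C: "complex_vector.independent C" "complex_vector.span C = S" "finite C"
    and f: "clinear f" "\<And>v. v \<in> S \<Longrightarrow> f v \<in> S"
  shows "(\<Sum>b\<in>B. complex_vector.representation B (f b) b) = (\<Sum>c\<in>C. complex_vector.representation C (f c) c)"
proof -
  let ?rB = "complex_vector.representation B" and ?rC = "complex_vector.representation C"
  have eB: "(\<Sum>b\<in>B. ?rB v b *\<^sub>C b) = v" if "v \<in> S" for v
    using complex_vector.sum_representation_eq[of B v B] B that by simp
  have eC: "(\<Sum>c\<in>C. ?rC v c *\<^sub>C c) = v" if "v \<in> S" for v
    using complex_vector.sum_representation_eq[of C v C] C that by simp
  have inS: "b \<in> S" if "b \<in> B" for b using B(2) complex_vector.span_base that by blast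
  have inS': "c \<in> S" if "c \<in> C" for c using C(2) complex_vector.span_base that by blast
  have rB: "?rB (\<Sum>c\<in>C. g c *\<^sub>C f c) b = (\<Sum>c\<in>C. g c * ?rB (f c) b)" for g b
  proof -
    have "?rB (\<Sum>c\<in>C. g c *\<^sub>C f c) b = (\<Sum>c\<in>C. ?rB (g c *\<^sub>C f c) b)"
      by (subst complex_vector.representation_sum)
        (use B C f inS' in \<open>auto intro!: complex_vector.span_scale\<close>)
    also have "\<dots> = (\<Sum>c\<in>C. g c * ?rB (f c) b)"
      by (intro sum.cong refl, subst complex_vector.representation_scale) (use B f inS' in auto)
    finally show ?thesis .
  qed
  have rC: "?rC (\<Sum>b\<in>B. g b *\<^sub>C b) c = (\<Sum>b\<in>B. g b * ?rC b c)" for g c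
  proof -
    have "?rC (\<Sum>b\<in>B. g b *\<^sub>C b) c = (\<Sum>b\<in>B. ?rC (g b *\<^sub>C b) c)"
      by (subst complex_vector.representation_sum)
        (use B C inS in \<open>auto intro!: complex_vector.span_scale\<close>)
    also have "\<dots> = (\<Sum>b\<in>B. g b * ?rC b c)"
      by (intro sum.cong refl, subst complex_vector.representation_scale) (use C inS in auto)
    finally show ?thesis .
  qed
  have "(\<Sum>b\<in>B. ?rB (f b) b) = (\<Sum>b\<in>B. \<Sum>c\<in>C. ?rC b c * ?rB (f c) b)"
  proof (rule sum.cong[OF refl])
    fix b
    assume "b \<in> B"
    then have "f b = f (\<Sum>c\<in>C. ?rC b c *\<^sub>C c)" by (simp add: eC inS)
    also have "\<dots> = (\<Sum>c\<in>C. ?rC b c *\<^sub>C f c)"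
      by (simp add: clinear_sum[OF f(1)] clinear_simps[OF f(1)])
    finally show "?rB (f b) b = (\<Sum>c\<in>C. ?rC b c * ?rB (f c) b)" by (simp add: rB)
  qed
  also have "\<dots> = (\<Sum>c\<in>C. \<Sum>b\<in>B. ?rB (f c) b * ?rC b c)"
    by (subst sum.swap) (simp add: mult.commute)
  also have "\<dots> = (\<Sum>c\<in>C. ?rC (f c) c)"
    by (intro sum.cong refl) (simp add: rC[symmetric] eB f(2) inS')
  finally show ?thesis .
qed

lemma weight_space_homogeneous: "v \<in> weight_space n \<longleftrightarrow> homogeneous (int n) v"
  by (simp add: weight_space_iff homogeneous_def)

lemma osc_weight_subset: "osc_weight k \<subseteq> osc_basis"
  by (auto simp: osc_weight_def)

lemma independent_mon:
  "complex_vector.independent (mon ` (osc_weight k :: ('a::bilinear_form_space \<times> nat) multiset set))"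
proof (rule complex_vector.independent_if_scalars_zero)
  show "finite (mon ` (osc_weight k :: ('a \<times> nat) multiset set))" by simp
  fix f :: "'a fock \<Rightarrow> complex" and x :: "'a fock"
  assume 0: "(\<Sum>x\<in>mon ` osc_weight k. f x *\<^sub>C x) = 0" and x: "x \<in> mon ` osc_weight k"
  then obtain M where M: "M \<in> osc_weight k" "x = mon M" by blast
  have inj: "inj_on mon (osc_weight k :: ('a \<times> nat) multiset set)" by (rule inj_on_subset[OF inj_on_mon osc_weight_subset])
  have "(\<Sum>N\<in>osc_weight k. f (mon N) *\<^sub>C (mon N :: 'a fock)) = 0" using 0 by (simp add: sum.reindex[OF inj])
  then have "coef (\<Sum>N\<in>osc_weight k. f (mon N) *\<^sub>C mon N) M = 0" by (simp add: coef_linear)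
  then show "f x = 0" using M by (simp add: coef_sum_mon osc_weight_subset)
qed

lemma span_mon_weight: "complex_vector.span (mon ` osc_weight (int n)) = weight_space n"
proof
  show "complex_vector.span (mon ` osc_weight (int n)) \<subseteq> weight_space n"
  proof
    fix v
    assume "v \<in> complex_vector.span (mon ` osc_weight (int n))"
    then have "homogeneous (int n) v"
    proof (induction rule: complex_vector.span_induct_alt)
      case (step c x y)
      then show ?case
        using homogeneous_mon by (auto simp: osc_weight_def intro!: homogeneous_linear)
    qed (simp add: homogeneous_linear)
    then show "v \<in> weight_space n" by (simp add: weight_space_homogeneous)
  qed
next
  show "weight_space n \<subseteq> complex_vector.span (mon ` osc_weight (int n))"
  proof
    fix v
    assume "v \<in> weight_space n"
    then have "v = (\<Sum>M\<in>osc_weight (int n). coef v M *\<^sub>C mon M)"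
      by (simp only: weight_space_homogeneous) (rule homogeneous_expand)
    also have "\<dots> \<in> complex_vector.span (mon ` osc_weight (int n))"
      by (intro complex_vector.span_sum complex_vector.span_scale complex_vector.span_base) auto
    finally show "v \<in> complex_vector.span (mon ` osc_weight (int n))" .
  qed
qed

lemma representation_mon:
  assumes v: "v \<in> weight_space n" and M: "M \<in> osc_weight (int n)"
  shows "complex_vector.representation (mon ` osc_weight (int n)) v (mon M) = coef v M"
proof -
  let ?C = "mon ` osc_weight (int n)"
  have inj: "inj_on mon (osc_weight (int n))" by (rule inj_on_subset[OF inj_on_mon osc_weight_subset])
  have "(\<Sum>x\<in>?C. complex_vector.representation ?C v x *\<^sub>C x) = v"
    using complex_vector.sum_representation_eq[of ?C v ?C] v
    by (simp add: independent_mon span_mon_weight)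
  then have "(\<Sum>N\<in>osc_weight (int n). complex_vector.representation ?C v (mon N) *\<^sub>C mon N) = v"
    by (simp add: sum.reindex[OF inj])
  then have "coef v M = coef (\<Sum>N\<in>osc_weight (int n). complex_vector.representation ?C v (mon N) *\<^sub>C mon N) M"
    by simp
  then show ?thesis using M by (simp add: coef_sum_mon osc_weight_subset)
qed

lemma subspace_trace_weight_space:
  assumes "lowers 0 X"
  shows "subspace_trace (weight_space n) X = wtrace (int n) X"
proof -
  let ?C = "mon ` osc_weight (int n)"
  have inj: "inj_on mon (osc_weight (int n))" by (rule inj_on_subset[OF inj_on_mon osc_weight_subset])
  have X: "clinear X" "\<And>v. v \<in> weight_space n \<Longrightarrow> X v \<in> weight_space n"
    using assms by (auto simp: lowers_def weight_space_homogeneous)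
  define B where "B = (SOME B. complex_vector.independent B \<and> complex_vector.span B = (weight_space n :: 'a fock set))"
  have B: "complex_vector.independent B" "complex_vector.span B = weight_space n"
    using someI_ex[of "\<lambda>B. complex_vector.independent B \<and> complex_vector.span B = (weight_space n :: 'a fock set)"]
      independent_mon[of "int n"] span_mon_weight unfolding B_def by blast+
  have "B \<subseteq> complex_vector.span ?C" unfolding span_mon_weight B(2)[symmetric] by (rule complex_vector.span_superset)
  then have "finite B" using complex_vector.independent_span_bound[of ?C B] B(1) by simp
  then have "subspace_trace (weight_space n) X = (\<Sum>c\<in>?C. complex_vector.representation ?C (X c) c)"
    unfolding subspace_trace_def Let_def B_def[symmetric]
    by (intro trace_basis_change[where S = "weight_space n"] B X independent_mon span_mon_weight) auto
  also have "\<dots> = (\<Sum>M\<in>osc_weight (int n). complex_vector.representation ?C (X (mon M)) (mon M))"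
    by (simp add: sum.reindex[OF inj])
  also have "\<dots> = wtrace (int n) X"
    unfolding wtrace_def
  proof (intro sum.cong refl representation_mon X)
    fix M :: "('a \<times> nat) multiset"
    assume "M \<in> osc_weight (int n)"
    then show "mon M \<in> weight_space n"
      using homogeneous_mon by (auto simp: weight_space_homogeneous osc_weight_def)
  qed
  finally show ?thesis .
qed

text \<open>Separates a vector from the fields describing its zero mode, so that linear combinations
  of derivative fields are allowed as factors. The threshold may depend on \<open>w\<close>, since
  no truncation works for all vectors at once.\<close>

definition realizes :: "'h::bilinear_form_space fock \<Rightarrow> (int \<Rightarrow> 'h) list \<Rightarrow> bool"
  where "realizes v xs \<longleftrightarrow> (\<forall>w. \<exists>K0. \<forall>K\<ge>K0. zero_mode v w = fld K xs 0 w)"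

lemma realizes_fock_monomial:
  "\<forall>(a, k)\<in>set xs. 1 \<le> k \<Longrightarrow> realizes (fock_monomial xs) (map derivative_field xs)"
  unfolding realizes_def using zero_mode_fock_monomial by blast

lemma realizes_multilinear:
  assumes u: "realizes u (us @ x # vs)" and v: "realizes v (us @ y # vs)"
  shows "realizes (c *\<^sub>C u + v) (us @ (\<lambda>m. c *\<^sub>C x m + y m) # vs)"
  unfolding realizes_def
proof
  fix w
  obtain K1 where K1: "\<And>K. K1 \<le> K \<Longrightarrow> zero_mode u w = fld K (us @ x # vs) 0 w"
    using u unfolding realizes_def by blast
  obtain K2 where K2: "\<And>K. K2 \<le> K \<Longrightarrow> zero_mode v w = fld K (us @ y # vs) 0 w"
    using v unfolding realizes_def by blast
  have "zero_mode (c *\<^sub>C u + v) w = fld K (us @ (\<lambda>m. c *\<^sub>C x m + y m) # vs) 0 w" if "max K1 K2 \<le> K" for K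
    using K1[of K] K2[of K] that by (simp add: clinear_simps[OF clinear_zero_mode] fld_multilinear)
  then show "\<exists>K0. \<forall>K\<ge>K0. zero_mode (c *\<^sub>C u + v) w = fld K (us @ (\<lambda>m. c *\<^sub>C x m + y m) # vs) 0 w"
    by blast
qed

text \<open>The description of \<open>zero_mode\<close> demands linearity only in \<open>v\<close>.
  Linearity in the other argument follows because finitely many vectors admit a common truncation,
  and truncated products are linear.\<close>

lemma realizes_lowers:
  fixes v :: "'a::bilinear_form_space fock"
  assumes "realizes v xs"
  shows "lowers 0 (zero_mode v)"
  unfolding lowers_def
proof (intro conjI allI impI)
  show "clinear (zero_mode v)"
  proof (rule clinearI)
    fix u w :: "'a fock" and c
    obtain K1 where K1: "\<And>K. K1 \<le> K \<Longrightarrow> zero_mode v u = fld K xs 0 u"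
      using assms unfolding realizes_def by blast
    obtain K2 where K2: "\<And>K. K2 \<le> K \<Longrightarrow> zero_mode v w = fld K xs 0 w"
      using assms unfolding realizes_def by blast
    obtain K3 where K3: "\<And>K. K3 \<le> K \<Longrightarrow> zero_mode v (u + w) = fld K xs 0 (u + w)"
      using assms unfolding realizes_def by blast
    obtain K4 where K4: "\<And>K. K4 \<le> K \<Longrightarrow> zero_mode v (c *\<^sub>C u) = fld K xs 0 (c *\<^sub>C u)"
      using assms unfolding realizes_def by blast
    define K where "K = max (max K1 K2) (max K3 K4)"
    show "zero_mode v (u + w) = zero_mode v u + zero_mode v w"
      using K1[of K] K2[of K] K3[of K] by (simp add: K_def fld_linear)
    show "zero_mode v (c *\<^sub>C u) = c *\<^sub>C zero_mode v u"
      using K1[of K] K4[of K] by (simp add: K_def fld_linear)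
  qed
  fix k and w :: "'a fock"
  assume w: "homogeneous k w"
  obtain K1 where K1: "\<And>K. K1 \<le> K \<Longrightarrow> zero_mode v w = fld K xs 0 w"
    using assms unfolding realizes_def by blast
  show "homogeneous (k - 0) (zero_mode v w)"
    using K1[of K1] lowers_fld[of 0 K1 xs] w unfolding lowers_def by simp
qed

lemma lowers_zero_mode:
  fixes v :: "'a::bilinear_form_space fock"
  shows "lowers 0 (zero_mode v)"
proof (induction v rule: fock_mon_induct)
  case zero
  have "zero_mode (0 :: 'a fock) = (\<lambda>w. 0)" by (rule ext) (rule clinear_0[OF clinear_zero_mode])
  then show ?case by (simp add: lowers_def clinear_zero homogeneous_linear)
next
  case (step c N v)
  obtain xs where xs: "mset xs = N" "set xs \<subseteq> onb \<times> {1..}" "mon N = fock_monomial xs"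
    using osc_basis_list[OF step(1)] by blast
  then have "realizes (mon N) (map derivative_field xs)"
    using realizes_fock_monomial[of xs] by fastforce
  then have N: "lowers 0 (zero_mode (mon N))" by (rule realizes_lowers)
  have "zero_mode (c *\<^sub>C mon N + v) = (\<lambda>w. c *\<^sub>C zero_mode (mon N) w + zero_mode v w)"
    by (rule ext) (simp add: clinear_simps[OF clinear_zero_mode])
  then show ?case
    using N step(2)
    by (simp add: lowers_def homogeneous_linear clinear_plus clinear_scaleC)
qed

definition char_fps :: "'h::bilinear_form_space itself \<Rightarrow> complex fps"
  where "char_fps t = Abs_fps (\<lambda>n. of_nat (card (osc_weight (int n) :: ('h \<times> nat) multiset set)))"

lemma trace_fps_fld_Nil: "trace_fps (fld K ([] :: (int \<Rightarrow> 'h::bilinear_form_space) list) 0) = char_fps TYPE('h)"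
proof (rule fps_ext)
  fix n
  have "(\<Sum>M\<in>(osc_weight (int n) :: ('h \<times> nat) multiset set). coef (mon M) M) = (\<Sum>M\<in>(osc_weight (int n) :: ('h \<times> nat) multiset set). 1)"
    by (rule sum.cong) (auto simp: coef_mon osc_weight_def)
  then show "trace_fps (fld K ([] :: (int \<Rightarrow> 'h) list) 0) $ n = char_fps TYPE('h) $ n"
    by (simp add: trace_fps_def wtrace_def char_fps_def)
qed

text \<open>Congruence modulo \<open>X^(n+1)\<close>. Truncation at \<open>K\<close> affects the
  pairings only in degrees above \<open>K\<close>, so identities are proved in this form for every
  degree.\<close>

definition fps_agree :: "nat \<Rightarrow> complex fps \<Rightarrow> complex fps \<Rightarrow> bool"
  where "fps_agree n f g \<longleftrightarrow> (\<forall>i\<le>n. f $ i = g $ i)"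

lemma fps_agree_add: "fps_agree n f g \<Longrightarrow> fps_agree n f' g' \<Longrightarrow> fps_agree n (f + f') (g + g')"
  by (simp add: fps_agree_def)

lemma fps_agree_mult: "fps_agree n f g \<Longrightarrow> fps_agree n f' g' \<Longrightarrow> fps_agree n (f * f') (g * g')"
  by (auto simp: fps_agree_def fps_mult_nth intro!: sum.cong)

lemma fps_agree_refl: "fps_agree n f f"
  by (simp add: fps_agree_def)

lemma fps_agree_power: "fps_agree n f g \<Longrightarrow> fps_agree n (f ^ k) (g ^ k)"
  by (induction k) (simp_all add: fps_agree_refl fps_agree_mult)

lemma fps_agree_sum: "(\<And>i. i \<in> A \<Longrightarrow> fps_agree n (f i) (g i)) \<Longrightarrow> fps_agree n (\<Sum>i\<in>A. f i) (\<Sum>i\<in>A. g i)"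
  by (induction A rule: infinite_finite_induct) (simp_all add: fps_agree_refl fps_agree_add)

text \<open>Weight \<open>n\<close> has finitely many basis monomials, so a single \<open>K\<close>
  beyond their thresholds and beyond \<open>n\<close> computes the coefficient of degree
  \<open>n\<close>.\<close>

lemma realizes_trace:
  fixes v :: "'h::bilinear_form_space fock"
  assumes v: "realizes v xs" and f: "\<And>K. fps_agree K (trace_fps (fld (int K) xs 0)) f"
  shows "trace_fps (zero_mode v) = f"
proof (rule fps_ext)
  fix n
  have "\<forall>w. \<exists>K0. \<forall>K\<ge>K0. zero_mode v w = fld K xs 0 w" using v by (simp add: realizes_def)
  then obtain K0 where K0: "\<And>w K. K0 w \<le> K \<Longrightarrow> zero_mode v w = fld K xs 0 w" by metis
  define L where "L = (insert 0 ((\<lambda>M. K0 (mon M)) ` osc_weight (int n)))"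
  define K where "K = max n (nat (Max L))"
  have "finite L" by (simp add: L_def)
  have "K0 (mon M) \<le> int K" if "M \<in> osc_weight (int n)" for M
  proof -
    have "K0 (mon M) \<le> Max L" using that \<open>finite L\<close> by (intro Max_ge) (auto simp: L_def)
    then show ?thesis by (simp add: K_def)
  qed
  then have "wtrace (int n) (zero_mode v) = wtrace (int n) (fld (int K) xs 0)"
    unfolding wtrace_def by (intro sum.cong refl) (subst K0[of _ "int K"], auto)
  then have "trace_fps (zero_mode v) $ n = trace_fps (fld (int K) xs 0) $ n"
    by (simp add: trace_fps_def)
  also have "\<dots> = f $ n" using f[of K] by (simp add: fps_agree_def K_def)
  finally show "trace_fps (zero_mode v) $ n = f $ n" .
qed

section \<open>Pairings of derivative fields as Lambert series\<close>

lemma geom_fps_nth_0: "i < m \<Longrightarrow> geom_fps m $ i = 0"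
  by (simp add: geom_fps_def fps_X_power_mult_nth)

definition lambert_upto :: "nat \<Rightarrow> nat \<Rightarrow> complex fps"
  where "lambert_upto n k = (\<Sum>m=1..n. fps_const (of_nat m ^ k) * geom_fps m)"

text \<open>Coefficient \<open>n\<close> may be read off after \<open>n\<close> terms because
  \<open>geom_fps m\<close> starts in degree \<open>m\<close>.\<close>

definition lambert_fps :: "nat \<Rightarrow> complex fps"
  where "lambert_fps k = Abs_fps (\<lambda>n. lambert_upto n k $ n)"

lemma lambert_upto_agree: "fps_agree n (lambert_upto n k) (lambert_fps k)"
  unfolding fps_agree_def
proof (intro allI impI)
  fix i
  assume i: "i \<le> n"
  have "lambert_upto n k $ i = (\<Sum>m=1..n. of_nat m ^ k * geom_fps m $ i)"
    by (simp add: lambert_upto_def fps_sum_nth)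
  also have "\<dots> = (\<Sum>m=1..i. of_nat m ^ k * geom_fps m $ i)"
    using i by (intro sum.mono_neutral_right) (auto simp: geom_fps_nth_0)
  also have "\<dots> = lambert_fps k $ i"
    by (simp add: lambert_fps_def lambert_upto_def fps_sum_nth)
  finally show "lambert_upto n k $ i = lambert_fps k $ i" .
qed

lemma poly_even_odd:
  fixes p :: "complex poly"
  shows "\<exists>E D. \<forall>z. poly p z = poly E (z\<^sup>2) + z * poly D (z\<^sup>2)"
proof (induction p)
  case 0
  show ?case by (intro exI[of _ 0]) simp
next
  case (pCons a p)
  then obtain E D where "\<forall>z. poly p z = poly E (z\<^sup>2) + z * poly D (z\<^sup>2)" by blast
  then show ?case
    by (intro exI[of _ "pCons a D"] exI[of _ E]) (simp add: algebra_simps power2_eq_square)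
qed

lemma poly_gchoose: "\<exists>p. \<forall>z :: complex. (- z - 1) gchoose k = poly p z"
proof -
  define p where "p = smult (1 / fact k) (\<Prod>i = 0..<k. [:- 1 - of_nat i, - 1:] :: complex poly)"
  have "(- z - 1) gchoose k = poly p z" for z
  proof -
    have *: "(\<Prod>i = 0..<k. - z - 1 - of_nat i) = (\<Prod>i = 0..<k. poly [:- 1 - of_nat i, - 1:] z)"
      by (rule prod.cong) (auto simp: algebra_simps)
    show ?thesis unfolding p_def poly_smult poly_prod gbinomial_prod_rev * by simp
  qed
  then show ?thesis by blast
qed

lemma fps_const_sum: "fps_const (\<Sum>i\<in>A. f i) = (\<Sum>i\<in>A. fps_const (f i))"
  by (induction A rule: infinite_finite_induct) (simp_all flip: fps_const_add)

lemma sum_poly_lambert_upto: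
  "(\<Sum>m=1..n. fps_const (of_nat m * poly R ((of_nat m)\<^sup>2)) * geom_fps m) =
    (\<Sum>i\<le>degree R. fps_const (coeff R i) * lambert_upto n (2 * i + 1))"
proof -
  have "(\<Sum>m=1..n. fps_const (of_nat m * poly R ((of_nat m)\<^sup>2)) * geom_fps m) =
      (\<Sum>m=1..n. \<Sum>i\<le>degree R. fps_const (coeff R i) * (fps_const (of_nat m ^ (2 * i + 1)) * geom_fps m))"
  proof (rule sum.cong[OF refl])
    fix m
    have pw: "of_nat m ^ (2 * i + 1) = of_nat m * ((of_nat m)\<^sup>2 :: complex) ^ i" for i
      by (simp add: power_mult)
    have "of_nat m * poly R ((of_nat m)\<^sup>2) = (\<Sum>i\<le>degree R. of_nat m * (coeff R i * ((of_nat m)\<^sup>2) ^ i))"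
      by (simp add: poly_altdef sum_distrib_left)
    also have "\<dots> = (\<Sum>i\<le>degree R. coeff R i * of_nat m ^ (2 * i + 1))"
      by (intro sum.cong refl) (subst pw, simp only: mult_ac)
    finally have "of_nat m * poly R ((of_nat m)\<^sup>2) = (\<Sum>i\<le>degree R. coeff R i * of_nat m ^ (2 * i + 1))" .
    then have "fps_const (of_nat m * poly R ((of_nat m)\<^sup>2)) =
        (\<Sum>i\<le>degree R. fps_const (coeff R i * of_nat m ^ (2 * i + 1)))"
      by (simp only: fps_const_sum)
    then show "fps_const (of_nat m * poly R ((of_nat m)\<^sup>2)) * geom_fps m =
        (\<Sum>i\<le>degree R. fps_const (coeff R i) * (fps_const (of_nat m ^ (2 * i + 1)) * geom_fps m))"
      by (simp add: sum_distrib_right mult.assoc del: fps_const_mult flip: fps_const_mult)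
  qed
  also have "\<dots> = (\<Sum>i\<le>degree R. fps_const (coeff R i) * lambert_upto n (2 * i + 1))"
    by (subst sum.swap) (simp add: lambert_upto_def sum_distrib_left)
  finally show ?thesis .
qed

text \<open>Mode coefficients of derivative fields are polynomials in the mode number. The
  symmetrised product over \<open>m\<close> and \<open>- m\<close> is even in \<open>m\<close>, and
  the factor \<open>m\<close> from the commutator makes it odd, so only Lambert series of odd index
  occur.\<close>

lemma pairing_derivative_fields:
  "\<exists>R. \<forall>n. pairing_upto n (derivative_field x) (derivative_field y) =
    (\<Sum>i\<le>degree R. fps_const (coeff R i) * lambert_upto n (2 * i + 1))"
proof -
  obtain a k b l where xy: "x = (a, k)" "y = (b, l)" by fastforce
  obtain p where p: "\<And>z :: complex. (- z - 1) gchoose (k - 1) = poly p z" using poly_gchoose by metis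
  obtain q where q: "\<And>z :: complex. (- z - 1) gchoose (l - 1) = poly q z" using poly_gchoose by metis
  obtain E D where ED: "\<And>z. poly p z = poly E (z\<^sup>2) + z * poly D (z\<^sup>2)" using poly_even_odd by metis
  obtain E' D' where ED': "\<And>z. poly q z = poly E' (z\<^sup>2) + z * poly D' (z\<^sup>2)" using poly_even_odd by metis
  \<comment> \<open>With \<open>p(m) = E(m^2) + m D(m^2)\<close> and likewise for \<open>q\<close>,
    the sum \<open>p(m) q(-m) + p(-m) q(m)\<close> is \<open>2 (E E' - m^2 D D')\<close> evaluated
    at \<open>m^2\<close>; \<open>[:0, 1:]\<close> stands for \<open>m^2\<close>.\<close>
  define R where "R = smult (2 * bform a b) (E * E' - [:0, 1:] * D * D')"
  have x: "derivative_field x m = poly p (of_int m) *\<^sub>C a" for m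
    using p[of "of_int m"] by (simp add: xy derivative_field_def)
  have y: "derivative_field y m = poly q (of_int m) *\<^sub>C b" for m
    using q[of "of_int m"] by (simp add: xy derivative_field_def)
  have "of_nat m * (bform (derivative_field x (int m)) (derivative_field y (- int m)) +
      bform (derivative_field x (- int m)) (derivative_field y (int m))) = of_nat m * poly R ((of_nat m)\<^sup>2)" for m
  proof -
    have b: "bform (derivative_field x k) (derivative_field y l) = poly p (of_int k) * poly q (of_int l) * bform a b" for k l
      by (simp add: x y bform_scale bform_scale_right)
    show ?thesis
      unfolding b by (simp add: ED ED' R_def algebra_simps power2_eq_square)
  qed
  then show ?thesis
    unfolding pairing_upto_def by (simp only: sum_poly_lambert_upto) blast
qed

section \<open>The ring of Lambert series\<close>

lemma fps_agree_trans [trans]: "fps_agree n f g \<Longrightarrow> fps_agree n g h \<Longrightarrow> fps_agree n f h"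
  by (simp add: fps_agree_def)

lemma fps_agree_eq_trans [trans]:
  "fps_agree n f g \<Longrightarrow> g = h \<Longrightarrow> fps_agree n f h"
  "f = g \<Longrightarrow> fps_agree n g h \<Longrightarrow> fps_agree n f h"
  by simp_all

lemma fps_agree_diff: "fps_agree n f g \<Longrightarrow> fps_agree n f' g' \<Longrightarrow> fps_agree n (f - f') (g - g')"
  by (simp add: fps_agree_def)

lemma fps_agree_sym: "fps_agree n f g \<Longrightarrow> fps_agree n g f"
  by (simp add: fps_agree_def)

lemma fps_eq_agreeI: "(\<And>n. fps_agree n f g) \<Longrightarrow> f = g"
  by (metis fps_agree_def fps_ext order_refl)

text \<open>With \<open>A = X^a\<close> and \<open>B = X^b\<close>, the last factor equals
  \<open>(1 - A B) / ((1 - A) (1 - B))\<close>. This linearises products once \<open>a + b\<close>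
  or, after rearranging, \<open>a - b\<close> is held fixed.\<close>

lemma geom_fps_mult_geom_fps:
  assumes "1 \<le> a" "1 \<le> b"
  shows "geom_fps a * geom_fps b = geom_fps (a + b) * (geom_fps a + geom_fps b + 1)"
proof -
  define A B :: "complex fps" where "A = fps_X ^ a" and "B = fps_X ^ b"
  define u v w where "u = geom_fps a" and "v = geom_fps b" and "w = geom_fps (a + b)"
  have u: "u * (1 - A) = A" and v: "v * (1 - B) = B" and w: "w * (1 - A * B) = A * B"
    using geom_fps_mult[of a] geom_fps_mult[of b] geom_fps_mult[of "a + b"] assms
    by (simp_all add: A_def B_def u_def v_def w_def power_add)
  have nz': "(1 - A) * (1 - B) * (1 - A * B) \<noteq> 0"
    using one_minus_X_power_nonzero[of a] one_minus_X_power_nonzero[of b]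
      one_minus_X_power_nonzero[of "a + b"] assms by (simp add: A_def B_def power_add)
  have "(u * v) * ((1 - A) * (1 - B) * (1 - A * B)) = (u * (1 - A)) * (v * (1 - B)) * (1 - A * B)"
    by (simp only: mult_ac)
  also have "\<dots> = A * B * (A * (1 - B) + B * (1 - A) + (1 - A) * (1 - B))"
    unfolding u v by (simp add: algebra_simps)
  also have "\<dots> = (w * (1 - A * B)) * (u * (1 - A) * (1 - B) + v * (1 - B) * (1 - A) + (1 - A) * (1 - B))"
    unfolding u v w ..
  also have "\<dots> = (w * (u + v + 1)) * ((1 - A) * (1 - B) * (1 - A * B))"
    by (simp add: algebra_simps)
  finally have "u * v = w * (u + v + 1)" using nz' by (metis mult_right_cancel)
  then show ?thesis by (simp add: u_def v_def w_def)
qed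

lemma geom_fps_mult_vanish:
  assumes "1 \<le> a" "1 \<le> b" "n < a + b"
  shows "fps_agree n (geom_fps a * geom_fps b) 0"
proof -
  have "fps_agree n (geom_fps (a + b)) 0"
    using assms by (simp add: fps_agree_def geom_fps_nth_0)
  from fps_agree_mult[OF this fps_agree_refl, of "geom_fps a + geom_fps b + 1"]
  show ?thesis using geom_fps_mult_geom_fps[OF assms(1,2)] by simp
qed

lemma lambert_upto_altdef: "lambert_upto n k = (\<Sum>a=1..n. of_nat a ^ k * geom_fps a)"
  unfolding lambert_upto_def
  by (intro sum.cong refl) (simp flip: fps_of_nat)

text \<open>The part linear in \<open>geom_fps\<close> that remains when products are grouped by the
  difference \<open>N\<close> of their indices. The inner sum is a polynomial in \<open>a\<close>,
  so this is a combination of Lambert series; \<open>conv_upto_recurrence\<close> says so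
  implicitly.\<close>

definition conv_upto :: "nat \<Rightarrow> nat \<Rightarrow> complex fps"
  where "conv_upto n i = (\<Sum>a=1..n. of_nat a * geom_fps a * (\<Sum>N=1..<a. of_nat N ^ (2 * i) * of_nat (a - N)))"

definition conv_fps :: "nat \<Rightarrow> complex fps"
  where "conv_fps i = Abs_fps (\<lambda>n. conv_upto n i $ n)"

lemma conv_upto_agree: "fps_agree n (conv_upto n k) (conv_fps k)"
  unfolding fps_agree_def
proof (intro allI impI)
  fix i
  assume i: "i \<le> n"
  let ?c = "\<lambda>a. of_nat a * (\<Sum>N=1..<a. of_nat N ^ (2 * k) * of_nat (a - N)) :: complex"
  have c: "of_nat a * geom_fps a * (\<Sum>N=1..<a. of_nat N ^ (2 * k) * of_nat (a - N)) = fps_const (?c a) * geom_fps a" for a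
    by (simp add: fps_const_sum fps_of_nat[symmetric] mult_ac flip: fps_const_mult fps_const_power)
  have "conv_upto n k $ i = (\<Sum>a=1..n. ?c a * geom_fps a $ i)"
    unfolding conv_upto_def c by (simp add: fps_sum_nth)
  also have "\<dots> = (\<Sum>a=1..i. ?c a * geom_fps a $ i)"
    using i by (intro sum.mono_neutral_right) (auto simp: geom_fps_nth_0)
  also have "\<dots> = conv_fps k $ i"
    unfolding conv_fps_def conv_upto_def c by (simp add: fps_sum_nth)
  finally show "conv_upto n k $ i = conv_fps k $ i" .
qed

section \<open>The recurrence for the remainder series\<close>

lemma sum_even_atMost:
  "(\<Sum>i\<le>2 * k. if even i then f i else 0) = (\<Sum>j\<le>k. f (2 * j))" for f :: "nat \<Rightarrow> 'a::comm_monoid_add"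
  by (induction k) simp_all

lemma even_power_diff_commute: "(x - y) ^ (2 * k) = (y - x) ^ (2 * k)"
  for x y :: "'a::comm_ring_1"
  by (simp only: power_mult power2_commute[of x y])

lemma even_binomial:
  fixes x y :: "'a::comm_ring_1"
  shows "(x + y) ^ (2 * k) + (x - y) ^ (2 * k) =
    2 * (\<Sum>j\<le>k. of_nat (2 * k choose (2 * j)) * x ^ (2 * j) * y ^ (2 * (k - j)))"
proof -
  have "(x + y) ^ (2 * k) + (- x + y) ^ (2 * k) =
      (\<Sum>i\<le>2 * k. if even i then 2 * (of_nat (2 * k choose i) * x ^ i * y ^ (2 * k - i)) else 0)"
    unfolding binomial_ring sum.distrib[symmetric]
    by (intro sum.cong refl) (auto simp: power_minus_odd)
  moreover have "(- x + y) ^ (2 * k) = (x - y) ^ (2 * k)"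
    using even_power_diff_commute[of y x k] by simp
  ultimately show ?thesis unfolding sum_even_atMost by (simp add: sum_distrib_left diff_mult_distrib2)
qed

text \<open>A discrete Taylor formula: the weight \<open>Suc m - N\<close> is the kernel of double
  summation, so summing twice undoes the second difference up to boundary terms.\<close>

lemma sum_second_difference:
  fixes g :: "nat \<Rightarrow> 'a::comm_ring_1"
  shows "(\<Sum>N=1..m. of_nat (Suc m - N) * (g (Suc N) - 2 * g N + g (N - 1)))
    = g (Suc m) - of_nat (Suc m) * g 1 + of_nat m * g 0"
proof -
  define h where "h N = g (Suc N) - 2 * g N + g (N - 1)" for N
  have tel: "(\<Sum>N=1..n. h N) = g (Suc n) - g n - g 1 + g 0" for n
    by (induction n) (simp_all add: h_def algebra_simps)
  have "(\<Sum>N=1..m. of_nat (Suc m - N) * h N) = g (Suc m) - of_nat (Suc m) * g 1 + of_nat m * g 0"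
  proof (induction m)
    case 0
    show ?case by simp
  next
    case (Suc m)
    have "(\<Sum>N=1..Suc m. of_nat (Suc (Suc m) - N) * h N) = (\<Sum>N=1..Suc m. of_nat (Suc m - N) * h N + h N)"
      by (rule sum.cong) (auto simp: Suc_diff_le algebra_simps)
    also have "\<dots> = (\<Sum>N=1..m. of_nat (Suc m - N) * h N) + (\<Sum>N=1..Suc m. h N)"
      unfolding sum.distrib by simp
    also have "\<dots> = g (Suc (Suc m)) - of_nat (Suc (Suc m)) * g 1 + of_nat (Suc m) * g 0"
      unfolding Suc tel by (simp add: algebra_simps)
    finally show ?case .
  qed
  then show ?thesis by (simp only: h_def)
qed

text \<open>The second difference of \<open>N^(2k+2)\<close> contains only even powers
  \<open>N^(2i)\<close> with \<open>i\<close> at most \<open>k\<close>. The weight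
  \<open>a - N\<close> in the inner sums of \<open>conv_upto\<close> is the kernel that sums it
  twice, leaving \<open>a^(2k+2) - a\<close>.\<close>

lemma conv_upto_recurrence:
  "2 * (\<Sum>i\<le>k. of_nat (2 * k + 2 choose (2 * i)) * conv_upto n i) = lambert_upto n (2 * k + 3) - lambert_upto n 2"
proof -
  let ?c = "\<lambda>i. of_nat (2 * k + 2 choose (2 * i)) :: complex fps"
  have inner: "2 * (\<Sum>i\<le>k. ?c i * (\<Sum>N=1..<a. of_nat N ^ (2 * i) * of_nat (a - N)))
      = of_nat a ^ (2 * k + 2) - of_nat a" if a: "1 \<le> a" for a
  proof -
    obtain m where m: "a = Suc m" using a by (cases a) auto
    define g :: "nat \<Rightarrow> complex fps" where "g N = of_nat N ^ (2 * k + 2)" for N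
    have d: "g (Suc N) - 2 * g N + g (N - 1) = 2 * (\<Sum>i\<le>k. ?c i * of_nat N ^ (2 * i))" if "1 \<le> N" for N
    proof -
      have "g (Suc N) + g (N - 1) = (of_nat N + 1) ^ (2 * Suc k) + (of_nat N - 1) ^ (2 * Suc k)"
        using that by (simp add: g_def of_nat_diff add.commute)
      \<comment> \<open>The summand \<open>2 * g N\<close> is the top term \<open>j = Suc k\<close>
        of the even binomial expansion.\<close>
      also have "\<dots> = 2 * (\<Sum>i\<le>k. ?c i * of_nat N ^ (2 * i)) + 2 * g N"
        unfolding even_binomial by (simp add: g_def algebra_simps)
      finally show ?thesis by (simp add: algebra_simps)
    qed
    have "2 * (\<Sum>i\<le>k. ?c i * (\<Sum>N=1..<a. of_nat N ^ (2 * i) * of_nat (a - N)))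
        = (\<Sum>N=1..<a. \<Sum>i\<le>k. of_nat (a - N) * (2 * (?c i * of_nat N ^ (2 * i))))"
      by (subst sum.swap) (simp add: sum_distrib_left mult_ac)
    also have "\<dots> = (\<Sum>N=1..<a. of_nat (a - N) * (g (Suc N) - 2 * g N + g (N - 1)))"
      by (rule sum.cong[OF refl], subst d) (simp_all only: sum_distrib_left atLeastLessThan_iff)
    also have "\<dots> = g a - of_nat a"
      unfolding m atLeastLessThanSuc_atLeastAtMost sum_second_difference by (simp add: g_def)
    finally show ?thesis by (simp add: g_def)
  qed
  have "2 * (\<Sum>i\<le>k. ?c i * conv_upto n i) = (\<Sum>a=1..n. of_nat a * geom_fps a *
      (2 * (\<Sum>i\<le>k. ?c i * (\<Sum>N=1..<a. of_nat N ^ (2 * i) * of_nat (a - N)))))"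
    unfolding conv_upto_def sum_distrib_left by (subst sum.swap) (simp only: mult_ac)
  also have "\<dots> = (\<Sum>a=1..n. of_nat a * geom_fps a * (of_nat a ^ (2 * k + 2) - of_nat a))"
    by (intro sum.cong refl) (simp only: inner atLeastAtMost_iff)
  also have "\<dots> = lambert_upto n (2 * k + 3) - lambert_upto n 2"
    unfolding lambert_upto_altdef sum_subtractf[symmetric]
    by (intro sum.cong refl) (simp add: algebra_simps power2_eq_square numeral_3_eq_3)
  finally show ?thesis .
qed

text \<open>The factor 6 clears the denominator of this power sum; it is the origin of the constants
  12 and 24 in \<open>lambert_convolution\<close>.\<close>

lemma six_sum_products:
  "6 * (\<Sum>a=1..<N. of_nat a * of_nat (N - a)) = (of_nat N ^ 3 - of_nat N :: 'a::comm_ring_1)"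
proof -
  have *: "6 * (\<Sum>a=1..M. of_nat a * (x - of_nat a)) =
      3 * x * of_nat M * (of_nat M + 1) - of_nat M * (of_nat M + 1) * (2 * of_nat M + 1)" for M :: nat and x :: 'a
    by (induction M) (simp_all add: algebra_simps)
  show ?thesis
  proof (cases N)
    case (Suc M)
    have "(\<Sum>a=1..<N. of_nat a * of_nat (N - a)) = (\<Sum>a=1..M. of_nat a * (of_nat N - of_nat a :: 'a))"
      unfolding Suc by (rule sum.cong) (auto simp: of_nat_diff algebra_simps)
    then show ?thesis using *[of "of_nat N" M] by (simp add: Suc algebra_simps power3_eq_cube)
  qed simp
qed

text \<open>An incomplete sum that neither grouping evaluates. It enters the sums over
  \<open>a + b\<close> and over \<open>a - b\<close> with coefficients that cancel in
  \<open>lambert_convolution\<close>.\<close>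

definition conv_geom :: "nat \<Rightarrow> complex fps"
  where "conv_geom N = (\<Sum>a=1..<N. of_nat a * of_nat (N - a) * geom_fps a)"

text \<open>The terms with \<open>a + b > L\<close> do not contribute below degree \<open>L\<close>, and the others are grouped by \<open>N = a + b\<close>.\<close>

lemma lambert_product_plus:
  "fps_agree L (6 * (\<Sum>a=1..L. \<Sum>b=1..L. (of_nat a + of_nat b) ^ (2 * k) * (of_nat a * of_nat b * (geom_fps a * geom_fps b))))
    (12 * (\<Sum>N=1..L. of_nat N ^ (2 * k) * geom_fps N * conv_geom N) + (lambert_upto L (2 * k + 3) - lambert_upto L (2 * k + 1)))"
proof -
  define R :: "nat \<Rightarrow> complex fps" where "R N = (\<Sum>a=1..<N. of_nat a * of_nat (N - a))" for N
  have R6: "6 * R N = of_nat N ^ 3 - of_nat N" for N unfolding R_def by (rule six_sum_products)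
  define f where "f a b = (of_nat a + of_nat b) ^ (2 * k) * (of_nat a * of_nat b * (geom_fps a * geom_fps b))" for a b
  have "fps_agree L (\<Sum>(a, b)\<in>{1..L} \<times> {1..L}. f a b) (\<Sum>(a, b)\<in>{1..L} \<times> {1..L}. if a + b \<le> L then f a b else 0)"
  proof (rule fps_agree_sum, clarify)
    fix a b
    assume ab: "a \<in> {1..L}" "b \<in> {1..L}"
    show "fps_agree L (f a b) (if a + b \<le> L then f a b else 0)"
    proof (cases "a + b \<le> L")
      case False
      have "fps_agree L (geom_fps a * geom_fps b) 0" using ab False by (intro geom_fps_mult_vanish) auto
      from fps_agree_mult[OF fps_agree_refl this, of "(of_nat a + of_nat b) ^ (2 * k) * (of_nat a * of_nat b)"]
      show ?thesis using False by (simp add: f_def mult.assoc)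
    qed (simp add: fps_agree_refl)
  qed
  also have "(\<Sum>(a, b)\<in>{1..L} \<times> {1..L}. if a + b \<le> L then f a b else 0) =
      (\<Sum>(a, b)\<in>{(a, b). 1 \<le> a \<and> 1 \<le> b \<and> a + b \<le> L}. f a b)"
    by (rule sum.mono_neutral_cong_right) (auto split: if_splits)
  also have "\<dots> = (\<Sum>(N, a)\<in>(SIGMA N:{1..L}. {1..<N}). f a (N - a))"
    by (rule sum.reindex_bij_witness[of _ "\<lambda>(N, a). (a, N - a)" "\<lambda>(a, b). (a + b, a)"]) auto
  also have "\<dots> = (\<Sum>N=1..L. \<Sum>a=1..<N. f a (N - a))" by (simp add: sum.Sigma)
  also have "\<dots> = (\<Sum>N=1..L. of_nat N ^ (2 * k) * geom_fps N * (2 * conv_geom N + R N))"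
  proof (rule sum.cong[OF refl])
    fix N
    have "(\<Sum>a=1..<N. f a (N - a)) = (\<Sum>a=1..<N. of_nat N ^ (2 * k) * geom_fps N *
        (of_nat a * of_nat (N - a) * geom_fps a + of_nat a * of_nat (N - a) * geom_fps (N - a) + of_nat a * of_nat (N - a)))"
    proof (rule sum.cong[OF refl])
      fix a
      assume a: "a \<in> {1..<N}"
      then have "1 \<le> a" "1 \<le> N - a" "a + (N - a) = N" by auto
      then have "geom_fps a * geom_fps (N - a) = geom_fps N * (geom_fps a + geom_fps (N - a) + 1)"
        using geom_fps_mult_geom_fps[of a "N - a"] by metis
      moreover have "of_nat a + of_nat (N - a) = (of_nat N :: complex fps)"
        using a by (simp flip: of_nat_add)
      ultimately show "f a (N - a) = of_nat N ^ (2 * k) * geom_fps N *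
        (of_nat a * of_nat (N - a) * geom_fps a + of_nat a * of_nat (N - a) * geom_fps (N - a) + of_nat a * of_nat (N - a))"
        by (simp add: f_def algebra_simps)
    qed
    also have "\<dots> = of_nat N ^ (2 * k) * geom_fps N * (conv_geom N
        + (\<Sum>a=1..<N. of_nat a * of_nat (N - a) * geom_fps (N - a)) + (\<Sum>a=1..<N. of_nat a * of_nat (N - a)))"
      by (simp only: sum_distrib_left[symmetric] sum.distrib conv_geom_def)
    also have "(\<Sum>a=1..<N. of_nat a * of_nat (N - a) * geom_fps (N - a)) = conv_geom N"
      unfolding conv_geom_def
      by (rule sum.reindex_bij_witness[of _ "\<lambda>a. N - a" "\<lambda>a. N - a"]) auto
    finally show "(\<Sum>a=1..<N. f a (N - a)) = of_nat N ^ (2 * k) * geom_fps N *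
        (2 * conv_geom N + R N)" by (simp add: R_def)
  qed
  finally have "fps_agree L (6 * (\<Sum>(a, b)\<in>{1..L} \<times> {1..L}. f a b)) (6 * \<dots>)"
    by (rule fps_agree_mult[OF fps_agree_refl])
  also have "6 * (\<Sum>N=1..L. of_nat N ^ (2 * k) * geom_fps N * (2 * conv_geom N + R N))
      = (\<Sum>N=1..L. 12 * (of_nat N ^ (2 * k) * geom_fps N * conv_geom N)
        + of_nat N ^ (2 * k) * geom_fps N * (6 * R N))"
    unfolding sum_distrib_left by (rule sum.cong) (simp_all add: algebra_simps)
  also have "\<dots> = 12 * (\<Sum>N=1..L. of_nat N ^ (2 * k) * geom_fps N * conv_geom N)
      + (lambert_upto L (2 * k + 3) - lambert_upto L (2 * k + 1))"
    unfolding R6 lambert_upto_altdef sum_distrib_left sum.distrib sum_subtractf[symmetric]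
    by (intro arg_cong2[where f = "(+)"] sum.cong refl) (simp add: algebra_simps power3_eq_cube numeral_3_eq_3)
  finally have "fps_agree L (6 * (\<Sum>(a, b)\<in>{1..L} \<times> {1..L}. f a b))
    (12 * (\<Sum>N=1..L. of_nat N ^ (2 * k) * geom_fps N * conv_geom N) + (lambert_upto L (2 * k + 3) - lambert_upto L (2 * k + 1)))" .
  then show ?thesis unfolding sum.cartesian_product[symmetric] f_def .
qed

text \<open>Here the terms with \<open>a > b\<close> are grouped by \<open>N = a - b\<close>, using
  \<open>u\<^sub>a u\<^sub>b = u\<^sub>N u\<^sub>b - u\<^sub>N u\<^sub>a - u\<^sub>a\<close> for \<open>u\<^sub>a = geom_fps a\<close>.\<close>

lemma lambert_product_minus:
  assumes k: "1 \<le> k"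
  shows "fps_agree L (\<Sum>a=1..L. \<Sum>b=1..L. (of_nat a - of_nat b) ^ (2 * k) * (of_nat a * of_nat b * (geom_fps a * geom_fps b)))
    (4 * lambert_upto L 1 * lambert_upto L (2 * k + 1) - 2 * (\<Sum>N=1..L. of_nat N ^ (2 * k) * geom_fps N * conv_geom N)
      - 2 * conv_upto L k)"
proof -
  define f where "f a b = (of_nat a - of_nat b) ^ (2 * k) * (of_nat a * of_nat b * (geom_fps a * geom_fps b))" for a b
  have f_sym: "f a b = f b a" for a b
    unfolding f_def even_power_diff_commute[of "of_nat a" "of_nat b" k] by (simp only: mult_ac)
  let ?D = "{1..L} \<times> {1..L}" and ?E = "{(a, b). 1 \<le> b \<and> b < a \<and> a \<le> L}"
  have finE: "finite ?E" by (rule finite_subset[of _ ?D]) auto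
  have D: "?D = ?E \<union> ((\<lambda>(a, b). (b, a)) ` ?E \<union> (\<lambda>a. (a, a)) ` {1..L})" by (auto simp: image_iff)
  have "(\<Sum>(a, b)\<in>?D. f a b) = (\<Sum>(a, b)\<in>?E. f a b) + ((\<Sum>(a, b)\<in>(\<lambda>(a, b). (b, a)) ` ?E. f a b)
      + (\<Sum>(a, b)\<in>(\<lambda>a. (a, a)) ` {1..L}. f a b))"
  proof -
    have "(\<Sum>(a, b)\<in>?D. f a b) = (\<Sum>(a, b)\<in>?E. f a b) + (\<Sum>(a, b)\<in>(\<lambda>(a, b). (b, a)) ` ?E \<union> (\<lambda>a. (a, a)) ` {1..L}. f a b)"
      by (subst D, rule sum.union_disjoint) (use finE in auto)
    also have "(\<Sum>(a, b)\<in>(\<lambda>(a, b). (b, a)) ` ?E \<union> (\<lambda>a. (a, a)) ` {1..L}. f a b) =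
        (\<Sum>(a, b)\<in>(\<lambda>(a, b). (b, a)) ` ?E. f a b) + (\<Sum>(a, b)\<in>(\<lambda>a. (a, a)) ` {1..L}. f a b)"
      by (rule sum.union_disjoint) (use finE in auto)
    finally show ?thesis .
  qed
  also have "(\<Sum>(a, b)\<in>(\<lambda>(a, b). (b, a)) ` ?E. f a b) = (\<Sum>(a, b)\<in>?E. f a b)"
    by (subst sum.reindex) (auto simp: inj_on_def case_prod_unfold f_sym)
  \<comment> \<open>Here \<open>1 \<le> k\<close> enters: the diagonal terms carry the factor
    \<open>0 ^ (2 * k)\<close>.\<close>
  also have "(\<Sum>(a, b)\<in>(\<lambda>a. (a, a)) ` {1..L}. f a b) = 0"
    using k by (intro sum.neutral) (auto simp: f_def)
  also have "(\<Sum>(a, b)\<in>?E. f a b) = (\<Sum>(N, b)\<in>(SIGMA N:{1..L}. {1..L - N}). f (b + N) b)"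
    by (rule sum.reindex_bij_witness[of _ "\<lambda>(N, b). (b + N, b)" "\<lambda>(a, b). (a - b, b)"]) auto
  also have "\<dots> = (\<Sum>N=1..L. \<Sum>b=1..L - N. f (b + N) b)" by (simp add: sum.Sigma)
  finally have sum_D: "(\<Sum>(a, b)\<in>?D. f a b) = 2 * (\<Sum>N=1..L. \<Sum>b=1..L - N. f (b + N) b)" by simp
  define P where "P N = of_nat N ^ (2 * k) * geom_fps N" for N
  have f_eq: "f (b + N) b = P N * (of_nat (b * (b + N)) * geom_fps b) - P N * (of_nat (b * (b + N)) * geom_fps (b + N))
      - of_nat N ^ (2 * k) * (of_nat (b * (b + N)) * geom_fps (b + N))" if "1 \<le> b" "1 \<le> N" for b N
  proof -
    have "geom_fps (b + N) * geom_fps b = geom_fps N * geom_fps b - geom_fps N * geom_fps (b + N) - geom_fps (b + N)"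
      using geom_fps_mult_geom_fps[OF that] by (simp add: algebra_simps)
    then have "f (b + N) b = of_nat N ^ (2 * k) * (of_nat (b * (b + N)) *
        (geom_fps N * geom_fps b - geom_fps N * geom_fps (b + N) - geom_fps (b + N)))"
      by (simp add: f_def mult_ac)
    then show ?thesis by (simp only: P_def right_diff_distrib mult_ac)
  qed
  have third: "(\<Sum>N=1..L. \<Sum>b=1..L - N. of_nat N ^ (2 * k) * (of_nat (b * (b + N)) * geom_fps (b + N))) = conv_upto L k"
  proof -
    have "(\<Sum>N=1..L. \<Sum>b=1..L - N. of_nat N ^ (2 * k) * (of_nat (b * (b + N)) * geom_fps (b + N)))
        = (\<Sum>(N, b)\<in>(SIGMA N:{1..L}. {1..L - N}). of_nat N ^ (2 * k) * (of_nat (b * (b + N)) * geom_fps (b + N)))"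
      by (simp add: sum.Sigma)
    also have "\<dots> = (\<Sum>(a, N)\<in>(SIGMA a:{1..L}. {1..<a}). of_nat a * geom_fps a * (of_nat N ^ (2 * k) * of_nat (a - N)))"
      by (rule sum.reindex_bij_witness[of _ "\<lambda>(a, N). (N, a - N)" "\<lambda>(N, b). (b + N, N)"]) (auto simp: mult_ac)
    also have "\<dots> = conv_upto L k"
      unfolding conv_upto_def sum_distrib_left by (rule sum.Sigma[symmetric]) auto
    finally show ?thesis .
  qed
  \<comment> \<open>After the shift \<open>a = b + N\<close> the range is completed to
    \<open>1..L\<close>: the term \<open>a = N\<close> vanishes, and the terms \<open>a < N\<close>
    add up to \<open>- conv_geom N\<close>.\<close>
  have second: "(\<Sum>b=1..L - N. of_nat (b * (b + N)) * geom_fps (b + N)) =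
      (\<Sum>a=1..L. of_nat a * (of_nat a - of_nat N) * geom_fps a) + conv_geom N" if N: "1 \<le> N" "N \<le> L" for N
  proof -
    have A: "(\<Sum>b=1..L - N. of_nat (b * (b + N)) * geom_fps (b + N)) = (\<Sum>a=Suc N..L. of_nat a * (of_nat a - of_nat N) * geom_fps a)"
      by (rule sum.reindex_bij_witness[of _ "\<lambda>a. a - N" "\<lambda>b. b + N"]) (auto simp: of_nat_diff mult_ac)
    have "{1..L} = {1..<N} \<union> ({N} \<union> {Suc N..L})" using N by auto
    then have "(\<Sum>a=1..L. of_nat a * (of_nat a - of_nat N) * geom_fps a) =
        (\<Sum>a\<in>{1..<N} \<union> ({N} \<union> {Suc N..L}). of_nat a * (of_nat a - of_nat N) * geom_fps a)" by simp
    also have "\<dots> = (\<Sum>a=1..<N. of_nat a * (of_nat a - of_nat N) * geom_fps a)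
        + (\<Sum>a=Suc N..L. of_nat a * (of_nat a - of_nat N) * geom_fps a)"
      by (subst sum.union_disjoint) auto
    also have "(\<Sum>a=1..<N. of_nat a * (of_nat a - of_nat N) * geom_fps a) = - conv_geom N"
      unfolding conv_geom_def sum_negf[symmetric]
      by (intro sum.cong refl) (auto simp: of_nat_diff algebra_simps)
    finally show ?thesis unfolding A by simp
  qed
  \<comment> \<open>The range of \<open>b\<close> may be extended to \<open>L\<close>, since for
    \<open>b > L - N\<close> the product \<open>geom_fps N * geom_fps b\<close> has no terms up to
    degree \<open>L\<close>.\<close>
  have first: "fps_agree L (P N * (\<Sum>b=1..L - N. of_nat (b * (b + N)) * geom_fps b))
      (P N * (\<Sum>b=1..L. of_nat (b * (b + N)) * geom_fps b))" if N: "1 \<le> N" for N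
  proof -
    have "fps_agree L (\<Sum>b=1..L. P N * (of_nat (b * (b + N)) * geom_fps b))
        (\<Sum>b=1..L. if b \<le> L - N then P N * (of_nat (b * (b + N)) * geom_fps b) else 0)"
    proof (rule fps_agree_sum)
      fix b
      assume b: "b \<in> {1..L}"
      show "fps_agree L (P N * (of_nat (b * (b + N)) * geom_fps b))
          (if b \<le> L - N then P N * (of_nat (b * (b + N)) * geom_fps b) else 0)"
      proof (cases "b \<le> L - N")
        case False
        have "fps_agree L (geom_fps N * geom_fps b) 0" using b N False by (intro geom_fps_mult_vanish) auto
        from fps_agree_mult[OF fps_agree_refl this, of "of_nat N ^ (2 * k) * of_nat (b * (b + N))"]
        show ?thesis using False by (simp add: P_def mult_ac)
      qed (simp add: fps_agree_refl)
    qed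
    also have "(\<Sum>b=1..L. if b \<le> L - N then P N * (of_nat (b * (b + N)) * geom_fps b) else 0)
        = (\<Sum>b=1..L - N. P N * (of_nat (b * (b + N)) * geom_fps b))"
      by (rule sum.mono_neutral_cong_right) auto
    finally show ?thesis by (simp only: sum_distrib_left fps_agree_sym)
  qed
  have "(\<Sum>N=1..L. \<Sum>b=1..L - N. f (b + N) b) =
      (\<Sum>N=1..L. P N * (\<Sum>b=1..L - N. of_nat (b * (b + N)) * geom_fps b)
        - P N * (\<Sum>b=1..L - N. of_nat (b * (b + N)) * geom_fps (b + N))) - conv_upto L k"
    unfolding third[symmetric] sum_subtractf[symmetric] sum_distrib_left
    by (intro sum.cong refl) (simp only: f_eq atLeastAtMost_iff)
  also have "fps_agree L \<dots> ((\<Sum>N=1..L. P N * (\<Sum>b=1..L. of_nat (b * (b + N)) * geom_fps b)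
        - P N * (\<Sum>b=1..L - N. of_nat (b * (b + N)) * geom_fps (b + N))) - conv_upto L k)"
    by (intro fps_agree_diff fps_agree_sum first fps_agree_refl) auto
  also have "(\<Sum>N=1..L. P N * (\<Sum>b=1..L. of_nat (b * (b + N)) * geom_fps b)
        - P N * (\<Sum>b=1..L - N. of_nat (b * (b + N)) * geom_fps (b + N)))
      = (\<Sum>N=1..L. 2 * lambert_upto L 1 * (of_nat N * P N) - P N * conv_geom N)"
  proof (rule sum.cong[OF refl])
    fix N
    assume "N \<in> {1..L}"
    then have N: "1 \<le> N" "N \<le> L" by auto
    \<comment> \<open>Termwise this is \<open>b (b + N) - b (b - N) = 2 b N\<close>: the quadratic
      parts cancel and a multiple of \<open>lambert_upto L 1\<close> remains.\<close>
    have "(\<Sum>b=1..L. of_nat (b * (b + N)) * geom_fps b) - (\<Sum>a=1..L. of_nat a * (of_nat a - of_nat N) * geom_fps a)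
        = 2 * lambert_upto L 1 * of_nat N"
      unfolding lambert_upto_altdef sum_subtractf[symmetric] sum_distrib_left sum_distrib_right
      by (intro sum.cong refl) (simp add: algebra_simps)
    then have "(\<Sum>b=1..L. of_nat (b * (b + N)) * geom_fps b) = 2 * lambert_upto L 1 * of_nat N
        + (\<Sum>a=1..L. of_nat a * (of_nat a - of_nat N) * geom_fps a)" by (simp add: algebra_simps)
    then show "P N * (\<Sum>b=1..L. of_nat (b * (b + N)) * geom_fps b)
        - P N * (\<Sum>b=1..L - N. of_nat (b * (b + N)) * geom_fps (b + N))
        = 2 * lambert_upto L 1 * (of_nat N * P N) - P N * conv_geom N"
      unfolding second[OF N] by (simp only: ring_distribs) (simp add: mult_ac)
  qed
  also have "\<dots> = 2 * lambert_upto L 1 * lambert_upto L (2 * k + 1) - (\<Sum>N=1..L. P N * conv_geom N)"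
    unfolding sum_subtractf sum_distrib_left[symmetric] lambert_upto_altdef[of L "2 * k + 1"]
    by (simp add: P_def mult_ac)
  finally have "fps_agree L (2 * (\<Sum>N=1..L. \<Sum>b=1..L - N. f (b + N) b))
      (2 * (2 * lambert_upto L 1 * lambert_upto L (2 * k + 1) - (\<Sum>N=1..L. P N * conv_geom N) - conv_upto L k))"
    by (rule fps_agree_mult[OF fps_agree_refl])
  then have "fps_agree L (\<Sum>a=1..L. \<Sum>b=1..L. f a b)
      (2 * (2 * lambert_upto L 1 * lambert_upto L (2 * k + 1) - (\<Sum>N=1..L. P N * conv_geom N) - conv_upto L k))"
    unfolding sum_D[symmetric] sum.cartesian_product[symmetric] .
  then show ?thesis by (simp only: f_def P_def) (simp add: algebra_simps)
qed

text \<open>The even part of the binomial expansion produces exactly the products of odd-index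
  series. The sums \<open>Q\<close> of \<open>conv_geom\<close> cancel as
  \<open>12 * Q - 6 * (2 * Q)\<close>.\<close>

lemma lambert_convolution:
  assumes k: "1 \<le> k"
  shows "12 * (\<Sum>j\<le>k. of_nat (2 * k choose (2 * j)) * lambert_fps (2 * j + 1) * lambert_fps (2 * (k - j) + 1)) =
    24 * lambert_fps 1 * lambert_fps (2 * k + 1) + lambert_fps (2 * k + 3) - lambert_fps (2 * k + 1) - 12 * conv_fps k"
proof (rule fps_eq_agreeI)
  fix L
  define c where "c a b = of_nat a * of_nat b * (geom_fps a * geom_fps b)" for a b
  define S Q where "S = lambert_upto L" and "Q = (\<Sum>N=1..L. of_nat N ^ (2 * k) * geom_fps N * conv_geom N)"
  have "12 * (\<Sum>j\<le>k. of_nat (2 * k choose (2 * j)) * S (2 * j + 1) * S (2 * (k - j) + 1))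
      = (\<Sum>a=1..L. \<Sum>b=1..L. 6 * (2 * (\<Sum>j\<le>k. of_nat (2 * k choose (2 * j)) * of_nat a ^ (2 * j) * of_nat b ^ (2 * (k - j)))) * c a b)"
  proof -
    have "12 * (of_nat (2 * k choose (2 * j)) * S (2 * j + 1) * S (2 * (k - j) + 1))
      = (\<Sum>a=1..L. \<Sum>b=1..L. 12 * (of_nat (2 * k choose (2 * j)) * of_nat a ^ (2 * j) * of_nat b ^ (2 * (k - j))) * c a b)" for j
    proof -
      have "12 * (of_nat (2 * k choose (2 * j)) * S (2 * j + 1) * S (2 * (k - j) + 1)) = 12 * of_nat (2 * k choose (2 * j)) *
          (\<Sum>a=1..L. \<Sum>b=1..L. (of_nat a ^ (2 * j + 1) * geom_fps a) * (of_nat b ^ (2 * (k - j) + 1) * geom_fps b))"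
        unfolding S_def lambert_upto_altdef sum_product[symmetric] by (simp only: mult_ac)
      then show ?thesis
        unfolding sum_distrib_left by (simp add: c_def mult_ac diff_mult_distrib2)
    qed
    then have "12 * (\<Sum>j\<le>k. of_nat (2 * k choose (2 * j)) * S (2 * j + 1) * S (2 * (k - j) + 1))
      = (\<Sum>j\<le>k. \<Sum>a=1..L. \<Sum>b=1..L. 12 * (of_nat (2 * k choose (2 * j)) * of_nat a ^ (2 * j) * of_nat b ^ (2 * (k - j))) * c a b)"
      by (simp add: sum_distrib_left)
    also have "\<dots> = (\<Sum>a=1..L. \<Sum>b=1..L. \<Sum>j\<le>k. 12 * (of_nat (2 * k choose (2 * j)) * of_nat a ^ (2 * j) * of_nat b ^ (2 * (k - j))) * c a b)"
    proof -
      have "(\<Sum>j\<le>k. \<Sum>a=1..L. \<Sum>b=1..L. 12 * (of_nat (2 * k choose (2 * j)) * of_nat a ^ (2 * j) * of_nat b ^ (2 * (k - j))) * c a b)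
        = (\<Sum>a=1..L. \<Sum>j\<le>k. \<Sum>b=1..L. 12 * (of_nat (2 * k choose (2 * j)) * of_nat a ^ (2 * j) * of_nat b ^ (2 * (k - j))) * c a b)"
        by (rule sum.swap)
      also have "\<dots> = (\<Sum>a=1..L. \<Sum>b=1..L. \<Sum>j\<le>k. 12 * (of_nat (2 * k choose (2 * j)) * of_nat a ^ (2 * j) * of_nat b ^ (2 * (k - j))) * c a b)"
        by (rule sum.cong[OF refl], rule sum.swap)
      finally show ?thesis .
    qed
    finally show ?thesis by (simp add: sum_distrib_left sum_distrib_right)
  qed
  also have "\<dots> = 6 * (\<Sum>a=1..L. \<Sum>b=1..L. (of_nat a + of_nat b) ^ (2 * k) * c a b)
      + 6 * (\<Sum>a=1..L. \<Sum>b=1..L. (of_nat a - of_nat b) ^ (2 * k) * c a b)"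
  proof -
    have "6 * (2 * (\<Sum>j\<le>k. of_nat (2 * k choose (2 * j)) * of_nat a ^ (2 * j) * of_nat b ^ (2 * (k - j)))) * c a b
        = 6 * ((of_nat a + of_nat b) ^ (2 * k) * c a b) + 6 * ((of_nat a - of_nat b) ^ (2 * k) * c a b)" for a b
      unfolding even_binomial[symmetric] by (simp add: algebra_simps)
    then show ?thesis by (simp only: sum_distrib_left sum.distrib)
  qed
  also have "fps_agree L \<dots> ((12 * Q + (S (2 * k + 3) - S (2 * k + 1)))
      + 6 * (4 * S 1 * S (2 * k + 1) - 2 * Q - 2 * conv_upto L k))"
    unfolding c_def S_def Q_def
    by (intro fps_agree_add lambert_product_plus fps_agree_mult fps_agree_refl lambert_product_minus k)
  also have "(12 * Q + (S (2 * k + 3) - S (2 * k + 1))) + 6 * (4 * S 1 * S (2 * k + 1) - 2 * Q - 2 * conv_upto L k)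
      = 24 * S 1 * S (2 * k + 1) + S (2 * k + 3) - S (2 * k + 1) - 12 * conv_upto L k"
    by (simp add: algebra_simps)
  finally have "fps_agree L (12 * (\<Sum>j\<le>k. of_nat (2 * k choose (2 * j)) * S (2 * j + 1) * S (2 * (k - j) + 1)))
    (24 * S 1 * S (2 * k + 1) + S (2 * k + 3) - S (2 * k + 1) - 12 * conv_upto L k)" .
  moreover have S: "fps_agree L (S i) (lambert_fps i)" for i unfolding S_def by (rule lambert_upto_agree)
  have "fps_agree L (12 * (\<Sum>j\<le>k. of_nat (2 * k choose (2 * j)) * S (2 * j + 1) * S (2 * (k - j) + 1)))
    (12 * (\<Sum>j\<le>k. of_nat (2 * k choose (2 * j)) * lambert_fps (2 * j + 1) * lambert_fps (2 * (k - j) + 1)))"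
    by (intro fps_agree_mult fps_agree_sum fps_agree_refl S)
  moreover have "fps_agree L (24 * S 1 * S (2 * k + 1) + S (2 * k + 3) - S (2 * k + 1) - 12 * conv_upto L k)
    (24 * lambert_fps 1 * lambert_fps (2 * k + 1) + lambert_fps (2 * k + 3) - lambert_fps (2 * k + 1) - 12 * conv_fps k)"
    by (intro fps_agree_mult fps_agree_add fps_agree_diff fps_agree_refl S conv_upto_agree)
  ultimately show "fps_agree L (12 * (\<Sum>j\<le>k. of_nat (2 * k choose (2 * j)) * lambert_fps (2 * j + 1) * lambert_fps (2 * (k - j) + 1)))
    (24 * lambert_fps 1 * lambert_fps (2 * k + 1) + lambert_fps (2 * k + 3) - lambert_fps (2 * k + 1) - 12 * conv_fps k)"
    by (meson fps_agree_sym fps_agree_trans)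
qed

lemma conv_fps_recurrence:
  "2 * (\<Sum>i\<le>k. of_nat (2 * k + 2 choose (2 * i)) * conv_fps i) = lambert_fps (2 * k + 3) - lambert_fps 2"
proof (rule fps_eq_agreeI)
  fix n
  have "fps_agree n (2 * (\<Sum>i\<le>k. of_nat (2 * k + 2 choose (2 * i)) * conv_upto n i))
      (2 * (\<Sum>i\<le>k. of_nat (2 * k + 2 choose (2 * i)) * conv_fps i))"
    by (intro fps_agree_mult fps_agree_sum fps_agree_refl conv_upto_agree)
  moreover have "fps_agree n (lambert_upto n (2 * k + 3) - lambert_upto n 2) (lambert_fps (2 * k + 3) - lambert_fps 2)"
    by (intro fps_agree_diff lambert_upto_agree)
  ultimately show "fps_agree n (2 * (\<Sum>i\<le>k. of_nat (2 * k + 2 choose (2 * i)) * conv_fps i)) (lambert_fps (2 * k + 3) - lambert_fps 2)"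
    unfolding conv_upto_recurrence by (meson fps_agree_sym fps_agree_trans)
qed

text \<open>The ring \<open>Q\<close> on the level of power series: each of its three series is an
  affine function of \<open>E_2\<close>, \<open>E_4\<close> or \<open>E_6\<close>.\<close>

inductive_set lambert_ring :: "complex fps set" where
  const: "fps_const c \<in> lambert_ring"
| L1: "lambert_fps 1 \<in> lambert_ring"
| L3: "lambert_fps 3 \<in> lambert_ring"
| L5: "lambert_fps 5 \<in> lambert_ring"
| add: "f \<in> lambert_ring \<Longrightarrow> g \<in> lambert_ring \<Longrightarrow> f + g \<in> lambert_ring"
| mult: "f \<in> lambert_ring \<Longrightarrow> g \<in> lambert_ring \<Longrightarrow> f * g \<in> lambert_ring"

lemma lambert_ring_of_nat: "of_nat n \<in> lambert_ring"
  using lambert_ring.const[of "of_nat n"] by (simp add: fps_of_nat)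

lemma lambert_ring_numeral: "numeral n \<in> lambert_ring"
  using lambert_ring_of_nat[of "numeral n"] by simp

lemma lambert_ring_diff:
  assumes "f \<in> lambert_ring" "g \<in> lambert_ring"
  shows "f - g \<in> lambert_ring"
proof -
  have *: "f - g = f + fps_const (- 1) * g" by (simp flip: fps_const_neg)
  show ?thesis unfolding * by (intro lambert_ring.intros assms)
qed

lemma lambert_ring_sum: "(\<And>i. i \<in> A \<Longrightarrow> f i \<in> lambert_ring) \<Longrightarrow> (\<Sum>i\<in>A. f i) \<in> lambert_ring"
  using lambert_ring_of_nat[of 0]
  by (induction A rule: infinite_finite_induct) (auto intro: lambert_ring.add)

lemma lambert_ring_scale:
  assumes "fps_const c * f \<in> lambert_ring" "c \<noteq> 0"
  shows "f \<in> lambert_ring"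
proof -
  have "f = fps_const (inverse c) * (fps_const c * f)"
    using assms(2) by (simp add: mult.assoc[symmetric])
  then show ?thesis using assms by (metis lambert_ring.const lambert_ring.mult)
qed

text \<open>Subtracting the case \<open>k = 0\<close> of the recurrence eliminates
  \<open>conv_fps 0\<close> together with the even-index series
  \<open>lambert_fps 2\<close>.\<close>

lemma conv_fps_recurrence_tail:
  assumes "1 \<le> k"
  shows "2 * (\<Sum>i=1..k. of_nat (2 * k + 2 choose (2 * i)) * conv_fps i) = lambert_fps (2 * k + 3) - lambert_fps 3"
proof -
  have "{..k} = insert 0 {1..k}" by auto
  then have "2 * (\<Sum>i\<le>k. of_nat (2 * k + 2 choose (2 * i)) * conv_fps i)
      = 2 * conv_fps 0 + 2 * (\<Sum>i=1..k. of_nat (2 * k + 2 choose (2 * i)) * conv_fps i)"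
    by (simp add: distrib_left)
  moreover have "2 * conv_fps 0 = lambert_fps 3 - lambert_fps 2"
    using conv_fps_recurrence[of 0] by simp
  ultimately have "2 * (\<Sum>i=1..k. of_nat (2 * k + 2 choose (2 * i)) * conv_fps i)
      = (lambert_fps (2 * k + 3) - lambert_fps 2) - (lambert_fps 3 - lambert_fps 2)"
    unfolding conv_fps_recurrence by (simp add: eq_diff_eq add.commute)
  then show ?thesis by simp
qed

text \<open>
  For \<open>k \<ge> 2\<close>, the convolution identity and the recurrence are two independent linear equations for
  \<open>lambert_fps (2 * k + 3)\<close> and \<open>conv_fps k\<close> with right-hand sides in the ring; for \<open>k = 1\<close> they are
  dependent, which is why \<open>lambert_fps 5\<close> is a generator.
\<close>

lemma lambert_conv_in_ring:
  assumes "1 \<le> k"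
  shows "lambert_fps (2 * k + 3) \<in> lambert_ring \<and> conv_fps k \<in> lambert_ring"
  using assms
proof (induction k rule: less_induct)
  case (less k)
  have L: "lambert_fps (2 * i + 1) \<in> lambert_ring" if "i \<le> k" for i
  proof -
    consider "i = 0" | "i = 1" | "2 \<le> i" by linarith
    then show ?thesis
    proof cases
      case 3
      then have "i - 1 < k" "1 \<le> i - 1" using that by auto
      then have "lambert_fps (2 * (i - 1) + 3) \<in> lambert_ring" using less.IH by blast
      moreover have "2 * (i - 1) + 3 = 2 * i + 1" using 3 by simp
      ultimately show ?thesis by metis
    qed (use lambert_ring.L1 lambert_ring.L3 in simp_all)
  qed
  have split: "{1..k} = insert k {1..<k}" using less.prems by auto
  define b :: nat where "b = (2 * k + 2 choose (2 * k))"
  have b2: "2 * b = (2 * k + 2) * (2 * k + 1)"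
  proof -
    have "b = (2 * k + 2 choose 2)" unfolding b_def by (subst binomial_symmetric) auto
    then show ?thesis by (simp add: choose_two)
  qed
  then have "b \<noteq> 0" by auto
  have "2 * (of_nat b * conv_fps k + (\<Sum>i=1..<k. of_nat (2 * k + 2 choose (2 * i)) * conv_fps i))
      = lambert_fps (2 * k + 3) - lambert_fps 3"
    using conv_fps_recurrence_tail[OF less.prems] unfolding split b_def by simp
  then have rec: "of_nat (2 * b) * conv_fps k = lambert_fps (2 * k + 3) - lambert_fps 3
      - 2 * (\<Sum>i=1..<k. of_nat (2 * k + 2 choose (2 * i)) * conv_fps i)"
    by (simp add: algebra_simps)
  have sum_in: "(\<Sum>i=1..<k. of_nat (2 * k + 2 choose (2 * i)) * conv_fps i) \<in> lambert_ring"
  proof (rule lambert_ring_sum)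
    fix i
    assume "i \<in> {1..<k}"
    then have "conv_fps i \<in> lambert_ring" using less.IH[of i] by simp
    then show "of_nat (2 * k + 2 choose (2 * i)) * conv_fps i \<in> lambert_ring"
      by (intro lambert_ring.mult lambert_ring_of_nat)
  qed
  show ?case
  proof (cases "k = 1")
    case True
    have "of_nat (2 * b) * conv_fps k \<in> lambert_ring"
      unfolding rec using sum_in lambert_ring.L5
      by (intro lambert_ring_diff lambert_ring.mult lambert_ring.L3 lambert_ring_numeral) (simp_all add: True)
    then have "fps_const (of_nat (2 * b)) * conv_fps k \<in> lambert_ring" by (simp only: fps_of_nat)
    then have "conv_fps k \<in> lambert_ring"
      by (rule lambert_ring_scale[of "of_nat (2 * b)"])
        (use \<open>b \<noteq> 0\<close> in simp)
    then show ?thesis using True lambert_ring.L5 by simp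
  next
    case False
    then have k: "2 \<le> k" using less.prems by simp
    \<comment> \<open>All Lambert indices on the right are odd and at most \<open>2 * k + 1\<close>,
      hence covered by the generators and the induction hypothesis.\<close>
    have conv: "lambert_fps (2 * k + 3) - 12 * conv_fps k =
        12 * (\<Sum>j\<le>k. of_nat (2 * k choose (2 * j)) * lambert_fps (2 * j + 1) * lambert_fps (2 * (k - j) + 1))
        - 24 * lambert_fps 1 * lambert_fps (2 * k + 1) + lambert_fps (2 * k + 1)"
      unfolding lambert_convolution[OF less.prems] by (simp add: algebra_simps)
    have in1: "lambert_fps (2 * k + 3) - 12 * conv_fps k \<in> lambert_ring"
      unfolding conv
      by (intro lambert_ring.add lambert_ring_diff lambert_ring.mult lambert_ring_sum lambert_ring_of_nat
          lambert_ring_numeral L lambert_ring.L1) auto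
    \<comment> \<open>Eliminating \<open>lambert_fps (2 * k + 3)\<close> between the two equations
      leaves \<open>conv_fps k\<close> with the factor \<open>2 * b - 12\<close>.\<close>
    have rec': "of_nat (2 * b) * conv_fps k - 12 * conv_fps k =
        (lambert_fps (2 * k + 3) - 12 * conv_fps k) - lambert_fps 3
        - 2 * (\<Sum>i=1..<k. of_nat (2 * k + 2 choose (2 * i)) * conv_fps i)"
      unfolding rec by (simp add: algebra_simps)
    have "of_nat (2 * b) * conv_fps k - 12 * conv_fps k \<in> lambert_ring"
      unfolding rec'
      by (rule lambert_ring_diff[OF lambert_ring_diff[OF in1 lambert_ring.L3]
            lambert_ring.mult[OF lambert_ring_numeral sum_in]])
    moreover have "fps_const (of_nat (2 * b) - 12) * conv_fps k = of_nat (2 * b) * conv_fps k - 12 * conv_fps k"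
    proof -
      have "fps_const (of_nat (2 * b) - 12 :: complex) = fps_const (of_nat (2 * b)) - fps_const (of_nat 12)"
        by simp
      also have "\<dots> = of_nat (2 * b) - of_nat 12" by (simp only: fps_of_nat)
      also have "\<dots> = of_nat (2 * b) - 12" by simp
      finally show ?thesis by (simp only: left_diff_distrib)
    qed
    \<comment> \<open>The factor is \<open>(2k+2)(2k+1) - 12\<close>, which is 0 at
      \<open>k = 1\<close> and positive from \<open>k = 2\<close> on.\<close>
    moreover have "of_nat (2 * b) - 12 \<noteq> (0 :: complex)"
    proof -
      have "(2 * k + 2) * (2 * k + 1) \<ge> (2 * 2 + 2) * (2 * 2 + 1)" using k by (intro mult_mono) auto
      then have "2 * b \<noteq> 12" using b2 by simp
      then have "of_nat (2 * b) \<noteq> (of_nat 12 :: complex)" using of_nat_eq_iff by blast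
      then show ?thesis by simp
    qed
    ultimately have c: "conv_fps k \<in> lambert_ring"
      by (metis lambert_ring_scale)
    have "(lambert_fps (2 * k + 3) - 12 * conv_fps k) + 12 * conv_fps k \<in> lambert_ring"
      by (intro lambert_ring.add lambert_ring.mult lambert_ring_numeral in1 c)
    then have "lambert_fps (2 * k + 3) \<in> lambert_ring" by (simp only: diff_add_cancel)
    then show ?thesis using c by simp
  qed
qed

lemma lambert_odd_in_ring: "lambert_fps (2 * i + 1) \<in> lambert_ring"
proof -
  consider "i = 0" | "i = 1" | "2 \<le> i" by linarith
  then show ?thesis
  proof cases
    case 3
    then have "1 \<le> i - 1" by simp
    then have "lambert_fps (2 * (i - 1) + 3) \<in> lambert_ring" using lambert_conv_in_ring by blast
    moreover have "2 * (i - 1) + 3 = 2 * i + 1" using 3 by simp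
    ultimately show ?thesis by metis
  qed (use lambert_ring.L1 lambert_ring.L3 in simp_all)
qed

section \<open>Realization of the ring of Lambert series\<close>

lemma removal_sum_map: "removal_sum f (map g xs) = removal_sum (\<lambda>y ys. f (g y) (map g ys)) xs"
  by (induction xs arbitrary: f) simp_all

lemma removal_sum_replicate:
  fixes f :: "'a \<Rightarrow> 'a list \<Rightarrow> 'b::comm_semiring_1"
  shows "removal_sum f (replicate (Suc n) x) = of_nat (Suc n) * f x (replicate n x)"
proof (induction n arbitrary: f)
  case (Suc n)
  have "removal_sum f (replicate (Suc (Suc n)) x) =
      f x (replicate (Suc n) x) + removal_sum (\<lambda>y ys. f y (x # ys)) (replicate (Suc n) x)"
    by (simp only: replicate_Suc removal_sum.simps)
  also have "\<dots> = of_nat (Suc (Suc n)) * f x (replicate (Suc n) x)"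
    unfolding Suc by (simp add: algebra_simps)
  finally show ?case .
qed simp

text \<open>The order of quantifiers matters: one ring element has to serve all truncations
  \<open>K\<close>.\<close>

lemma removal_sum_agree:
  assumes "\<And>y ys. y \<in> set xs \<Longrightarrow> mset xs = add_mset y (mset ys) \<Longrightarrow>
    \<exists>f\<in>lambert_ring. \<forall>K. fps_agree K (F K y ys) (f * c)"
  shows "\<exists>f\<in>lambert_ring. \<forall>K. fps_agree K (removal_sum (F K) xs) (f * c)"
  using assms
proof (induction xs arbitrary: F)
  case Nil
  show ?case using lambert_ring.const[of 0] by (intro bexI[of _ 0]) (simp_all add: fps_agree_refl)
next
  case (Cons x xs)
  obtain f where f: "f \<in> lambert_ring" "\<forall>K. fps_agree K (F K x xs) (f * c)"
    using Cons.prems[of x xs] by auto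
  have "\<exists>g\<in>lambert_ring. \<forall>K. fps_agree K (removal_sum (\<lambda>y ys. F K y (x # ys)) xs) (g * c)"
    by (rule Cons.IH) (rule Cons.prems, auto)
  then obtain g where g: "g \<in> lambert_ring" "\<forall>K. fps_agree K (removal_sum (\<lambda>y ys. F K y (x # ys)) xs) (g * c)"
    by blast
  show ?case
    using f g by (intro bexI[of _ "f + g"]) (auto simp: distrib_right intro: fps_agree_add lambert_ring.add)
qed

lemma pairing_derivative_fields_agree:
  "\<exists>f\<in>lambert_ring. \<forall>K. fps_agree K (pairing_upto K (derivative_field x) (derivative_field y)) f"
proof -
  obtain R where R: "\<And>n. pairing_upto n (derivative_field x) (derivative_field y) =
    (\<Sum>i\<le>degree R. fps_const (coeff R i) * lambert_upto n (2 * i + 1))"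
    using pairing_derivative_fields by blast
  show ?thesis
  proof (intro bexI[of _ "\<Sum>i\<le>degree R. fps_const (coeff R i) * lambert_fps (2 * i + 1)"] allI)
    show "(\<Sum>i\<le>degree R. fps_const (coeff R i) * lambert_fps (2 * i + 1)) \<in> lambert_ring"
      by (intro lambert_ring_sum lambert_ring.mult lambert_ring.const lambert_odd_in_ring)
  next
    fix K
    show "fps_agree K (pairing_upto K (derivative_field x) (derivative_field y))
        (\<Sum>i\<le>degree R. fps_const (coeff R i) * lambert_fps (2 * i + 1))"
      unfolding R by (intro fps_agree_sum fps_agree_mult fps_agree_refl lambert_upto_agree)
  qed
qed

text \<open>Each Wick step removes two factors, hence induction on the length. A single factor
  leaves an empty removal sum, so products of odd length have trace 0.\<close>

lemma trace_fps_derivative_fields: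
  fixes xs :: "('h::bilinear_form_space \<times> nat) list"
  shows "\<exists>f\<in>lambert_ring. \<forall>K. fps_agree K (trace_fps (fld (int K) (map derivative_field xs) 0)) (f * char_fps TYPE('h))"
proof (induction xs rule: length_induct)
  case (1 xs)
  show ?case
  proof (cases xs)
    case Nil
    then show ?thesis
      using lambert_ring.const[of 1] by (intro bexI[of _ 1]) (simp_all add: trace_fps_fld_Nil fps_agree_refl del: fld.simps)
  next
    case (Cons x zs)
    have "\<exists>f\<in>lambert_ring. \<forall>K. fps_agree K
      (removal_sum (\<lambda>y ys. pairing_upto K (derivative_field x) (derivative_field y) *
        trace_fps (fld (int K) (map derivative_field ys) 0)) zs) (f * char_fps TYPE('h))"
    proof (rule removal_sum_agree)
      fix y ys
      assume "mset zs = add_mset y (mset ys)"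
      then have "length zs = Suc (length ys)" by (metis size_add_mset size_mset)
      then have "length ys < length xs" using Cons by simp
      then obtain f where f: "f \<in> lambert_ring" "\<And>K. fps_agree K (trace_fps (fld (int K) (map derivative_field ys) 0))
          (f * char_fps TYPE('h))"
        using 1 by blast
      obtain p where p: "p \<in> lambert_ring" "\<And>K. fps_agree K (pairing_upto K (derivative_field x) (derivative_field y)) p"
        using pairing_derivative_fields_agree by blast
      show "\<exists>f\<in>lambert_ring. \<forall>K. fps_agree K (pairing_upto K (derivative_field x) (derivative_field y) *
        trace_fps (fld (int K) (map derivative_field ys) 0)) (f * char_fps TYPE('h))"
        using f p by (intro bexI[of _ "p * f"]) (auto simp: mult.assoc intro: fps_agree_mult lambert_ring.mult)
    qed
    then show ?thesis unfolding Cons list.map trace_fps_fld_Cons removal_sum_map .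
  qed
qed

lemma trace_fps_zero_mode_linear:
  "trace_fps (zero_mode (c *\<^sub>C u + v)) = fps_const c * trace_fps (zero_mode u) + trace_fps (zero_mode v)"
proof -
  have "zero_mode (c *\<^sub>C u + v) = (\<lambda>w. c *\<^sub>C zero_mode u w + zero_mode v w)"
    by (rule ext) (simp add: clinear_simps[OF clinear_zero_mode])
  then show ?thesis by (simp add: trace_fps_linear)
qed

lemma trace_fps_zero_mode_zero: "trace_fps (zero_mode (0 :: 'h::bilinear_form_space fock)) = 0"
proof -
  have "zero_mode (0 :: 'h fock) = (\<lambda>w. 0)" by (rule ext) (rule clinear_0[OF clinear_zero_mode])
  then show ?thesis by (simp add: trace_fps_linear)
qed

lemma trace_fps_zero_mode:
  fixes v :: "'h::bilinear_form_space fock"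
  shows "\<exists>f\<in>lambert_ring. trace_fps (zero_mode v) = f * char_fps TYPE('h)"
proof (induction v rule: fock_mon_induct)
  case zero
  show ?case
    using lambert_ring.const[of 0] by (intro bexI[of _ 0]) (simp_all add: trace_fps_zero_mode_zero)
next
  case (step c N v)
  obtain g where g: "g \<in> lambert_ring" "trace_fps (zero_mode v) = g * char_fps TYPE('h)" using step by blast
  obtain xs where xs: "set xs \<subseteq> onb \<times> {1..}" "mon N = fock_monomial xs"
    using osc_basis_list[OF step(1)] by blast
  then have r: "realizes (mon N) (map derivative_field xs)"
    using realizes_fock_monomial[of xs] by fastforce
  obtain f where f: "f \<in> lambert_ring" "\<And>K. fps_agree K (trace_fps (fld (int K) (map derivative_field xs) 0))
      (f * char_fps TYPE('h))"
    using trace_fps_derivative_fields by blast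
  have "trace_fps (zero_mode (mon N)) = f * char_fps TYPE('h)" by (rule realizes_trace[OF r f(2)])
  then have "trace_fps (zero_mode (c *\<^sub>C mon N + v)) = (fps_const c * f + g) * char_fps TYPE('h)"
    by (simp add: trace_fps_zero_mode_linear g distrib_right mult.assoc)
  moreover have "fps_const c * f + g \<in> lambert_ring"
    by (intro lambert_ring.add lambert_ring.mult lambert_ring.const f g)
  ultimately show ?case by blast
qed

section \<open>Realizing powers of linear forms\<close>

inductive_set derivative_span :: "(int \<Rightarrow> 'h::bilinear_form_space) set" where
  base: "1 \<le> k \<Longrightarrow> derivative_field (a, k) \<in> derivative_span"
| step: "x \<in> derivative_span \<Longrightarrow> y \<in> derivative_span \<Longrightarrow> (\<lambda>m. c *\<^sub>C x m + y m) \<in> derivative_span"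

text \<open>The last slot is reduced to derivative fields along its derivation in the span, using
  multilinearity, and then joins the tail \<open>vs\<close>. The tail is there to make this
  induction possible.\<close>

lemma derivative_span_realized:
  assumes "set us \<subseteq> derivative_span" "\<forall>(a, k)\<in>set vs. 1 \<le> k"
  shows "\<exists>v. realizes v (us @ map derivative_field vs)"
  using assms
proof (induction us arbitrary: vs rule: rev_induct)
  case Nil
  then show ?case using realizes_fock_monomial by auto
next
  case (snoc x us)
  have "x \<in> derivative_span" and us: "set us \<subseteq> derivative_span" using snoc.prems by auto
  then have "\<exists>v. realizes v (us @ x # map derivative_field vs)"
  proof induction
    case (base k a)
    then show ?case using snoc.IH[OF us, of "(a, k) # vs"] snoc.prems by simp
  next
    case (step x y c)
    then show ?case using realizes_multilinear by blast
  qed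
  then show ?case by simp
qed

definition quadratic_field :: "complex \<Rightarrow> complex \<Rightarrow> complex \<Rightarrow> 'h::bilinear_form_space \<Rightarrow> int \<Rightarrow> 'h"
  where "quadratic_field p q r b m = (p + q * of_int m + r * (of_int m)\<^sup>2) *\<^sub>C b"

text \<open>The field \<open>b(z)\<close> and its first two divided derivatives have the mode coefficients \<open>1\<close>, \<open>- m - 1\<close> and
  \<open>(m + 1) (m + 2) / 2\<close>.\<close>

lemma quadratic_field_span: "quadratic_field p q r b \<in> derivative_span"
proof -
  have g: "z gchoose 2 = z * (z - 1) / 2" for z :: complex
    by (simp add: gbinomial_prod_rev numeral_2_eq_2)
  have d: "derivative_field (b, 1) m = b" "derivative_field (b, 2) m = (- of_int m - 1) *\<^sub>C b"
      "derivative_field (b, 3) m = ((- of_int m - 1) * (- of_int m - 2) / 2) *\<^sub>C b" for m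
    by (simp_all add: derivative_field_def g algebra_simps)
  \<comment> \<open>The coefficients are found by comparing powers of \<open>m\<close>. The span
    rule adds a multiple of one element to an unscaled one, so the coefficient \<open>2 * r\<close>
    of the last field is split as \<open>(2 * r - 1) + 1\<close>.\<close>
  have "quadratic_field p q r b = (\<lambda>m. (p - q + r) *\<^sub>C derivative_field (b, 1) m
      + ((3 * r - q) *\<^sub>C derivative_field (b, 2) m + ((2 * r - 1) *\<^sub>C derivative_field (b, 3) m + derivative_field (b, 3) m)))"
  proof
    fix m
    let ?x = "of_int m :: complex"
    have "(p - q + r) *\<^sub>C derivative_field (b, 1) m
      + ((3 * r - q) *\<^sub>C derivative_field (b, 2) m + ((2 * r - 1) *\<^sub>C derivative_field (b, 3) m + derivative_field (b, 3) m))
      = ((p - q + r) + ((3 * r - q) * (- ?x - 1) + ((2 * r - 1) * ((- ?x - 1) * (- ?x - 2) / 2)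
        + (- ?x - 1) * (- ?x - 2) / 2))) *\<^sub>C b"
      unfolding d by (simp only: scaleC_add_left scaleC_scaleC)
    also have "(p - q + r) + ((3 * r - q) * (- ?x - 1) + ((2 * r - 1) * ((- ?x - 1) * (- ?x - 2) / 2)
        + (- ?x - 1) * (- ?x - 2) / 2)) = p + q * ?x + r * ?x\<^sup>2"
      by (simp add: field_simps power2_eq_square)
    finally show "quadratic_field p q r b m = (p - q + r) *\<^sub>C derivative_field (b, 1) m
      + ((3 * r - q) *\<^sub>C derivative_field (b, 2) m + ((2 * r - 1) *\<^sub>C derivative_field (b, 3) m + derivative_field (b, 3) m))"
      by (simp add: quadratic_field_def)
  qed
  then show ?thesis
    by (simp only:) (intro derivative_span.step derivative_span.base, simp_all)
qed

text \<open>With \<open>P(m) = p + q m + r m^2\<close> one has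
  \<open>P(m) P(-m) = (p + r m^2)^2 - q^2 m^2\<close>, so the three coefficients can be prescribed
  independently.\<close>

lemma pairing_quadratic_field:
  assumes "b \<in> onb"
  shows "pairing_upto n (quadratic_field p q r b) (quadratic_field p q r b) =
    fps_const (2 * p\<^sup>2) * lambert_upto n 1 + fps_const (2 * (2 * p * r - q\<^sup>2)) * lambert_upto n 3
    + fps_const (2 * r\<^sup>2) * lambert_upto n 5"
proof -
  have c: "of_nat m * (bform (quadratic_field p q r b (int m)) (quadratic_field p q r b (- int m))
      + bform (quadratic_field p q r b (- int m)) (quadratic_field p q r b (int m)))
    = (2 * p\<^sup>2) * of_nat m ^ 1 + (2 * (2 * p * r - q\<^sup>2)) * of_nat m ^ 3 + (2 * r\<^sup>2) * of_nat m ^ 5" for m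
  proof -
    have "bform (quadratic_field p q r b k) (quadratic_field p q r b l) =
        (p + q * of_int k + r * (of_int k)\<^sup>2) * (p + q * of_int l + r * (of_int l)\<^sup>2)" for k l
      using assms by (simp add: quadratic_field_def bform_scale bform_scale_right bform_onb)
    then show ?thesis by (simp add: algebra_simps eval_nat_numeral)
  qed
  show ?thesis
    unfolding pairing_upto_def lambert_upto_def c sum_distrib_left sum.distrib[symmetric]
    by (intro sum.cong refl) (simp add: distrib_right mult.assoc flip: fps_const_add fps_const_mult)
qed

text \<open>The product of odd numbers counts the perfect matchings of \<open>2 * l\<close> equal
  factors.\<close>

lemma trace_fps_replicate:
  fixes x :: "int \<Rightarrow> 'h::bilinear_form_space"
  shows "trace_fps (fld (int K) (replicate (2 * l) x) 0) =
    of_nat (\<Prod>i<l. 2 * i + 1) * pairing_upto K x x ^ l * char_fps TYPE('h)"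
proof (induction l)
  case 0
  show ?case by (simp add: trace_fps_fld_Nil del: fld.simps)
next
  case (Suc l)
  have "replicate (2 * Suc l) x = x # replicate (Suc (2 * l)) x" by simp
  then have "trace_fps (fld (int K) (replicate (2 * Suc l) x) 0)
      = of_nat (Suc (2 * l)) * (pairing_upto K x x * trace_fps (fld (int K) (replicate (2 * l) x) 0))"
    by (simp only: trace_fps_fld_Cons removal_sum_replicate)
  also have "\<dots> = of_nat (\<Prod>i<Suc l. 2 * i + 1) * pairing_upto K x x ^ Suc l * char_fps TYPE('h)"
    unfolding Suc prod.lessThan_Suc of_nat_mult power_Suc by (simp add: mult_ac)
  finally show ?case .
qed

definition trace_image :: "'h::bilinear_form_space itself \<Rightarrow> complex fps set"
  where "trace_image t = {f. \<exists>v :: 'h fock. trace_fps (zero_mode v) = f * char_fps t}"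

lemma trace_image_linear:
  assumes "f \<in> trace_image TYPE('h::bilinear_form_space)" "g \<in> trace_image TYPE('h)"
  shows "fps_const c * f + g \<in> trace_image TYPE('h)"
proof -
  obtain u v :: "'h fock" where "trace_fps (zero_mode u) = f * char_fps TYPE('h)"
      "trace_fps (zero_mode v) = g * char_fps TYPE('h)"
    using assms by (auto simp: trace_image_def)
  then have "trace_fps (zero_mode (c *\<^sub>C u + v)) = (fps_const c * f + g) * char_fps TYPE('h)"
    by (simp add: trace_fps_zero_mode_linear distrib_right mult.assoc)
  then show ?thesis unfolding trace_image_def by blast
qed

lemma trace_image_zero: "0 \<in> trace_image TYPE('h::bilinear_form_space)"
  unfolding trace_image_def using trace_fps_zero_mode_zero[where 'h = 'h] by fastforce

lemma trace_image_scale: "f \<in> trace_image TYPE('h::bilinear_form_space) \<Longrightarrow> fps_const c * f \<in> trace_image TYPE('h)"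
  using trace_image_linear[OF _ trace_image_zero, of f c] by simp

lemma trace_image_diff:
  "f \<in> trace_image TYPE('h::bilinear_form_space) \<Longrightarrow> g \<in> trace_image TYPE('h) \<Longrightarrow> f - g \<in> trace_image TYPE('h)"
  using trace_image_linear[of g f "- 1"] by (simp flip: fps_const_neg)

text \<open>Positive dimension supplies the unit vector \<open>e\<close>. Its quadratic fields have
  every linear form in the three series as self-pairing, and the number of matchings is divided out
  at the end.\<close>

lemma linear_form_power_in_image:
  assumes "complex_vector.dim (UNIV :: 'h::bilinear_form_space set) \<ge> 1"
  shows "(fps_const a * lambert_fps 1 + fps_const b * lambert_fps 3 + fps_const c * lambert_fps 5) ^ l
    \<in> trace_image TYPE('h)"
proof -
  have "onb \<noteq> ({} :: 'h set)" using assms card_onb[where 'h = 'h] by force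
  then obtain e :: 'h where e: "e \<in> onb" by blast
  \<comment> \<open>The outer coefficients \<open>a\<close> and \<open>c\<close> fix
    \<open>p\<close> and \<open>r\<close>; then \<open>q\<close> adjusts the middle coefficient
    \<open>b\<close>.\<close>
  define p r where "p = csqrt (a / 2)" and "r = csqrt (c / 2)"
  define q where "q = csqrt (2 * p * r - b / 2)"
  have pqr: "2 * p\<^sup>2 = a" "2 * (2 * p * r - q\<^sup>2) = b" "2 * r\<^sup>2 = c"
    by (simp_all add: p_def q_def r_def)
  define x where "x = quadratic_field p q r e"
  let ?L = "fps_const a * lambert_fps 1 + fps_const b * lambert_fps 3 + fps_const c * lambert_fps 5"
  have G: "fps_agree K (pairing_upto K x x) ?L" for K
    unfolding x_def pairing_quadratic_field[OF e] pqr
    by (intro fps_agree_add fps_agree_mult fps_agree_refl lambert_upto_agree)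
  have "set (replicate (2 * l) x) \<subseteq> derivative_span"
    using quadratic_field_span by (auto simp: x_def)
  then obtain v where v: "realizes v (replicate (2 * l) x)"
    using derivative_span_realized[of "replicate (2 * l) x" "[]"] by auto
  let ?n = "\<Prod>i<l. 2 * i + 1 :: nat"
  have "trace_fps (zero_mode v) = of_nat ?n * ?L ^ l * char_fps TYPE('h)"
  proof (rule realizes_trace[OF v])
    fix K
    show "fps_agree K (trace_fps (fld (int K) (replicate (2 * l) x) 0)) (of_nat ?n * ?L ^ l * char_fps TYPE('h))"
      unfolding trace_fps_replicate by (intro fps_agree_mult fps_agree_refl fps_agree_power G)
  qed
  then have "of_nat ?n * ?L ^ l \<in> trace_image TYPE('h)" unfolding trace_image_def by blast
  then have "fps_const (inverse (of_nat ?n)) * (of_nat ?n * ?L ^ l) \<in> trace_image TYPE('h)"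
    by (rule trace_image_scale)
  moreover have "fps_const (inverse (of_nat ?n)) * of_nat ?n = (1 :: complex fps)"
  proof -
    have nz: "(of_nat ?n :: complex) \<noteq> 0" by (simp del: of_nat_prod of_nat_add of_nat_mult add: prod_zero_iff)
    then have "fps_const (inverse (of_nat ?n)) * fps_const (of_nat ?n) = (1 :: complex fps)"
      by (simp only: fps_const_mult left_inverse[OF nz] fps_const_1_eq_1)
    then show ?thesis by (simp only: fps_of_nat)
  qed
  ultimately show ?thesis by (simp only: mult.assoc[symmetric] mult_1_left)
qed

text \<open>
  Replacing \<open>t\<close> by \<open>2 t\<close> and subtracting \<open>2\<^sup>n\<^sup>+\<^sup>1\<close> times the original sum removes the top coefficient.
\<close>

lemma coefficient_extraction:
  assumes "\<And>t. (\<Sum>i\<le>n. fps_const (t ^ i) * r i) \<in> trace_image TYPE('h::bilinear_form_space)"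
  shows "i \<le> n \<Longrightarrow> r i \<in> trace_image TYPE('h)"
  using assms
proof (induction n arbitrary: r i)
  case 0
  then show ?case using "0.prems"(2)[of 1] by simp
next
  case (Suc n)
  let ?p = "\<lambda>t. \<Sum>i\<le>Suc n. fps_const (t ^ i) * r i"
  have low: "r j \<in> trace_image TYPE('h)" if j: "j \<le> n" for j
  proof -
    have "(\<Sum>i\<le>n. fps_const (t ^ i) * (fps_const (2 ^ i - 2 ^ Suc n) * r i)) \<in> trace_image TYPE('h)" for t
    proof -
      have "?p (2 * t) - fps_const (2 ^ Suc n) * ?p t \<in> trace_image TYPE('h)"
        by (intro trace_image_diff trace_image_scale Suc.prems(2))
      moreover have "?p (2 * t) - fps_const (2 ^ Suc n) * ?p t
          = (\<Sum>i\<le>Suc n. fps_const (t ^ i) * (fps_const (2 ^ i - 2 ^ Suc n) * r i))"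
        unfolding sum_distrib_left sum_subtractf[symmetric]
      proof (rule sum.cong[OF refl])
        fix i
        have "fps_const ((2 * t) ^ i) = fps_const (2 ^ i) * fps_const (t ^ i)"
          by (simp add: power_mult_distrib)
        moreover have "fps_const (2 ^ i - 2 ^ Suc n :: complex) = fps_const (2 ^ i) - fps_const (2 ^ Suc n)"
          by (simp only: fps_const_sub)
        ultimately show "fps_const ((2 * t) ^ i) * r i - fps_const (2 ^ Suc n) * (fps_const (t ^ i) * r i)
            = fps_const (t ^ i) * (fps_const (2 ^ i - 2 ^ Suc n) * r i)"
          by (simp only: ring_distribs mult_ac)
      qed
      moreover have "\<dots> = (\<Sum>i\<le>n. fps_const (t ^ i) * (fps_const (2 ^ i - 2 ^ Suc n) * r i))"
        unfolding sum.atMost_Suc by simp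
      ultimately show ?thesis by simp
    qed
    then have "fps_const (2 ^ j - 2 ^ Suc n) * r j \<in> trace_image TYPE('h)"
      using Suc.IH[of j "\<lambda>i. fps_const (2 ^ i - 2 ^ Suc n) * r i"] j by blast
    then have "fps_const (inverse (2 ^ j - 2 ^ Suc n)) * (fps_const (2 ^ j - 2 ^ Suc n) * r j) \<in> trace_image TYPE('h)"
      by (rule trace_image_scale)
    moreover have nz: "(2 ^ j - 2 ^ Suc n :: complex) \<noteq> 0"
    proof -
      have "(2::nat) ^ j < 2 ^ Suc n" using j by (intro power_strict_increasing) auto
      then have "(2::nat) ^ j \<noteq> 2 ^ Suc n" by (rule less_imp_neq)
      then have "(of_nat (2 ^ j) :: complex) \<noteq> of_nat (2 ^ Suc n)" using of_nat_eq_iff by blast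
      then show ?thesis by simp
    qed
    ultimately show ?thesis by (simp only: mult.assoc[symmetric] fps_const_mult left_inverse[OF nz] fps_const_1_eq_1 mult_1_left)
  qed
  show ?case
  proof (cases "i = Suc n")
    case True
    \<comment> \<open>The scaling argument loses the top coefficient; it is recovered at
      \<open>t = 1\<close> by subtracting the lower ones.\<close>
    have "(\<Sum>i\<in>A. r i) \<in> trace_image TYPE('h)" if "A \<subseteq> {..n}" "finite A" for A
      using that(2,1)
    proof (induction A)
      case (insert j A)
      then show ?case using trace_image_linear[where ?'h = 'h, of "r j" _ 1] low by simp
    qed (simp add: trace_image_zero)
    then have "(\<Sum>i\<le>n. r i) \<in> trace_image TYPE('h)" by simp
    moreover have "(\<Sum>i\<le>Suc n. r i) \<in> trace_image TYPE('h)" using Suc.prems(2)[of 1] by simp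
    ultimately have "(\<Sum>i\<le>Suc n. r i) - (\<Sum>i\<le>n. r i) \<in> trace_image TYPE('h)" by (rule trace_image_diff[rotated])
    then show ?thesis using True by simp
  next
    case False
    then show ?thesis using low Suc.prems(1) by simp
  qed
qed

text \<open>Polarization: \<open>(A + t B)^(i+j)\<close> is a polynomial in \<open>t\<close> whose
  coefficient of \<open>t^j\<close> is a nonzero multiple of \<open>A^i B^j\<close>. The spectator
  factor \<open>C\<close> allows a second application.\<close>

lemma binomial_extraction:
  fixes A B C :: "complex fps"
  assumes "\<And>n t. (A + fps_const t * B) ^ n * C \<in> trace_image TYPE('h::bilinear_form_space)"
  shows "A ^ i * B ^ j * C \<in> trace_image TYPE('h)"
proof -
  let ?n = "i + j"
  let ?r = "\<lambda>k. of_nat (?n choose k) * B ^ k * A ^ (?n - k) * C"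
  have e: "(A + fps_const t * B) ^ ?n * C = (\<Sum>k\<le>?n. fps_const (t ^ k) * ?r k)" for t
  proof -
    have "(A + fps_const t * B) ^ ?n = (\<Sum>k\<le>?n. of_nat (?n choose k) * (fps_const t * B) ^ k * A ^ (?n - k))"
      unfolding binomial_ring[symmetric] by (simp only: add.commute)
    then show ?thesis
      by (simp add: sum_distrib_left sum_distrib_right power_mult_distrib mult_ac flip: fps_const_power)
  qed
  have "(\<Sum>k\<le>?n. fps_const (t ^ k) * ?r k) \<in> trace_image TYPE('h)" for t
    unfolding e[symmetric] by (rule assms)
  from coefficient_extraction[OF this le_add2] have "?r j \<in> trace_image TYPE('h)" .
  then have "fps_const (inverse (of_nat (?n choose j))) * ?r j \<in> trace_image TYPE('h)"
    by (rule trace_image_scale)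
  moreover have "fps_const (inverse (of_nat (?n choose j))) * of_nat (?n choose j) = (1 :: complex fps)"
  proof -
    have nz: "(of_nat (?n choose j) :: complex) \<noteq> 0" by simp
    then have "fps_const (inverse (of_nat (?n choose j))) * fps_const (of_nat (?n choose j)) = (1 :: complex fps)"
      by (simp only: fps_const_mult left_inverse[OF nz] fps_const_1_eq_1)
    then show ?thesis by (simp only: fps_of_nat)
  qed
  ultimately have "B ^ j * A ^ (?n - j) * C \<in> trace_image TYPE('h)"
    by (simp only: mult.assoc[symmetric] mult_1_left)
  then show ?thesis by (simp add: mult_ac)
qed

inductive_set monomial_span :: "complex fps set" where
  monomial: "lambert_fps 1 ^ i * lambert_fps 3 ^ j * lambert_fps 5 ^ k \<in> monomial_span"
| linear: "f \<in> monomial_span \<Longrightarrow> g \<in> monomial_span \<Longrightarrow> fps_const c * f + g \<in> monomial_span"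

text \<open>Stated as absorption of \<open>f\<close> into any \<open>h\<close> of the span, so that
  the product case of the induction is just two successive absorptions.\<close>

lemma lambert_ring_monomial_span:
  assumes "f \<in> lambert_ring" "h \<in> monomial_span"
  shows "f * h \<in> monomial_span"
proof -
  have mono: "g * h \<in> monomial_span" if "h \<in> monomial_span"
    and "\<And>i j k. g * (lambert_fps 1 ^ i * lambert_fps 3 ^ j * lambert_fps 5 ^ k) \<in> monomial_span" for g h
    using that(1)
  proof induction
    case (linear f f' c)
    then have "fps_const c * (g * f) + g * f' \<in> monomial_span" by (intro monomial_span.linear)
    then show ?case by (simp add: algebra_simps)
  qed (rule that(2))
  show ?thesis
    using assms
  proof (induction arbitrary: h)
    case (const c)
    \<comment> \<open>The \<open>linear\<close> rule leaves its second summand unscaled, so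
      \<open>c\<close> is written as \<open>(c - 1) + 1\<close>.\<close>
    have "fps_const (c - 1) * h + h \<in> monomial_span" using const by (intro monomial_span.linear)
    moreover have "fps_const (c - 1) * h + h = fps_const c * h"
      by (simp add: algebra_simps flip: fps_const_sub)
    ultimately show ?case by simp
  next
    case L1
    show ?case
      by (rule mono[OF L1]) (use monomial_span.monomial[of "Suc _"] in \<open>simp add: mult_ac\<close>)
  next
    case L3
    show ?case
      by (rule mono[OF L3]) (use monomial_span.monomial[of _ "Suc _"] in \<open>simp add: mult_ac\<close>)
  next
    case L5
    show ?case
      by (rule mono[OF L5]) (use monomial_span.monomial[of _ _ "Suc _"] in \<open>simp add: mult_ac\<close>)
  next
    case (add f g)
    then have "fps_const 1 * (f * h) + g * h \<in> monomial_span" by (intro monomial_span.linear) auto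
    then show ?case by (simp add: distrib_right)
  next
    case (mult f g)
    then have "f * (g * h) \<in> monomial_span" by blast
    then show ?case by (simp add: mult.assoc)
  qed
qed

text \<open>Two extractions reduce powers of ternary linear forms to monomials: the first splits off
  \<open>lambert_fps 5\<close>, the second separates the other two series with a power of
  \<open>lambert_fps 5\<close> as spectator.\<close>

lemma lambert_ring_in_image:
  assumes "complex_vector.dim (UNIV :: 'h::bilinear_form_space set) \<ge> 1" "f \<in> lambert_ring"
  shows "f \<in> trace_image TYPE('h)"
proof -
  have "(fps_const a * lambert_fps 1 + fps_const b * lambert_fps 3) ^ i * lambert_fps 5 ^ k * 1 \<in> trace_image TYPE('h)"
    for a b i k
    by (rule binomial_extraction) (use linear_form_power_in_image[OF assms(1)] in simp)
  from this[of 1] have "(lambert_fps 1 + fps_const b * lambert_fps 3) ^ i * lambert_fps 5 ^ k \<in> trace_image TYPE('h)" for b i k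
    by simp
  then have mono: "lambert_fps 1 ^ i * lambert_fps 3 ^ j * lambert_fps 5 ^ k \<in> trace_image TYPE('h)" for i j k
    by (rule binomial_extraction)
  have "h \<in> trace_image TYPE('h)" if "h \<in> monomial_span" for h
    using that by induction (rule mono, rule trace_image_linear)
  moreover have "f * (lambert_fps 1 ^ 0 * lambert_fps 3 ^ 0 * lambert_fps 5 ^ 0) \<in> monomial_span"
    by (rule lambert_ring_monomial_span[OF assms(2) monomial_span.monomial])
  ultimately show ?thesis by simp
qed

section \<open>Convergence and the character\<close>

lemma norm_less_conv_radius:
  fixes z :: complex
  assumes "norm z < 1" "1 \<le> fps_conv_radius f"
  shows "ereal (norm z) < fps_conv_radius f"
proof -
  have "ereal (norm z) < 1" using assms(1) by simp
  then show ?thesis using assms(2) by (rule less_le_trans)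
qed

text \<open>The operator \<open>X d/dX\<close> raises the power of \<open>n\<close> by one and keeps
  the radius at least 1.\<close>

lemma conv_radius_of_nat_power: "1 \<le> fps_conv_radius (Abs_fps (\<lambda>n. of_nat n ^ k) :: complex fps)"
proof (induction k)
  case 0
  have "1 \<le> conv_radius (\<lambda>n. 1 :: complex)"
    by (rule conv_radius_geI_ex') (auto intro!: summable_geometric)
  then show ?case by (simp add: fps_conv_radius_def)
next
  case (Suc k)
  let ?f = "Abs_fps (\<lambda>n. of_nat n ^ k) :: complex fps"
  have "Abs_fps (\<lambda>n. of_nat n ^ Suc k) = fps_X * fps_deriv ?f"
  proof (rule fps_ext)
    fix n
    show "Abs_fps (\<lambda>n. of_nat n ^ Suc k) $ n = (fps_X * fps_deriv ?f) $ n"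
      by (cases n) simp_all
  qed
  moreover have "1 \<le> fps_conv_radius (fps_deriv ?f)"
    using Suc fps_conv_radius_deriv[of ?f] by (rule order_trans)
  ultimately show ?case
    using fps_conv_radius_mult[of fps_X "fps_deriv ?f"] by (simp add: min_def split: if_splits)
qed

lemma conv_radius_polynomial_bound:
  fixes f :: "complex fps"
  assumes "\<And>n. norm (f $ n) \<le> real n ^ k"
  shows "1 \<le> fps_conv_radius f"
  unfolding fps_conv_radius_def
proof (rule conv_radius_geI_ex')
  fix r :: real
  assume r: "0 < r" "ereal r < 1"
  let ?g = "Abs_fps (\<lambda>n. of_nat n ^ k) :: complex fps"
  have "ereal (norm (of_real r :: complex)) < conv_radius (fps_nth ?g)"
    using r norm_less_conv_radius[OF _ conv_radius_of_nat_power, of "of_real r"]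
    unfolding fps_conv_radius_def by simp
  then have "summable (\<lambda>n. norm (?g $ n * of_real r ^ n))"
    by (rule abs_summable_in_conv_radius)
  then show "summable (\<lambda>n. f $ n * of_real r ^ n)"
  proof (rule summable_comparison_test'[where N = 0])
    fix n
    show "norm (f $ n * of_real r ^ n) \<le> norm (?g $ n * of_real r ^ n)"
      using assms[of n] by (simp add: norm_mult norm_power mult_right_mono)
  qed
qed

text \<open>The indicator series of positive multiples of \<open>m\<close> satisfies
  \<open>g = X^m (g + 1)\<close>, an equation whose only solution is
  \<open>geom_fps m\<close>.\<close>

lemma geom_fps_nth:
  assumes "1 \<le> m"
  shows "geom_fps m $ n = (if 0 < n \<and> m dvd n then 1 else 0)"
proof -
  define g :: "complex fps" where "g = Abs_fps (\<lambda>n. if 0 < n \<and> m dvd n then 1 else 0)"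
  have "g = fps_X ^ m * (g + 1)"
  proof (rule fps_ext)
    fix n
    consider "n < m" | "n = m" | "m < n" by linarith
    then show "g $ n = (fps_X ^ m * (g + 1)) $ n"
    proof cases
      case 1
      then show ?thesis by (auto simp: g_def fps_X_power_mult_nth dest: dvd_imp_le)
    next
      case 2
      then show ?thesis using assms by (simp add: g_def fps_X_power_mult_nth)
    next
      case 3
      then have "m dvd n \<longleftrightarrow> m dvd n - m" by (simp add: dvd_minus_self)
      then show ?thesis using 3 by (simp add: g_def fps_X_power_mult_nth)
    qed
  qed
  then have "g = geom_fps m * 1" by (rule fps_eq_geom_mult[OF assms])
  then have *: "geom_fps m = g" by simp
  show ?thesis unfolding * by (simp add: g_def)
qed

lemma lambert_fps_nth: "lambert_fps k $ n = (if n = 0 then 0 else of_nat (divisor_sigma k n))"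
proof (cases "n = 0")
  case True
  then show ?thesis by (simp add: lambert_fps_def lambert_upto_def)
next
  case False
  have "lambert_fps k $ n = (\<Sum>m=1..n. if m dvd n then of_nat (m ^ k) else 0)"
  proof -
    have "lambert_fps k $ n = (\<Sum>m=1..n. of_nat m ^ k * geom_fps m $ n)"
      by (simp add: lambert_fps_def lambert_upto_def fps_sum_nth)
    also have "\<dots> = (\<Sum>m=1..n. if m dvd n then of_nat (m ^ k) else 0)"
      using False by (intro sum.cong refl) (simp add: geom_fps_nth)
    finally show ?thesis .
  qed
  also have "\<dots> = (\<Sum>m | m dvd n. of_nat (m ^ k))"
    using False by (intro sum.mono_neutral_cong_right) (auto intro: dvd_imp_le Suc_leI dvd_pos_nat)
  finally show ?thesis using False by (simp add: divisor_sigma_def)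
qed

lemma conv_radius_lambert_fps: "1 \<le> fps_conv_radius (lambert_fps k)"
proof (rule conv_radius_polynomial_bound)
  fix n
  show "norm (lambert_fps k $ n) \<le> real n ^ Suc k"
  proof (cases "n = 0")
    case False
    have fin: "{m. m dvd n} \<subseteq> {1..n}" using False by (auto intro: dvd_imp_le Suc_leI dvd_pos_nat)
    have "divisor_sigma k n \<le> (\<Sum>m | m dvd n. n ^ k)"
      unfolding divisor_sigma_def using fin by (intro sum_mono power_mono) auto
    also have "\<dots> \<le> n * n ^ k"
      using card_mono[OF _ fin] by simp
    finally have "divisor_sigma k n \<le> n ^ Suc k" by simp
    then have "real (divisor_sigma k n) \<le> real (n ^ Suc k)" by (simp only: of_nat_le_iff)
    then show ?thesis using False by (simp add: lambert_fps_nth)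
  qed (simp add: lambert_fps_nth)
qed

lemma conv_radius_lambert_ring: "f \<in> lambert_ring \<Longrightarrow> 1 \<le> fps_conv_radius f"
proof (induction rule: lambert_ring.induct)
  case (add f g)
  then show ?case using fps_conv_radius_add[of f g] by (meson min.boundedI order_trans)
next
  case (mult f g)
  then show ?case using fps_conv_radius_mult[of f g] by (meson min.boundedI order_trans)
qed (use conv_radius_lambert_fps in simp_all)

section \<open>The character as an infinite product\<close>

definition count_fps :: "('h \<times> nat) set \<Rightarrow> complex fps"
  where "count_fps A = Abs_fps (\<lambda>n. of_nat (card {M. set_mset M \<subseteq> A \<and> wt M = n}))"

lemma finite_multisets_wt:
  assumes "finite A" "\<forall>x\<in>A. 1 \<le> snd x"
  shows "finite {M. set_mset M \<subseteq> A \<and> wt M = n}"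
proof -
  have size: "size M \<le> wt M" if "set_mset M \<subseteq> A" for M
    using that assms(2) by (induction M) auto
  have "{M. set_mset M \<subseteq> A \<and> wt M = n} \<subseteq> mset ` {xs. set xs \<subseteq> A \<and> length xs \<le> n}"
  proof
    fix M
    assume M: "M \<in> {M. set_mset M \<subseteq> A \<and> wt M = n}"
    obtain xs where "mset xs = M" using ex_mset by blast
    then show "M \<in> mset ` {xs. set xs \<subseteq> A \<and> length xs \<le> n}" using M size[of M] by auto
  qed
  then show ?thesis using finite_lists_length_le[OF assms(1)] by (meson finite_imageI finite_subset)
qed

text \<open>Multisets containing \<open>y\<close> correspond to all multisets of weight smaller by
  \<open>snd y\<close>, by removing one copy of \<open>y\<close>.\<close>

lemma count_fps_insert:
  assumes A: "finite A" "\<forall>x\<in>insert y A. 1 \<le> snd x" and y: "y \<notin> A"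
  shows "count_fps (insert y A) * (1 - fps_X ^ snd y) = count_fps A"
proof -
  let ?S = "\<lambda>B n. {M. set_mset M \<subseteq> B \<and> wt M = n}"
  have fin: "finite (?S A n)" "finite (?S (insert y A) n)" for n
    using A by (auto intro!: finite_multisets_wt)
  have "count_fps (insert y A) = count_fps A + fps_X ^ snd y * count_fps (insert y A)"
  proof (rule fps_ext)
    fix n
    have split: "?S (insert y A) n = ?S A n \<union> {M \<in> ?S (insert y A) n. y \<in># M}"
      by auto
    have 1: "card (?S (insert y A) n) = card (?S A n) + card {M \<in> ?S (insert y A) n. y \<in># M}"
    proof -
      have "finite {M \<in> ?S (insert y A) n. y \<in># M}"
        by (rule finite_subset[OF _ fin(2)[of n]]) auto
      then have "card (?S A n \<union> {M \<in> ?S (insert y A) n. y \<in># M})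
          = card (?S A n) + card {M \<in> ?S (insert y A) n. y \<in># M}"
        using fin(1)[of n] y by (intro card_Un_disjoint) auto
      then show ?thesis unfolding split[symmetric] .
    qed
    have 2: "card {M \<in> ?S (insert y A) n. y \<in># M} = (if n < snd y then 0 else card (?S (insert y A) (n - snd y)))"
    proof (cases "n < snd y")
      case True
      then have "{M \<in> ?S (insert y A) n. y \<in># M} = {}" by (auto dest: mem_le_wt)
      then show ?thesis using True by (simp only: card.empty if_True)
    next
      case False
      have "{M \<in> ?S (insert y A) n. y \<in># M} = add_mset y ` ?S (insert y A) (n - snd y)"
      proof (intro equalityI subsetI)
        fix M
        assume M: "M \<in> {M \<in> ?S (insert y A) n. y \<in># M}"
        then obtain N where "M = add_mset y N" by (auto dest: multi_member_split)
        then show "M \<in> add_mset y ` ?S (insert y A) (n - snd y)" using M by auto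
      qed (use False in auto)
      then show ?thesis using False by (simp add: card_image inj_on_def)
    qed
    show "count_fps (insert y A) $ n = (count_fps A + fps_X ^ snd y * count_fps (insert y A)) $ n"
    proof -
      have "count_fps (insert y A) $ n = of_nat (card (?S (insert y A) n))" by (simp add: count_fps_def)
      also have "\<dots> = of_nat (card (?S A n)) + of_nat (if n < snd y then 0 else card (?S (insert y A) (n - snd y)))"
        by (simp only: 1 2 of_nat_add)
      also have "\<dots> = (count_fps A + fps_X ^ snd y * count_fps (insert y A)) $ n"
        by (simp add: count_fps_def fps_X_power_mult_nth)
      finally show ?thesis .
    qed
  qed
  then have "count_fps (insert y A) - fps_X ^ snd y * count_fps (insert y A) = count_fps A"
    unfolding diff_eq_eq .
  moreover have "count_fps (insert y A) * (1 - fps_X ^ snd y) = count_fps (insert y A) - fps_X ^ snd y * count_fps (insert y A)"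
    by (simp add: algebra_simps)
  ultimately show ?thesis by (rule trans[rotated])
qed

lemma count_fps_prod:
  assumes "finite A" "\<forall>x\<in>A. 1 \<le> snd x"
  shows "count_fps A * (\<Prod>x\<in>A. 1 - fps_X ^ snd x) = 1"
  using assms
proof (induction A)
  case empty
  have "{M. M = {#} \<and> wt M = n} = (if n = 0 then {{#} :: ('a \<times> nat) multiset} else {})" for n by auto
  then show ?case by (simp add: count_fps_def fps_eq_iff)
next
  case (insert y A)
  have "count_fps (insert y A) * (\<Prod>x\<in>insert y A. 1 - fps_X ^ snd x)
      = (count_fps (insert y A) * (1 - fps_X ^ snd y)) * (\<Prod>x\<in>A. 1 - fps_X ^ snd x)"
    using insert by (simp add: mult.assoc)
  also have "\<dots> = 1" using insert by (simp add: count_fps_insert)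
  finally show ?case .
qed

lemma geom_fps_inverse: "1 \<le> m \<Longrightarrow> (1 + geom_fps m) * (1 - fps_X ^ m) = 1"
  using geom_fps_mult[of m] by (simp add: distrib_right)

lemma conv_radius_prod:
  fixes f :: "'a \<Rightarrow> complex fps"
  assumes "\<And>x. x \<in> A \<Longrightarrow> 1 \<le> fps_conv_radius (f x)"
  shows "1 \<le> fps_conv_radius (\<Prod>x\<in>A. f x)"
  using assms
proof (induction A rule: infinite_finite_induct)
  case (insert x A)
  then have "1 \<le> min (fps_conv_radius (f x)) (fps_conv_radius (\<Prod>x\<in>A. f x))" by simp
  also have "\<dots> \<le> fps_conv_radius (f x * (\<Prod>x\<in>A. f x))" by (rule fps_conv_radius_mult)
  finally show ?case using insert by simp
qed simp_all

text \<open>The series \<open>1 + geom_fps m\<close> inverts \<open>1 - X^m\<close>. As the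
  coefficients of \<open>geom_fps m\<close> are 0 or 1, each factor of the finite product has radius
  at least 1.\<close>

lemma conv_radius_count_fps:
  assumes "finite A" "\<forall>x\<in>A. 1 \<le> snd x"
  shows "1 \<le> fps_conv_radius (count_fps A)"
proof -
  have "(\<Prod>x\<in>A. 1 + geom_fps (snd x)) * (\<Prod>x\<in>A. 1 - fps_X ^ snd x) = 1"
    unfolding prod.distrib[symmetric] using assms by (intro prod.neutral) (simp add: geom_fps_inverse)
  then have "count_fps A = count_fps A * ((\<Prod>x\<in>A. 1 - fps_X ^ snd x) * (\<Prod>x\<in>A. 1 + geom_fps (snd x)))"
    by (simp add: mult.commute)
  also have "\<dots> = (\<Prod>x\<in>A. 1 + geom_fps (snd x))"
    unfolding mult.assoc[symmetric] count_fps_prod[OF assms] by simp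
  finally have eq: "count_fps A = (\<Prod>x\<in>A. 1 + geom_fps (snd x))" .
  have g: "1 \<le> fps_conv_radius (geom_fps (snd x))" if "x \<in> A" for x
    using assms that by (intro conv_radius_polynomial_bound[of _ 0]) (simp add: geom_fps_nth)
  show ?thesis
    unfolding eq
  proof (rule conv_radius_prod)
    fix x
    assume "x \<in> A"
    then show "1 \<le> fps_conv_radius (1 + geom_fps (snd x))"
      using fps_conv_radius_add[of 1 "geom_fps (snd x)"] g[of x] by (simp add: min_def split: if_splits)
  qed
qed

lemma eval_fps_prod:
  fixes f :: "'a \<Rightarrow> complex fps"
  assumes "\<And>x. x \<in> A \<Longrightarrow> 1 \<le> fps_conv_radius (f x)" "norm z < 1"
  shows "eval_fps (\<Prod>x\<in>A. f x) z = (\<Prod>x\<in>A. eval_fps (f x) z)"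
  using assms
proof (induction A rule: infinite_finite_induct)
  case (insert x A)
  have "1 \<le> fps_conv_radius (f x)" "1 \<le> fps_conv_radius (\<Prod>x\<in>A. f x)"
    using insert.prems(1) by (auto intro: conv_radius_prod)
  then have "ereal (norm z) < fps_conv_radius (f x)" "ereal (norm z) < fps_conv_radius (\<Prod>x\<in>A. f x)"
    using norm_less_conv_radius[OF insert.prems(2)] by auto
  then show ?case using insert by (simp add: eval_fps_mult)
qed simp_all

definition modes_upto :: "nat \<Rightarrow> ('h::bilinear_form_space \<times> nat) set"
  where "modes_upto L = onb \<times> {1..L}"

lemma eval_count_fps:
  assumes z: "norm z < 1"
  shows "eval_fps (count_fps (modes_upto L :: ('h::bilinear_form_space \<times> nat) set)) z *
    (\<Prod>m=1..L. 1 - z ^ m) ^ card (onb :: 'h set) = 1"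
proof -
  let ?A = "modes_upto L :: ('h \<times> nat) set"
  have A: "finite ?A" "\<forall>x\<in>?A. 1 \<le> snd x" by (auto simp: modes_upto_def)
  have r: "1 \<le> fps_conv_radius (1 - fps_X ^ m :: complex fps)" for m
    using fps_conv_radius_diff[of 1 "fps_X ^ m :: complex fps"] by simp
  have e: "eval_fps (1 - fps_X ^ m) z = 1 - z ^ m" for m
    by (subst eval_fps_diff) simp_all
  have "eval_fps (\<Prod>x\<in>?A. 1 - fps_X ^ snd x) z = (\<Prod>x\<in>?A. 1 - z ^ snd x)"
    using z by (simp add: eval_fps_prod r e)
  also have "\<dots> = (\<Prod>b\<in>(onb :: 'h set). \<Prod>m=1..L. 1 - z ^ m)"
    unfolding modes_upto_def prod.cartesian_product case_prod_unfold ..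
  finally have "eval_fps (\<Prod>x\<in>?A. 1 - fps_X ^ snd x) z = (\<Prod>m=1..L. 1 - z ^ m) ^ card (onb :: 'h set)"
    by simp
  moreover have "eval_fps (count_fps ?A * (\<Prod>x\<in>?A. 1 - fps_X ^ snd x)) z
      = eval_fps (count_fps ?A) z * eval_fps (\<Prod>x\<in>?A. 1 - fps_X ^ snd x) z"
    by (intro eval_fps_mult norm_less_conv_radius[OF z] conv_radius_count_fps[OF A] conv_radius_prod r)
  ultimately show ?thesis by (simp add: count_fps_prod[OF A])
qed

lemma count_fps_le_char:
  "\<exists>c. count_fps (modes_upto L :: ('h::bilinear_form_space \<times> nat) set) $ n = of_nat c \<and>
    c \<le> card (osc_weight (int n) :: ('h \<times> nat) multiset set)"
proof -
  have "{M. set_mset M \<subseteq> (modes_upto L :: ('h \<times> nat) set) \<and> wt M = n} \<subseteq> osc_weight (int n)"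
    by (auto simp: osc_weight_def osc_basis_def modes_upto_def)
  from card_mono[OF finite_osc_weight this] show ?thesis by (auto simp: count_fps_def)
qed

lemma count_fps_eq_char:
  assumes "n \<le> L"
  shows "count_fps (modes_upto L :: ('h::bilinear_form_space \<times> nat) set) $ n = char_fps TYPE('h) $ n"
proof -
  have "{M. set_mset M \<subseteq> (modes_upto L :: ('h \<times> nat) set) \<and> wt M = n} = osc_weight (int n)"
    using assms mem_le_wt by (fastforce simp: osc_weight_def osc_basis_def modes_upto_def)
  then show ?thesis by (simp add: count_fps_def char_fps_def)
qed

lemma convergent_prod_one_minus_power:
  fixes z :: "'a::{real_normed_field,banach}"
  assumes "norm z < 1"
  shows "convergent_prod (\<lambda>n. 1 - z ^ (n + 1))"
proof (rule abs_convergent_prod_imp_convergent_prod, rule summable_imp_abs_convergent_prod)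
  have "summable (\<lambda>n. norm z * norm z ^ n)" using assms by (intro summable_mult summable_geometric) simp
  then show "summable (\<lambda>i. norm (1 - z ^ (i + 1) - 1))" by (simp add: norm_power norm_mult)
qed

lemma prod_one_minus_power_LIMSEQ:
  fixes z :: "'a::{real_normed_field,banach}"
  assumes "norm z < 1"
  shows "(\<lambda>L. \<Prod>m=1..L. 1 - z ^ m) \<longlonglongrightarrow> prodinf (\<lambda>n. 1 - z ^ (n + 1))"
proof -
  have "(\<Prod>m=1..Suc L. 1 - z ^ m) = (\<Prod>i\<le>L. 1 - z ^ (i + 1))" for L
    by (induction L) simp_all
  then have "(\<lambda>L. \<Prod>m=1..Suc L. 1 - z ^ m) \<longlonglongrightarrow> prodinf (\<lambda>n. 1 - z ^ (n + 1))"
    using convergent_prod_LIMSEQ[OF convergent_prod_one_minus_power[OF assms]] by simp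
  then show ?thesis by (rule LIMSEQ_imp_Suc)
qed

text \<open>For real \<open>0 < r < 1\<close>, the partial sums of the character at \<open>r\<close> are bounded by the values of
  its truncations, hence by the inverse of the infinite product.\<close>

lemma conv_radius_char_fps: "1 \<le> fps_conv_radius (char_fps TYPE('h::bilinear_form_space))"
  unfolding fps_conv_radius_def
proof (rule conv_radius_geI_ex')
  fix r :: real
  assume r: "0 < r" "ereal r < 1"
  let ?c = "\<lambda>n. card (osc_weight (int n) :: ('h \<times> nat) multiset set)" and ?d = "card (onb :: 'h set)"
  let ?p = "\<lambda>L. \<Prod>m=1..L. 1 - r ^ m"
  define P where "P = prodinf (\<lambda>n. 1 - r ^ (n + 1))"
  have r1: "r < 1" "norm r < 1" using r by auto
  have pow: "0 < 1 - r ^ (n + 1)" "1 - r ^ (n + 1) \<le> 1" for n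
    using r r1 power_Suc_less_one[of r n] by auto
  have P: "0 < P" unfolding P_def
    using convergent_prod_one_minus_power[OF r1(2)] pow(1) by (intro less_0_prodinf)
  have dec: "decseq ?p"
  proof (rule decseq_SucI)
    fix L
    have "0 \<le> ?p L" using r r1 by (intro prod_nonneg) (simp add: power_le_one)
    then show "?p (Suc L) \<le> ?p L" using pow(2)[of L] by (simp add: mult_left_le)
  qed
  have pP: "P \<le> ?p L" for L
    using decseq_ge[OF dec] prod_one_minus_power_LIMSEQ[OF r1(2)] by (simp add: P_def)
  have "summable (\<lambda>n. real (?c n) * r ^ n)"
  proof (rule bounded_imp_summable)
    fix L
    let ?F = "count_fps (modes_upto L :: ('h \<times> nat) set)"
    have zr: "norm (of_real r :: complex) < 1" using r1 r by simp
    have "\<forall>n. \<exists>k. ?F $ n = of_nat k" using count_fps_le_char[where 'h = 'h] by blast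
    then obtain k where k: "\<And>n. ?F $ n = of_nat (k n)" by metis
    have kc: "k n = ?c n" if "n \<le> L" for n
      using count_fps_eq_char[OF that, where 'h = 'h] by (simp add: k char_fps_def)
    have A: "finite (modes_upto L :: ('h \<times> nat) set)" "\<forall>x\<in>(modes_upto L :: ('h \<times> nat) set). 1 \<le> snd x"
      by (auto simp: modes_upto_def)
    have "ereal (norm (of_real r :: complex)) < fps_conv_radius ?F"
      by (rule norm_less_conv_radius[OF zr conv_radius_count_fps[OF A]])
    then have "(\<lambda>n. ?F $ n * of_real r ^ n) sums eval_fps ?F (of_real r)" by (rule sums_eval_fps)
    then have "(\<lambda>n. Re (?F $ n * of_real r ^ n)) sums Re (eval_fps ?F (of_real r))" by (rule sums_Re)
    moreover have "Re (?F $ n * of_real r ^ n) = real (k n) * r ^ n" for n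
      unfolding k of_real_power[symmetric] by (simp add: Re_complex_of_real)
    ultimately have sums: "(\<lambda>n. real (k n) * r ^ n) sums Re (eval_fps ?F (of_real r))" by (simp only:)
    have pos: "0 < ?p L" using P pP[of L] by simp
    have "?p L \<noteq> 0" using pos by linarith
    then have "complex_of_real (?p L) \<noteq> 0" by (simp only: of_real_eq_0_iff not_False_eq_True)
    then have nz: "complex_of_real (?p L) ^ ?d \<noteq> 0" by (rule power_not_zero)
    have "eval_fps ?F (of_real r) * of_real (?p L) ^ ?d = 1"
      using eval_count_fps[OF zr, of L, where 'h = 'h] by simp
    then have "eval_fps ?F (of_real r) = 1 / complex_of_real (?p L) ^ ?d"
      using nonzero_eq_divide_eq[OF nz] by blast
    also have "\<dots> = of_real (1 / ?p L ^ ?d)" by (simp only: of_real_divide of_real_power of_real_1)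
    finally have val: "Re (eval_fps ?F (of_real r)) = 1 / ?p L ^ ?d" by (simp only: Re_complex_of_real)
    \<comment> \<open>Restricting to the variables of index at most \<open>L\<close> does not change
      coefficients up to degree \<open>L\<close>; the further terms of the truncated series are
      non-negative.\<close>
    have "(\<Sum>n\<le>L. real (?c n) * r ^ n) = (\<Sum>n\<le>L. real (k n) * r ^ n)" by (simp add: kc)
    also have "\<dots> \<le> suminf (\<lambda>n. real (k n) * r ^ n)"
      using sums_summable[OF sums] r by (intro sum_le_suminf) auto
    also have "\<dots> = 1 / ?p L ^ ?d" using sums_unique[OF sums] val by simp
    also have "\<dots> \<le> 1 / P ^ ?d"
      using P pP[of L] by (intro divide_left_mono power_mono mult_pos_pos zero_less_power) (auto intro: pos)
    finally show "(\<Sum>n\<le>L. real (?c n) * r ^ n) \<le> 1 / P ^ ?d" .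
  qed (use r in simp)
  then have "summable (\<lambda>n. complex_of_real (real (?c n) * r ^ n))" by (simp only: summable_of_real_iff)
  then show "summable (\<lambda>n. char_fps TYPE('h) $ n * of_real r ^ n)" by (simp add: char_fps_def)
qed

text \<open>The product identity holds for finitely many variables. Coefficients of the truncations
  are dominated by those of the character, which converges absolutely, so Tannery's theorem permits
  the limit.\<close>

lemma eval_char_fps:
  assumes z: "norm z < 1"
  shows "eval_fps (char_fps TYPE('h::bilinear_form_space)) z * prodinf (\<lambda>n. 1 - z ^ (n + 1)) ^ card (onb :: 'h set) = 1"
proof -
  let ?d = "card (onb :: 'h set)" and ?F = "\<lambda>L. count_fps (modes_upto L :: ('h \<times> nat) set)"
  let ?C = "char_fps TYPE('h)"
  have z': "ereal (norm z) < fps_conv_radius ?C"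
    by (rule norm_less_conv_radius[OF z conv_radius_char_fps])
  have "summable (\<lambda>n. norm (?C $ n * z ^ n))"
    using z' unfolding fps_conv_radius_def by (rule abs_summable_in_conv_radius)
  moreover have "norm (?F L $ n * z ^ n) \<le> norm (?C $ n * z ^ n)" for L n
    using count_fps_le_char[of L n, where 'h = 'h] by (auto simp: char_fps_def norm_mult intro!: mult_right_mono)
  moreover have "(\<lambda>L. ?F L $ n * z ^ n) \<longlonglongrightarrow> ?C $ n * z ^ n" for n
  proof (rule tendsto_eventually)
    show "\<forall>\<^sub>F L in sequentially. ?F L $ n * z ^ n = ?C $ n * z ^ n"
      using eventually_ge_at_top[of n] by eventually_elim (simp add: count_fps_eq_char)
  qed
  ultimately have "(\<lambda>L. suminf (\<lambda>n. fps_nth (?F L) n * z ^ n)) \<longlonglongrightarrow> suminf (\<lambda>n. fps_nth ?C n * z ^ n)"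
    using tannerys_theorem[of "\<lambda>n L. ?F L $ n * z ^ n" "\<lambda>n. ?C $ n * z ^ n" sequentially "\<lambda>n. norm (?C $ n * z ^ n)"]
    by (simp add: case_prod_unfold)
  then have "(\<lambda>L. eval_fps (?F L) z) \<longlonglongrightarrow> eval_fps ?C z" by (simp add: eval_fps_def)
  then have "(\<lambda>L. eval_fps (?F L) z * (\<Prod>m=1..L. 1 - z ^ m) ^ ?d) \<longlonglongrightarrow>
      eval_fps ?C z * prodinf (\<lambda>n. 1 - z ^ (n + 1)) ^ ?d"
    by (intro tendsto_mult tendsto_power prod_one_minus_power_LIMSEQ z)
  then have "(\<lambda>L. 1) \<longlonglongrightarrow> eval_fps ?C z * prodinf (\<lambda>n. 1 - z ^ (n + 1)) ^ ?d"
    by (simp only: eval_count_fps[OF z])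
  then show ?thesis using LIMSEQ_unique tendsto_const by blast
qed

section \<open>Quasi-modular forms\<close>

lemma norm_nome:
  assumes "\<tau> \<in> upper_half_plane"
  shows "norm (nome \<tau>) < 1"
  using assms by (simp add: nome_def upper_half_plane_def norm_exp_eq_Re mult_pos_pos)

lemma eval_lambert_fps:
  assumes "norm z < 1"
  shows "eval_fps (lambert_fps k) z = suminf (\<lambda>n. of_nat (divisor_sigma k (n + 1)) * z ^ (n + 1))"
proof -
  have "(\<lambda>n. lambert_fps k $ n * z ^ n) sums eval_fps (lambert_fps k) z"
    by (rule sums_eval_fps[OF norm_less_conv_radius[OF assms conv_radius_lambert_fps]])
  then have "(\<lambda>n. lambert_fps k $ (Suc n) * z ^ (Suc n)) sums eval_fps (lambert_fps k) z"
    by (subst sums_Suc_iff) (simp add: lambert_fps_nth)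
  then have "(\<lambda>n. of_nat (divisor_sigma k (n + 1)) * z ^ (n + 1)) sums eval_fps (lambert_fps k) z"
    by (simp add: lambert_fps_nth)
  then show ?thesis by (rule sums_unique)
qed

lemma eisenstein_eval:
  assumes "\<tau> \<in> upper_half_plane"
  shows "eisenstein k \<tau> = - bernoulli (2 * k) / fact (2 * k) +
    2 / fact (2 * k - 1) * eval_fps (lambert_fps (2 * k - 1)) (nome \<tau>)"
  unfolding eisenstein_def eval_lambert_fps[OF norm_nome[OF assms]] ..

lemma quasi_modular_imp_lambert_ring:
  assumes "f \<in> quasi_modular"
  shows "\<exists>h\<in>lambert_ring. \<forall>\<tau>\<in>upper_half_plane. f \<tau> = eval_fps h (nome \<tau>)"
proof -
  have E: "\<exists>h\<in>lambert_ring. \<forall>\<tau>\<in>upper_half_plane. eisenstein k \<tau> = eval_fps h (nome \<tau>)"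
    if L: "lambert_fps (2 * k - 1) \<in> lambert_ring" for k
  proof (intro bexI ballI)
    let ?a = "- bernoulli (2 * k) / fact (2 * k)" and ?b = "2 / fact (2 * k - 1) :: complex"
    let ?h = "fps_const ?a + fps_const ?b * lambert_fps (2 * k - 1)"
    show "?h \<in> lambert_ring" by (intro lambert_ring.add lambert_ring.mult lambert_ring.const L)
    fix \<tau>
    assume \<tau>: "\<tau> \<in> upper_half_plane"
    have r: "ereal (norm (nome \<tau>)) < fps_conv_radius g" if "g \<in> lambert_ring" for g
      by (rule norm_less_conv_radius[OF norm_nome[OF \<tau>] conv_radius_lambert_ring[OF that]])
    have "eval_fps ?h (nome \<tau>) = eval_fps (fps_const ?a) (nome \<tau>)
        + eval_fps (fps_const ?b) (nome \<tau>) * eval_fps (lambert_fps (2 * k - 1)) (nome \<tau>)"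
      by (subst eval_fps_add; (subst eval_fps_mult)?) (intro r lambert_ring.mult lambert_ring.const L refl)+
    then show "eisenstein k \<tau> = eval_fps ?h (nome \<tau>)"
      by (simp only: eisenstein_eval[OF \<tau>] eval_fps_const)
  qed
  show ?thesis
    using assms
  proof induction
    case (const c)
    show ?case by (intro bexI[of _ "fps_const c"]) (simp_all add: lambert_ring.const)
  next
    case E2
    show ?case by (rule E) (use lambert_ring.L1 in simp)
  next
    case E4
    show ?case by (rule E) (use lambert_ring.L3 in simp)
  next
    case E6
    show ?case by (rule E) (use lambert_ring.L5 in simp)
  next
    case (add f g)
    then obtain h h' where h: "h \<in> lambert_ring" "h' \<in> lambert_ring"
      "\<forall>\<tau>\<in>upper_half_plane. f \<tau> = eval_fps h (nome \<tau>)" "\<forall>\<tau>\<in>upper_half_plane. g \<tau> = eval_fps h' (nome \<tau>)"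
      by blast
    then show ?case
      by (intro bexI[of _ "h + h'"])
        (auto simp: eval_fps_add norm_less_conv_radius[OF norm_nome] conv_radius_lambert_ring intro: lambert_ring.add)
  next
    case (mult f g)
    then obtain h h' where h: "h \<in> lambert_ring" "h' \<in> lambert_ring"
      "\<forall>\<tau>\<in>upper_half_plane. f \<tau> = eval_fps h (nome \<tau>)" "\<forall>\<tau>\<in>upper_half_plane. g \<tau> = eval_fps h' (nome \<tau>)"
      by blast
    then show ?case
      by (intro bexI[of _ "h * h'"])
        (auto simp: eval_fps_mult norm_less_conv_radius[OF norm_nome] conv_radius_lambert_ring intro: lambert_ring.mult)
  qed
qed

lemma lambert_ring_imp_quasi_modular:
  assumes "h \<in> lambert_ring"
  shows "\<exists>f\<in>quasi_modular. \<forall>\<tau>\<in>upper_half_plane. f \<tau> = eval_fps h (nome \<tau>)"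
proof -
  have L: "\<exists>f\<in>quasi_modular. \<forall>\<tau>\<in>upper_half_plane. f \<tau> = eval_fps (lambert_fps (2 * k - 1)) (nome \<tau>)"
    if E: "eisenstein k \<in> quasi_modular" for k
  proof (intro bexI ballI)
    let ?a = "- bernoulli (2 * k) / fact (2 * k)" and ?b = "2 / fact (2 * k - 1) :: complex"
    \<comment> \<open>The constants are written as functions so that the closure rules of
      \<open>quasi_modular\<close> match syntactically.\<close>
    let ?f = "\<lambda>\<tau>. (\<lambda>\<tau>. inverse ?b) \<tau> * (\<lambda>\<tau>. eisenstein k \<tau> + (\<lambda>\<tau>. - ?a) \<tau>) \<tau>"
    show "?f \<in> quasi_modular" by (intro quasi_modular.mult quasi_modular.add quasi_modular.const E)
    fix \<tau>
    assume \<tau>: "\<tau> \<in> upper_half_plane"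
    have nz: "?b \<noteq> 0" by simp
    show "?f \<tau> = eval_fps (lambert_fps (2 * k - 1)) (nome \<tau>)"
      by (simp only: eisenstein_eval[OF \<tau>] add.commute[of ?a] add.assoc add.right_inverse add_0_right
          mult.assoc[symmetric] left_inverse[OF nz] mult_1_left)
  qed
  show ?thesis
    using assms
  proof induction
    case (const c)
    show ?case by (intro bexI[of _ "\<lambda>\<tau>. c"]) (simp_all add: quasi_modular.const)
  next
    case L1
    show ?case using L[OF quasi_modular.E2] by simp
  next
    case L3
    show ?case using L[OF quasi_modular.E4] by simp
  next
    case L5
    show ?case using L[OF quasi_modular.E6] by simp
  next
    case (add h h')
    then obtain f g where fg: "f \<in> quasi_modular" "g \<in> quasi_modular"
      "\<forall>\<tau>\<in>upper_half_plane. f \<tau> = eval_fps h (nome \<tau>)" "\<forall>\<tau>\<in>upper_half_plane. g \<tau> = eval_fps h' (nome \<tau>)"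
      by blast
    show ?case
      by (rule bexI[OF _ quasi_modular.add[OF fg(1,2)]])
        (use fg add in \<open>simp add: eval_fps_add norm_less_conv_radius[OF norm_nome] conv_radius_lambert_ring\<close>)
  next
    case (mult h h')
    then obtain f g where fg: "f \<in> quasi_modular" "g \<in> quasi_modular"
      "\<forall>\<tau>\<in>upper_half_plane. f \<tau> = eval_fps h (nome \<tau>)" "\<forall>\<tau>\<in>upper_half_plane. g \<tau> = eval_fps h' (nome \<tau>)"
      by blast
    show ?case
      by (rule bexI[OF _ quasi_modular.mult[OF fg(1,2)]])
        (use fg mult in \<open>simp add: eval_fps_mult norm_less_conv_radius[OF norm_nome] conv_radius_lambert_ring\<close>)
  qed
qed

text \<open>The prefactor of \<open>trace_term\<close> is the inverse of the \<open>d\<close>-th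
  power of the exponential factor of \<open>dedekind_eta\<close>, and the character is the inverse
  of the \<open>d\<close>-th power of its product.\<close>

lemma trace_function_converges:
  fixes v :: "'h::bilinear_form_space fock"
  assumes h: "h \<in> lambert_ring" and v: "trace_fps (zero_mode v) = h * char_fps TYPE('h)"
    and f: "\<forall>\<tau>\<in>upper_half_plane. f \<tau> = eval_fps h (nome \<tau>)"
    and d: "complex_vector.dim (UNIV :: 'h set) = d"
  shows "trace_function_converges_to v (\<lambda>\<tau>. f \<tau> / dedekind_eta \<tau> ^ d)"
proof -
  let ?C = "char_fps TYPE('h)" and ?T = "h * char_fps TYPE('h)"
  let ?e = "\<lambda>\<tau>. exp (- (2 * of_real pi * \<i> * \<tau> * of_nat d / 24))"
  have r: "1 \<le> fps_conv_radius ?T"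
    using fps_conv_radius_mult[of h ?C] conv_radius_lambert_ring[OF h] conv_radius_char_fps[where 'h = 'h]
    by (meson min.boundedI order_trans)
  have val: "?e \<tau> * eval_fps ?T (nome \<tau>) = f \<tau> / dedekind_eta \<tau> ^ d" if \<tau>: "\<tau> \<in> upper_half_plane" for \<tau>
  proof -
    define p where "p = prodinf (\<lambda>n. 1 - nome \<tau> ^ (n + 1))"
    have Cp: "eval_fps ?C (nome \<tau>) * p ^ d = 1"
      using eval_char_fps[OF norm_nome[OF \<tau>], where 'h = 'h] by (simp add: card_onb d p_def)
    then have pd: "p ^ d \<noteq> 0" by force
    have C: "eval_fps ?C (nome \<tau>) = 1 / p ^ d" using Cp nonzero_eq_divide_eq[OF pd] by blast
    have T: "eval_fps ?T (nome \<tau>) = eval_fps h (nome \<tau>) * eval_fps ?C (nome \<tau>)"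
      by (intro eval_fps_mult norm_less_conv_radius[OF norm_nome[OF \<tau>]] conv_radius_lambert_ring[OF h]
          conv_radius_char_fps)
    have eta: "dedekind_eta \<tau> ^ d = p ^ d / ?e \<tau>"
    proof -
      have "exp (2 * of_real pi * \<i> * \<tau> / 24) ^ d = exp (2 * of_real pi * \<i> * \<tau> * of_nat d / 24)"
        by (simp add: exp_of_nat_mult[symmetric] mult_ac)
      then show ?thesis
        by (simp add: dedekind_eta_def p_def power_mult_distrib exp_minus field_simps)
    qed
    show ?thesis unfolding T C eta f[rule_format, OF \<tau>] by simp
  qed
  have "trace_term v \<tau> sums (f \<tau> / dedekind_eta \<tau> ^ d)" if \<tau>: "\<tau> \<in> upper_half_plane" for \<tau>
  proof -
    have t: "subspace_trace (weight_space n) (zero_mode v) = ?T $ n" for n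
      unfolding v[symmetric] by (simp add: subspace_trace_weight_space[OF lowers_zero_mode] trace_fps_def)
    have "(\<lambda>n. ?T $ n * nome \<tau> ^ n) sums eval_fps ?T (nome \<tau>)"
      by (rule sums_eval_fps[OF norm_less_conv_radius[OF norm_nome[OF \<tau>] r]])
    then have "(\<lambda>n. ?e \<tau> * (?T $ n * nome \<tau> ^ n)) sums (?e \<tau> * eval_fps ?T (nome \<tau>))"
      by (rule sums_mult)
    moreover have "trace_term v \<tau> = (\<lambda>n. ?e \<tau> * (?T $ n * nome \<tau> ^ n))"
      by (rule ext) (simp only: trace_term_def t d)
    ultimately show ?thesis by (simp only: val[OF \<tau>])
  qed
  \<comment> \<open>Holomorphy is taken from the power series composed with \<open>nome\<close>,
    which avoids proving that \<open>dedekind_eta\<close> is holomorphic. By \<open>val\<close> the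
    two functions agree on the upper half plane.\<close>
  moreover have "(\<lambda>\<tau>. f \<tau> / dedekind_eta \<tau> ^ d) holomorphic_on upper_half_plane"
  proof (rule holomorphic_transform)
    have "nome holomorphic_on upper_half_plane"
      unfolding nome_def[abs_def] by (intro holomorphic_intros)
    moreover have "eval_fps ?T holomorphic_on nome ` upper_half_plane"
      by (rule holomorphic_on_eval_fps) (use norm_less_conv_radius[OF norm_nome r] in \<open>auto simp: in_eball_iff\<close>)
    ultimately have "(eval_fps ?T \<circ> nome) holomorphic_on upper_half_plane"
      by (rule holomorphic_on_compose)
    then show "(\<lambda>\<tau>. ?e \<tau> * eval_fps ?T (nome \<tau>)) holomorphic_on upper_half_plane"
      unfolding comp_def by (intro holomorphic_intros) auto
  qed (rule val)
  ultimately show ?thesis by (simp add: trace_function_converges_to_def)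
qed

theorem theorem1:
  fixes d :: nat
  assumes "d \<ge> 1" and "complex_vector.dim (UNIV :: 'h::bilinear_form_space set) = d"
  shows "(\<forall>v :: 'h fock. \<exists>f\<in>quasi_modular.
            trace_function_converges_to v (\<lambda>\<tau>. f \<tau> / dedekind_eta \<tau> ^ d)) \<and>
         (\<forall>f\<in>quasi_modular. \<exists>v :: 'h fock.
            trace_function_converges_to v (\<lambda>\<tau>. f \<tau> / dedekind_eta \<tau> ^ d))"
proof (intro conjI allI ballI)
  fix v :: "'h fock"
  obtain h where h: "h \<in> lambert_ring" "trace_fps (zero_mode v) = h * char_fps TYPE('h)"
    using trace_fps_zero_mode by blast
  obtain f where f: "f \<in> quasi_modular" "\<forall>\<tau>\<in>upper_half_plane. f \<tau> = eval_fps h (nome \<tau>)"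
    using lambert_ring_imp_quasi_modular[OF h(1)] by blast
  show "\<exists>f\<in>quasi_modular. trace_function_converges_to v (\<lambda>\<tau>. f \<tau> / dedekind_eta \<tau> ^ d)"
    using f(1) trace_function_converges[OF h f(2) assms(2)] by blast
next
  fix f
  assume "f \<in> quasi_modular"
  then obtain h where h: "h \<in> lambert_ring" "\<forall>\<tau>\<in>upper_half_plane. f \<tau> = eval_fps h (nome \<tau>)"
    using quasi_modular_imp_lambert_ring by blast
  have "h \<in> trace_image TYPE('h)" using assms h(1) by (intro lambert_ring_in_image) simp_all
  then obtain v :: "'h fock" where "trace_fps (zero_mode v) = h * char_fps TYPE('h)"
    by (auto simp: trace_image_def)
  from trace_function_converges[OF h(1) this h(2) assms(2)]
  show "\<exists>v :: 'h fock. trace_function_converges_to v (\<lambda>\<tau>. f \<tau> / dedekind_eta \<tau> ^ d)" by blast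
qed


end
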